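(* Let $a\ge 4$ be an integer and let $\rho$ be a root of the polynomial $x^3+(a-1)x^2-ax-1$. Then the Pythagoras number of the ring $\mathbb{Z}[\rho]$ satisfies $\mathcal{P}(\mathbb{Z}[\rho])=6$.
   Context: For a commutative ring $\mathcal{O}$, let $\sum\mathcal{O}^2$ be the set of all elements of $\mathcal{O}$ that are sums of (finitely many) squares of elements of $\mathcal{O}$, and for $m\in\mathbb{N}$ let $\sum^m\mathcal{O}^2$ be the set of elements that are sums of at most $m$ squares of elements of $\mathcal{O}$. The Pythagoras number of $\mathcal{O}$ is $\mathcal{P}(\mathcal{O})=\inf\{m\in\mathbb{N}\cup\{\infty\} : \sum\mathcal{O}^2=\sum^m\mathcal{O}^2\}$. *)

theory Defs
  imports Complex_Main "HOL-Library.Extended_Nat" "HOL-Computational_Algebra.Polynomial"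
begin

text \<open>A commutative ring is represented by a subring of a type of class \<^class>\<open>comm_ring_1\<close>
  (take the whole type for the ring of all elements of a type).
  The empty sum is allowed and has value 0.\<close>

definition sums_of_squares :: "'a::comm_ring_1 set \<Rightarrow> 'a set" where
  "sums_of_squares R = {\<Sum>x\<leftarrow>xs. x\<^sup>2 | xs. set xs \<subseteq> R}"

text \<open>For \<open>m = \<infinity>\<close> there is no bound on the number of squares.\<close>

definition sums_of_at_most_squares :: "enat \<Rightarrow> 'a::comm_ring_1 set \<Rightarrow> 'a set" where
  "sums_of_at_most_squares m R =
     {\<Sum>x\<leftarrow>xs. x\<^sup>2 | xs. set xs \<subseteq> R \<and> enat (length xs) \<le> m}"

definition pythagoras_number :: "'a::comm_ring_1 set \<Rightarrow> enat" where
  "pythagoras_number R = Inf {m. sums_of_squares R = sums_of_at_most_squares m R}"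

text \<open>The subring \<open>\<int>[x]\<close> generated by \<open>x\<close>.\<close>

definition int_adjoin :: "'a::comm_ring_1 \<Rightarrow> 'a set" where
  "int_adjoin x = range (\<lambda>p :: int poly. poly (map_poly of_int p) x)"

end

theory Submission
  imports Defs "HOL-Analysis.Analysis" "HOL-Number_Theory.Number_Theory" "HOL-Real_Asymp.Real_Asymp"
    "HOL-Library.Discrete_Functions" "HOL-Computational_Algebra.Squarefree"
begin

text \<open>For the lower bound, \<open>7 + \<rho>\<^sup>2 + (1 + 1/\<rho>)\<^sup>2\<close> is a sum of six squares, and comparing
  coefficients shows that five squares would make 7 a sum of three squares.

  For the upper bound, a sum of squares in \<open>\<int>[\<rho>]\<close> is determined by the Gram matrix of the coefficients of its
  terms in the basis \<open>1, \<rho>, 1/\<rho>\<close>, so it suffices that a ternary quadratic form which is a sum of squares of integral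
  linear forms is a sum of six of them (Mordell, Ko). Such a form embeds isometrically over \<open>\<rat>\<close> into
  \<open>\<rat>(\<i>)\<^sup>3 = \<rat>\<^sup>6\<close>; this rests on Legendre's theorem, applied with a prime that is found with the help of the real
  Dirichlet characters. The image of \<open>\<int>\<^sup>3\<close> is an integral family, which successive neighbours of \<open>\<int>\<^sup>6\<close> absorb into
  a unimodular lattice, and every unimodular lattice of rank 6 has an orthonormal basis by reduction theory.\<close>

section \<open>The cubic order\<close>

text \<open>The obstacle is the rational embedding: in six dimensions a ternary form leaves a
  ternary complement that would itself have to be constructed. The complex structure avoids this,
  because a hermitian form over Q(i) has hardly any invariants: a|p|^2 + b|q|^2 + ab|r|^2 is
  standard for all positive a and b. It remains to place the rational ternary form inside a form of
  this shape, and this comes down to one condition: (discriminant) * w^2 - (a value) * s^2 has to be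
  a sum of two squares. The prime enters here. If q is a sum of two squares, the difference may be q
  times a square, which is an equation within reach of Legendre's theorem; only quadratic characters
  of q get prescribed, hence the real Dirichlet characters. For the lower bound, 7 is the least
  positive integer that is not a sum of three squares. The two further squares occupy two
  coordinates, which leaves three of five for 7, and \<open>a \<ge> 4\<close> makes the coefficients
  so large that other Gram matrices are excluded.\<close>

text \<open>The last coefficient is that of \<open>1/\<rho> = \<rho>\<^sup>2 + (a - 1) \<rho> - a\<close>.\<close>

definition Zcomb :: "int \<Rightarrow> complex \<Rightarrow> int \<Rightarrow> int \<Rightarrow> int \<Rightarrow> complex" where
  "Zcomb a \<rho> u v w = of_int u + of_int v * \<rho> + of_int w * (\<rho>\<^sup>2 + of_int (a - 1) * \<rho> - of_int a)"

lemma Zcomb_mult_rho: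
  assumes "\<rho> ^ 3 + of_int (a - 1) * \<rho>\<^sup>2 - of_int a * \<rho> - 1 = 0"
  shows "\<rho> * Zcomb a \<rho> u v w = Zcomb a \<rho> (w + a * v) (u - (a - 1) * v) v"
proof -
  have "\<rho> * Zcomb a \<rho> u v w - Zcomb a \<rho> (w + a * v) (u - (a - 1) * v) v
      = of_int w * (\<rho> ^ 3 + of_int (a - 1) * \<rho>\<^sup>2 - of_int a * \<rho> - 1)"
    by (simp add: Zcomb_def algebra_simps power2_eq_square power3_eq_cube)
  with assms show ?thesis by simp
qed

lemma Zcomb_power2:
  assumes "\<rho> ^ 3 + of_int (a - 1) * \<rho>\<^sup>2 - of_int a * \<rho> - 1 = 0"
  shows "(Zcomb a \<rho> u v w)\<^sup>2 = Zcomb a \<rho> (u\<^sup>2 + a * v\<^sup>2 + (a - 1) * w\<^sup>2 + 2 * (v * w))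
           (w\<^sup>2 - (a - 1) * v\<^sup>2 + 2 * (u * v)) (v\<^sup>2 - a * w\<^sup>2 + 2 * (u * w))"
proof -
  have "(Zcomb a \<rho> u v w)\<^sup>2 - Zcomb a \<rho> (u\<^sup>2 + a * v\<^sup>2 + (a - 1) * w\<^sup>2 + 2 * (v * w))
           (w\<^sup>2 - (a - 1) * v\<^sup>2 + 2 * (u * v)) (v\<^sup>2 - a * w\<^sup>2 + 2 * (u * w))
      = (2 * of_int v * of_int w + of_int w ^ 2 * (\<rho> + of_int (a - 1))) *
        (\<rho> ^ 3 + of_int (a - 1) * \<rho>\<^sup>2 - of_int a * \<rho> - 1)"
    by (simp add: Zcomb_def) (simp add: algebra_simps power2_eq_square power3_eq_cube)
  with assms show ?thesis by simp
qed

text \<open>\<open>n\<close> is the norm of the element, written as the determinant of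
  multiplication in the basis 1, \<rho>, 1/\<rho>. Modulo 2 the cubic is x^3 + x^2 + 1 or x^3 + x +
  1, irreducible either way, so the norm form has only the trivial zero modulo 2. Linear
  independence of the basis follows by infinite descent.\<close>

lemma Zcomb_eq_0_imp_even:
  assumes \<rho>: "\<rho> ^ 3 + of_int (a - 1) * \<rho>\<^sup>2 - of_int a * \<rho> - 1 = 0"
    and z: "Zcomb a \<rho> u v w = 0"
  shows "even u \<and> even v \<and> even w"
proof -
  define n where "n = u * ((u - (a - 1) * v) * (u - a * w) - v * w)
    - v * ((w + a * v) * (u - a * w) - v * (v + (a - 1) * w))
    + w * ((w + a * v) * w - (u - (a - 1) * v) * (v + (a - 1) * w))"
  define \<sigma> where "\<sigma> = \<rho>\<^sup>2 + of_int (a - 1) * \<rho> - of_int a"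
  have rs: "\<rho> * \<sigma> = 1"
    using \<rho> by (simp add: \<sigma>_def algebra_simps power2_eq_square power3_eq_cube)
  have e1: "of_int u + of_int v * \<rho> + of_int w * \<sigma> = 0"
    using z by (simp add: Zcomb_def \<sigma>_def)
  have e2: "of_int (w + a * v) + of_int (u - (a - 1) * v) * \<rho> + of_int v * \<sigma> = 0"
    using Zcomb_mult_rho[OF \<rho>, of u v w] z by (simp add: Zcomb_def \<sigma>_def)
  have "\<rho> * (of_int (v + (a - 1) * w) + of_int w * \<rho> + of_int (u - a * w) * \<sigma>)
      = of_int u + of_int v * \<rho> + of_int w * \<sigma> + of_int w * (\<rho>\<^sup>2 - \<sigma> + of_int (a - 1) * \<rho> - of_int a)
        + (of_int u - of_int a * of_int w) * (\<rho> * \<sigma> - 1)"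
    by (simp add: algebra_simps power2_eq_square)
  also have "\<dots> = 0" using e1 rs by (simp add: \<sigma>_def)
  finally have e3: "of_int (v + (a - 1) * w) + of_int w * \<rho> + of_int (u - a * w) * \<sigma> = 0"
    using rs by auto
  \<comment> \<open>Cofactor expansion along the first column: the rows of the determinant are the
    coordinates of the element, of its product with \<rho> and of its quotient by \<rho>, all of
    which vanish.\<close>
  have "of_int n = ((of_int u - (of_int a - 1) * of_int v) * (of_int u - of_int a * of_int w) - of_int v * of_int w) * (of_int u + of_int v * \<rho> + of_int w * \<sigma>)
    - (of_int v * (of_int u - of_int a * of_int w) - of_int w * of_int w) * (of_int (w + a * v) + of_int (u - (a - 1) * v) * \<rho> + of_int v * \<sigma>)
    + (of_int v * of_int v - of_int w * (of_int u - (of_int a - 1) * of_int v)) * (of_int (v + (a - 1) * w) + of_int w * \<rho> + of_int (u - a * w) * \<sigma>)"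
    by (simp add: n_def) (simp add: algebra_simps)
  hence "(of_int n :: complex) = 0" unfolding e1 e2 e3 by simp
  hence "n = 0" by simp
  hence "even n" by simp
  thus ?thesis unfolding n_def
    by (cases "even a"; cases "even u"; cases "even v"; cases "even w") (simp_all)
qed

lemma Zcomb_eq_0:
  assumes \<rho>: "\<rho> ^ 3 + of_int (a - 1) * \<rho>\<^sup>2 - of_int a * \<rho> - 1 = 0"
    and "Zcomb a \<rho> u v w = 0"
  shows "u = 0 \<and> v = 0 \<and> w = 0"
  using assms(2)
proof (induction "nat (\<bar>u\<bar> + \<bar>v\<bar> + \<bar>w\<bar>)" arbitrary: u v w rule: less_induct)
  case less
  from Zcomb_eq_0_imp_even[OF \<rho> less.prems] obtain u' v' w'
    where *: "u = 2 * u'" "v = 2 * v'" "w = 2 * w'" by (auto elim!: evenE)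
  have "2 * Zcomb a \<rho> u' v' w' = 0"
    using less.prems by (simp add: * Zcomb_def algebra_simps)
  hence z: "Zcomb a \<rho> u' v' w' = 0" by simp
  show ?case
  proof (rule ccontr)
    assume "\<not> ?thesis"
    hence "nat (\<bar>u'\<bar> + \<bar>v'\<bar> + \<bar>w'\<bar>) < nat (\<bar>u\<bar> + \<bar>v\<bar> + \<bar>w\<bar>)" using * by auto
    with less.hyps[OF this z] * \<open>\<not> ?thesis\<close> show False by auto
  qed
qed

lemma Zcomb_inject:
  assumes \<rho>: "\<rho> ^ 3 + of_int (a - 1) * \<rho>\<^sup>2 - of_int a * \<rho> - 1 = 0"
    and "Zcomb a \<rho> u v w = Zcomb a \<rho> u' v' w'"
  shows "u = u' \<and> v = v' \<and> w = w'"
proof -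
  have "Zcomb a \<rho> (u - u') (v - v') (w - w') = 0"
    using assms(2) by (simp add: Zcomb_def algebra_simps)
  from Zcomb_eq_0[OF \<rho> this] show ?thesis by simp
qed

lemma int_adjoin_eq_Zcomb:
  assumes \<rho>: "\<rho> ^ 3 + of_int (a - 1) * \<rho>\<^sup>2 - of_int a * \<rho> - 1 = 0"
  shows "int_adjoin \<rho> = {Zcomb a \<rho> u v w | u v w. True}"
proof (intro equalityI subsetI)
  fix x assume "x \<in> int_adjoin \<rho>"
  then obtain p :: "int poly" where p: "x = poly (map_poly of_int p) \<rho>"
    by (auto simp: int_adjoin_def)
  have "\<exists>u v w. poly (map_poly of_int p) \<rho> = Zcomb a \<rho> u v w"
  proof (induction p)
    case 0
    have "poly (map_poly of_int 0) \<rho> = Zcomb a \<rho> 0 0 0" by (simp add: Zcomb_def)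
    thus ?case by blast
  next
    case (pCons c p)
    then obtain u v w where "poly (map_poly of_int p) \<rho> = Zcomb a \<rho> u v w" by blast
    hence "poly (map_poly of_int (pCons c p)) \<rho> = of_int c + \<rho> * Zcomb a \<rho> u v w"
      by (simp add: map_poly_pCons)
    also have "\<dots> = Zcomb a \<rho> (c + (w + a * v)) (u - (a - 1) * v) v"
      by (subst Zcomb_mult_rho[OF \<rho>]) (simp add: Zcomb_def)
    finally show ?case by blast
  qed
  thus "x \<in> {Zcomb a \<rho> u v w | u v w. True}" using p by blast
next
  fix x assume "x \<in> {Zcomb a \<rho> u v w | u v w. True}"
  then obtain u v w where "x = Zcomb a \<rho> u v w" by blast
  hence "x = poly (map_poly of_int [:u - a * w, v + (a - 1) * w, w:]) \<rho>"
    by (simp add: Zcomb_def map_poly_pCons algebra_simps power2_eq_square)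
  thus "x \<in> int_adjoin \<rho>" unfolding int_adjoin_def by blast
qed

lemma Zcomb_add: "Zcomb a \<rho> u v w + Zcomb a \<rho> u' v' w' = Zcomb a \<rho> (u + u') (v + v') (w + w')"
  by (simp add: Zcomb_def algebra_simps)

lemma Zcomb_0: "Zcomb a \<rho> 0 0 0 = 0"
  by (simp add: Zcomb_def)

lemma Zcomb_sum:
  "(\<Sum>i\<in>I. Zcomb a \<rho> (u i) (v i) (w i)) = Zcomb a \<rho> (\<Sum>i\<in>I. u i) (\<Sum>i\<in>I. v i) (\<Sum>i\<in>I. w i)"
  by (induction I rule: infinite_finite_induct) (simp_all add: Zcomb_0 Zcomb_add)

section \<open>A sum of squares that is not a sum of five squares\<close>

lemma sum_mult_power2_le:
  fixes f g :: "'a \<Rightarrow> int"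
  shows "(\<Sum>i\<in>I. f i * g i)\<^sup>2 \<le> (\<Sum>i\<in>I. (f i)\<^sup>2) * (\<Sum>i\<in>I. (g i)\<^sup>2)"
proof -
  have "(\<Sum>i\<in>I. real_of_int (f i) * real_of_int (g i))\<^sup>2
      \<le> (\<Sum>i\<in>I. (real_of_int (f i))\<^sup>2) * (\<Sum>i\<in>I. (real_of_int (g i))\<^sup>2)"
    by (rule Cauchy_Schwarz_ineq_sum)
  hence "real_of_int ((\<Sum>i\<in>I. f i * g i)\<^sup>2) \<le> real_of_int ((\<Sum>i\<in>I. (f i)\<^sup>2) * (\<Sum>i\<in>I. (g i)\<^sup>2))"
    by simp
  thus ?thesis by linarith
qed

lemma sum_three_squares_neq_7:
  fixes f :: "'a \<Rightarrow> int"
  assumes "finite I" "card I \<le> 3"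
  shows "(\<Sum>i\<in>I. (f i)\<^sup>2) \<noteq> 7"
proof
  assume 7: "(\<Sum>i\<in>I. (f i)\<^sup>2) = 7"
  have sq: "\<exists>k. x\<^sup>2 = 8 * k \<or> x\<^sup>2 = 8 * k + 1 \<or> x\<^sup>2 = 8 * k + 4" for x :: int
  proof -
    have "\<exists>j. x = 4 * j \<or> x = 4 * j + 1 \<or> x = 4 * j + 2 \<or> x = 4 * j + 3"
      by presburger
    then obtain j where "x = 4 * j \<or> x = 4 * j + 1 \<or> x = 4 * j + 2 \<or> x = 4 * j + 3" ..
    hence "x\<^sup>2 = 8 * (2 * j\<^sup>2) \<or> x\<^sup>2 = 8 * (2 * j\<^sup>2 + j) + 1 \<or> x\<^sup>2 = 8 * (2 * j\<^sup>2 + 2 * j) + 4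
        \<or> x\<^sup>2 = 8 * (2 * j\<^sup>2 + 3 * j + 1) + 1"
      by (auto simp: power2_eq_square algebra_simps)
    thus ?thesis by blast
  qed
  have main: "x\<^sup>2 + y\<^sup>2 + z\<^sup>2 \<noteq> 7" for x y z :: int
    using sq[of x] sq[of y] sq[of z] by (elim exE disjE) presburger+
  from assms(2) consider "card I = 0" | "card I = 1" | "card I = 2" | "card I = 3" by linarith
  thus False
  proof cases
    case 1 thus False using 7 assms(1) by simp
  next
    case 2
    then obtain i where "I = {i}" by (auto simp: card_1_singleton_iff)
    thus False using 7 main[of "f i" 0 0] by simp
  next
    case 3
    then obtain i j where "I = {i, j}" "i \<noteq> j" by (auto simp: card_2_iff)
    thus False using 7 main[of "f i" "f j" 0] by simp
  next
    case 4
    then obtain i j k where "I = {i, j, k}" "i \<noteq> j" "j \<noteq> k" "i \<noteq> k" by (auto simp: card_3_iff)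
    thus False using 7 main[of "f i" "f j" "f k"] by (simp add: add.assoc)
  qed
qed

lemma sum_power2_eq_1:
  fixes f :: "'a \<Rightarrow> int"
  assumes "finite I" "(\<Sum>i\<in>I. (f i)\<^sup>2) = 1"
  obtains i where "i \<in> I" "(f i)\<^sup>2 = 1" "\<And>j. j \<in> I \<Longrightarrow> j \<noteq> i \<Longrightarrow> f j = 0"
proof -
  obtain i where i: "i \<in> I" "f i \<noteq> 0"
    using assms(2) sum.neutral[of I "\<lambda>i. (f i)\<^sup>2"] by fastforce
  have "(\<Sum>i\<in>I. (f i)\<^sup>2) = (f i)\<^sup>2 + (\<Sum>j\<in>I - {i}. (f j)\<^sup>2)"
    using assms(1) i(1) by (rule sum.remove)
  moreover have "(\<Sum>j\<in>I - {i}. (f j)\<^sup>2) \<ge> 0" by (rule sum_nonneg) simp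
  moreover have "(f i)\<^sup>2 > 0" using i(2) by simp
  ultimately have "(f i)\<^sup>2 = 1" and s: "(\<Sum>j\<in>I - {i}. (f j)\<^sup>2) = 0" using assms(2) by linarith+
  moreover have "f j = 0" if "j \<in> I" "j \<noteq> i" for j
  proof -
    have "\<forall>j\<in>I - {i}. (f j)\<^sup>2 = 0"
      using s assms(1) by (simp add: sum_nonneg_eq_0_iff)
    with that show ?thesis by simp
  qed
  ultimately show ?thesis using that i(1) by blast
qed

text \<open>The three equations are the coefficients, in the basis \<open>1, \<rho>, 1/\<rho>\<close>, of a representation of
  \<open>7 + \<rho>\<^sup>2 + (1 + 1/\<rho>)\<^sup>2\<close> as a sum of squares. They force the Gram matrix of the coefficient vectors
  to be the one of the defining representation, in which 7 has to be a sum of three squares.\<close>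

lemma five_squares_impossible:
  fixes a :: int and u v w :: "'a \<Rightarrow> int"
  assumes a: "a \<ge> 4" and I: "finite I" "card I \<le> 5"
    and e0: "(\<Sum>i\<in>I. (u i)\<^sup>2 + a * (v i)\<^sup>2 + (a - 1) * (w i)\<^sup>2 + 2 * (v i * w i)) = 7 + 2 * a"
    and e1: "(\<Sum>i\<in>I. (w i)\<^sup>2 - (a - 1) * (v i)\<^sup>2 + 2 * (u i * v i)) = 2 - a"
    and e2: "(\<Sum>i\<in>I. (v i)\<^sup>2 - a * (w i)\<^sup>2 + 2 * (u i * w i)) = 3 - a"
  shows False
proof -
  define U V W C S T where "U = (\<Sum>i\<in>I. (u i)\<^sup>2)" and "V = (\<Sum>i\<in>I. (v i)\<^sup>2)"
    and "W = (\<Sum>i\<in>I. (w i)\<^sup>2)" and "C = (\<Sum>i\<in>I. v i * w i)"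
    and "S = (\<Sum>i\<in>I. u i * v i)" and "T = (\<Sum>i\<in>I. u i * w i)"
  note defs = U_def V_def W_def C_def S_def T_def
  have E0: "U + a * V + (a - 1) * W + 2 * C = 7 + 2 * a"
    using e0 by (simp add: sum.distrib sum_distrib_left[symmetric] defs)
  have E1: "W - (a - 1) * V + 2 * S = 2 - a"
    using e1 by (simp add: sum.distrib sum_subtractf sum_distrib_left[symmetric] defs)
  have E2: "V - a * W + 2 * T = 3 - a"
    using e2 by (simp add: sum.distrib sum_subtractf sum_distrib_left[symmetric] defs)
  have nn: "U \<ge> 0" "V \<ge> 0" "W \<ge> 0" unfolding defs by (auto intro: sum_nonneg)
  have CS: "C\<^sup>2 \<le> V * W" "S\<^sup>2 \<le> U * V" "T\<^sup>2 \<le> U * W"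
    unfolding defs by (rule sum_mult_power2_le)+
  have par: "odd V \<and> odd W"
  proof -
    have "(2 - a) - (W - (a - 1) * V) = 2 * S" "(3 - a) - (V - a * W) = 2 * T"
      using E1 E2 by simp_all
    hence "even ((2 - a) - (W - (a - 1) * V))" "even ((3 - a) - (V - a * W))" by simp_all
    thus ?thesis by (cases "even a"; cases "even V"; cases "even W") simp_all
  qed
  \<comment> \<open>The first coefficient contains \<open>2 * C\<close>, so an upper bound on
    \<open>U\<close> needs a lower bound on \<open>C\<close>. It comes from the norm of v + w; with
    \<open>a \<ge> 4\<close> it leaves five pairs of values for the odd numbers \<open>V\<close> and
    \<open>W\<close>.\<close>
  have "0 \<le> (\<Sum>i\<in>I. (v i + w i)\<^sup>2)" by (rule sum_nonneg) simp
  also have "(\<Sum>i\<in>I. (v i + w i)\<^sup>2) = V + W + 2 * C"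
    unfolding defs by (simp add: power2_sum sum.distrib sum_distrib_left mult.assoc)
  finally have C: "V + W + 2 * C \<ge> 0" .
  obtain V' W' where VW: "V = 2 * V' + 1" "W = 2 * W' + 1" using par by (auto elim!: oddE)
  have nn': "V' \<ge> 0" "W' \<ge> 0" using nn VW by auto
  have S: "S = (a - 1) * V' - W'" using E1 VW by (simp add: algebra_simps)
  have T: "T = 1 + a * W' - V'" using E2 VW by (simp add: algebra_simps)
  have UC: "U = 8 - 2 * (a * V') - 2 * ((a - 1) * W') - 2 * C" using E0 VW by (simp add: algebra_simps)
  have aV: "a * V' \<ge> 4 * V'" and aW: "a * W' \<ge> 4 * W'" using a nn' by (auto intro: mult_right_mono)
  have bnd: "U \<le> 10 - 2 * (a * V') + 2 * V' - 2 * (a * W') + 4 * W'"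
    using UC C VW by (simp add: algebra_simps)
  have "6 * V' + 4 * W' \<le> 10" using bnd nn aV aW by linarith
  hence "(V' = 0 \<and> W' = 0) \<or> (V' = 1 \<and> W' = 0) \<or> (V' = 0 \<and> W' = 1) \<or> (V' = 1 \<and> W' = 1)
       \<or> (V' = 0 \<and> W' = 2)" using nn' by presburger
  then consider "V' = 0" "W' = 0" | "V' = 1" "W' = 0" | "V' = 0" "W' = 1" | "V' = 1" "W' = 1"
    | "V' = 0" "W' = 2" by blast
  thus False
  proof cases
    \<comment> \<open>Here \<open>bnd\<close> alone does not contradict the size of \<open>S\<close>
      when a = 4; Cauchy-Schwarz for \<open>C\<close> sharpens it to
      \<open>U \<le> 10 - 2 * a\<close>.\<close>
    case 2
    have "C\<^sup>2 \<le> 3" using CS(1) VW 2 by simp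
    hence "\<bar>C\<bar> < 2" by (intro power2_less_imp_less[of "\<bar>C\<bar>" 2]) auto
    hence "C \<ge> -1" by simp
    hence "U \<le> 10 - 2 * a" using UC 2 by simp
    hence "U \<le> 2" "a - 1 \<ge> 3" using a by auto
    hence "S\<^sup>2 \<le> 6" using CS(2) VW 2 by simp
    moreover have "S\<^sup>2 \<ge> 3\<^sup>2" using S 2 a by (intro power_mono) auto
    ultimately show False by simp
  next
    case 3
    have "U \<le> 6" using bnd a 3 by simp
    hence "T\<^sup>2 \<le> 18" using CS(3) VW 3 by simp
    moreover have "T\<^sup>2 \<ge> 5\<^sup>2" using T 3 a by (intro power_mono) auto
    ultimately show False by simp
  next
    case 4
    have "U \<le> 0" using bnd a 4 by simp
    hence "S\<^sup>2 \<le> 0" using CS(2) nn by simp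
    thus False using S 4 a by simp
  next
    case 5
    have "U \<le> 2" using bnd a 5 by simp
    hence "T\<^sup>2 \<le> 10" using CS(3) VW 5 by simp
    moreover have "T\<^sup>2 \<ge> 9\<^sup>2" using T 5 a by (intro power_mono) auto
    ultimately show False by simp
  next
    \<comment> \<open>Now \<open>v\<close> and \<open>w\<close> each have a single nonzero entry, at
      places \<open>i\<close> and \<open>j\<close>. \<open>S = 0\<close> and \<open>T = 1\<close>
      force i and j to differ, with \<open>u i = 0\<close> and \<open>u j\<close> a sign, so
      \<open>U = 8\<close> leaves 7 for at most three further entries of \<open>u\<close>.\<close>
    case 1
    hence V1: "V = 1" "W = 1" "S = 0" "T = 1" using VW S T by auto
    obtain i where i: "i \<in> I" "(v i)\<^sup>2 = 1" "\<And>j. j \<in> I \<Longrightarrow> j \<noteq> i \<Longrightarrow> v j = 0"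
      using sum_power2_eq_1[OF I(1)] V1(1) unfolding V_def by metis
    obtain j where j: "j \<in> I" "(w j)\<^sup>2 = 1" "\<And>i. i \<in> I \<Longrightarrow> i \<noteq> j \<Longrightarrow> w i = 0"
      using sum_power2_eq_1[OF I(1)] V1(2) unfolding W_def by metis
    have Si: "S = u i * v i"
      unfolding S_def using I(1) i by (subst sum.remove[of _ i]) (auto intro!: sum.neutral)
    have Tj: "T = u j * w j"
      unfolding T_def using I(1) j by (subst sum.remove[of _ j]) (auto intro!: sum.neutral)
    have Ci: "C = v i * w i"
      unfolding C_def using I(1) i by (subst sum.remove[of _ i]) (auto intro!: sum.neutral)
    have ui: "u i = 0" using Si V1 i(2) by auto
    have ij: "i \<noteq> j" using ui Tj V1 by auto
    have "C = 0" using Ci j(3)[OF i(1) ij] by simp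
    hence "U = 8" using UC 1 by simp
    have "(u j)\<^sup>2 * (w j)\<^sup>2 = 1" using Tj V1 by (metis power_mult_distrib power_one)
    hence uj: "(u j)\<^sup>2 = 1" using j(2) by simp
    have "U = (u i)\<^sup>2 + ((u j)\<^sup>2 + (\<Sum>k\<in>I - {i} - {j}. (u k)\<^sup>2))"
      unfolding U_def using I(1) i(1) j(1) ij by (subst sum.remove[of _ i], simp, simp, subst sum.remove[of _ j]) auto
    hence "(\<Sum>k\<in>I - {i} - {j}. (u k)\<^sup>2) = 7" using \<open>U = 8\<close> ui uj by simp
    moreover have "card (I - {i} - {j}) = card I - 1 - 1"
    proof -
      have "j \<in> I - {i}" using j(1) ij by blast
      hence "card (I - {i} - {j}) = card (I - {i}) - 1" by (rule card_Diff_singleton)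
      thus ?thesis using card_Diff_singleton[OF i(1)] by simp
    qed
    hence "card (I - {i} - {j}) \<le> 3" using I(2) by linarith
    ultimately show False using sum_three_squares_neq_7[of "I - {i} - {j}" u] I(1) by auto
  qed
qed

lemma exists_sum_of_squares_not_five:
  fixes a :: int and \<rho> :: complex
  assumes \<rho>: "\<rho> ^ 3 + of_int (a - 1) * \<rho>\<^sup>2 - of_int a * \<rho> - 1 = 0" and a: "a \<ge> 4"
  shows "\<exists>x \<in> sums_of_squares (int_adjoin \<rho>). x \<notin> sums_of_at_most_squares 5 (int_adjoin \<rho>)"
proof -
  let ?Z = "Zcomb a \<rho>"
  \<comment> \<open>Membership among all sums of squares is enough here, so 7 is spelled out as
    seven ones.\<close>
  define xs where "xs = [?Z 1 0 0, ?Z 1 0 0, ?Z 1 0 0, ?Z 1 0 0, ?Z 1 0 0, ?Z 1 0 0, ?Z 1 0 0, ?Z 0 1 0, ?Z 1 0 1]"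
  define x where "x = (\<Sum>x\<leftarrow>xs. x\<^sup>2)"
  have "set xs \<subseteq> int_adjoin \<rho>"
    unfolding int_adjoin_eq_Zcomb[OF \<rho>] xs_def by auto
  hence x1: "x \<in> sums_of_squares (int_adjoin \<rho>)" unfolding sums_of_squares_def x_def by blast
  have x: "x = ?Z (7 + 2 * a) (2 - a) (3 - a)"
    unfolding x_def xs_def
    by (simp add: Zcomb_power2[OF \<rho>] Zcomb_add Zcomb_0)
  have "x \<notin> sums_of_at_most_squares 5 (int_adjoin \<rho>)"
  proof
    assume "x \<in> sums_of_at_most_squares 5 (int_adjoin \<rho>)"
    then obtain ys where ys: "x = (\<Sum>y\<leftarrow>ys. y\<^sup>2)" "set ys \<subseteq> int_adjoin \<rho>" "enat (length ys) \<le> 5"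
      unfolding sums_of_at_most_squares_def by blast
    have "length ys \<le> 5" using ys(3) by (metis enat_ord_simps(1) numeral_eq_enat)
    have "\<exists>u v w. i < length ys \<longrightarrow> ys ! i = ?Z u v w" for i
    proof (cases "i < length ys")
      case True
      hence "ys ! i \<in> {?Z u v w | u v w. True}"
        using ys(2) nth_mem unfolding int_adjoin_eq_Zcomb[OF \<rho>] by blast
      thus ?thesis by blast
    qed simp
    then obtain u v w where uvw: "\<And>i. i < length ys \<Longrightarrow> ys ! i = ?Z (u i) (v i) (w i)" by metis
    let ?I = "{..<length ys}"
    have "x = (\<Sum>i\<in>?I. (?Z (u i) (v i) (w i))\<^sup>2)"
      unfolding ys(1) by (simp add: sum_list_sum_nth atLeast0LessThan uvw)
    also have "\<dots> = ?Z (\<Sum>i\<in>?I. (u i)\<^sup>2 + a * (v i)\<^sup>2 + (a - 1) * (w i)\<^sup>2 + 2 * (v i * w i))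
        (\<Sum>i\<in>?I. (w i)\<^sup>2 - (a - 1) * (v i)\<^sup>2 + 2 * (u i * v i))
        (\<Sum>i\<in>?I. (v i)\<^sup>2 - a * (w i)\<^sup>2 + 2 * (u i * w i))"
      unfolding Zcomb_power2[OF \<rho>] Zcomb_sum ..
    finally have "?Z (7 + 2 * a) (2 - a) (3 - a) = \<dots>" using x by simp
    from Zcomb_inject[OF \<rho> this] show False
      using five_squares_impossible[OF a, of ?I u v w] \<open>length ys \<le> 5\<close> by simp
  qed
  with x1 show ?thesis by blast
qed

section \<open>Real Dirichlet characters\<close>

lemma sum_divisors_swap:
  fixes g :: "nat \<Rightarrow> nat \<Rightarrow> 'a::comm_monoid_add"
  shows "(\<Sum>n=1..N. \<Sum>d | d dvd n. g d (n div d)) = (\<Sum>d=1..N. \<Sum>k=1..N div d. g d k)"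
proof -
  have "(\<Sum>n=1..N. \<Sum>d | d dvd n. g d (n div d))
      = (\<Sum>(n, d)\<in>(SIGMA n:{1..N}. {d. d dvd n}). g d (n div d))"
    by (subst sum.Sigma) auto
  also have "\<dots> = (\<Sum>(d, k)\<in>(SIGMA d:{1..N}. {1..N div d}). g d k)"
  proof -
    have le: "d \<le> N" if "d * k \<le> N" "0 < k" for d k :: nat
      using that by (metis le_trans mult_le_mono2 mult.right_neutral Suc_leI One_nat_def)
    show ?thesis
    by (rule sum.reindex_bij_witness[of _ "\<lambda>(d, k). (d * k, d)" "\<lambda>(n, d). (d, n div d)"])
       (auto simp: div_le_mono Suc_le_eq dvd_div_eq_0_iff dvd_imp_le less_eq_div_iff_mult_less_eq
             mult.commute intro: Nat.gr0I le elim!: dvdE)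
  qed
  also have "\<dots> = (\<Sum>d=1..N. \<Sum>k=1..N div d. g d k)"
    by (subst sum.Sigma) auto
  finally show ?thesis .
qed

lemma abel_summation_bound:
  fixes c f :: "nat \<Rightarrow> real"
  assumes B: "\<And>k. \<bar>\<Sum>n\<in>{m..<k}. c n\<bar> \<le> B"
    and f: "\<And>n. n \<ge> m \<Longrightarrow> f (Suc n) \<le> f n" "\<And>n. n \<ge> m \<Longrightarrow> 0 \<le> f n"
    and "m \<le> N"
  shows "\<bar>\<Sum>n\<in>{m..<N}. c n * f n\<bar> \<le> B * f m"
proof -
  let ?C = "\<lambda>k. \<Sum>n\<in>{m..<k}. c n"
  have eq: "(\<Sum>n\<in>{m..<N}. c n * f n) = ?C N * f N + (\<Sum>n\<in>{m..<N}. ?C (Suc n) * (f n - f (Suc n)))"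
    using \<open>m \<le> N\<close> by (induction N rule: dec_induct) (simp_all add: algebra_simps)
  have tel: "(\<Sum>n\<in>{m..<N}. f n - f (Suc n)) = f m - f N"
    using \<open>m \<le> N\<close> by (induction N rule: dec_induct) simp_all
  have "B \<ge> 0" using B[of m] by simp
  have "\<bar>\<Sum>n\<in>{m..<N}. ?C (Suc n) * (f n - f (Suc n))\<bar> \<le> (\<Sum>n\<in>{m..<N}. B * (f n - f (Suc n)))"
  proof (rule order.trans[OF sum_abs], rule sum_mono)
    fix n assume "n \<in> {m..<N}"
    hence "f n - f (Suc n) \<ge> 0" using f(1)[of n] by simp
    thus "\<bar>?C (Suc n) * (f n - f (Suc n))\<bar> \<le> B * (f n - f (Suc n))"
      unfolding abs_mult using mult_right_mono[OF B[of "Suc n"]] by simp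
  qed
  also have "\<dots> = B * (f m - f N)" by (simp add: sum_distrib_left[symmetric] tel)
  finally have "\<bar>\<Sum>n\<in>{m..<N}. ?C (Suc n) * (f n - f (Suc n))\<bar> \<le> B * (f m - f N)" .
  moreover have "\<bar>?C N * f N\<bar> \<le> B * f N"
    unfolding abs_mult using mult_right_mono[OF B[of N], of "f N"] f(2)[of N] \<open>m \<le> N\<close> by simp
  moreover have "B * f N + B * (f m - f N) = B * f m" by (simp add: right_diff_distrib)
  ultimately show ?thesis unfolding eq by linarith
qed

text \<open>Dirichlet characters modulo \<open>D\<close> with real values, as functions on all
  naturals. They separate residue classes up to squares, which is what Legendre symbols and the
  class of a unit modulo 8 require.\<close>

definition real_char :: "nat \<Rightarrow> (nat \<Rightarrow> real) \<Rightarrow> bool" where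
  "real_char D \<xi> \<longleftrightarrow> (\<forall>m n. \<xi> (m * n) = \<xi> m * \<xi> n) \<and> (\<forall>n. \<xi> (n + D) = \<xi> n)
     \<and> (\<forall>n. \<xi> n \<in> {-1, 0, 1}) \<and> (\<forall>n. \<xi> n = 0 \<longleftrightarrow> \<not> coprime n D)"

definition principal_char :: "nat \<Rightarrow> nat \<Rightarrow> real" where
  "principal_char D n = (if coprime n D then 1 else 0)"

lemma real_char_principal: "real_char D (principal_char D)"
proof -
  have "coprime (n + D) D \<longleftrightarrow> coprime n D" for n by (metis coprime_iff_gcd_eq_1 gcd_add1)
  thus ?thesis by (simp add: real_char_def principal_char_def)
qed

lemma real_char_mult: "real_char D \<xi> \<Longrightarrow> real_char D \<psi> \<Longrightarrow> real_char D (\<lambda>n. \<xi> n * \<psi> n)"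
proof -
  assume 1: "real_char D \<xi>" "real_char D \<psi>"
  have "\<xi> n \<in> {-1, 0, 1}" "\<psi> n \<in> {-1, 0, 1}" for n using 1 unfolding real_char_def by blast+
  hence "\<xi> n * \<psi> n \<in> {-1, 0, 1}" for n
    by (cases "\<xi> n = -1"; cases "\<xi> n = 0"; cases "\<psi> n = -1"; cases "\<psi> n = 0") fastforce+
  with 1 show ?thesis unfolding real_char_def by simp
qed

lemma real_char_abs_le:
  assumes "real_char D \<xi>" shows "\<bar>\<xi> n\<bar> \<le> 1"
proof -
  have "\<xi> n \<in> {-1, 0, 1}" using assms unfolding real_char_def by blast
  thus ?thesis by auto
qed

lemma real_char_1:
  assumes "real_char D \<xi>" shows "\<xi> 1 = 1"
proof -
  have "\<xi> (1 * 1) = \<xi> 1 * \<xi> 1" "\<xi> 1 = 0 \<longleftrightarrow> \<not> coprime 1 D"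
    using assms unfolding real_char_def by blast+
  thus ?thesis by simp
qed

lemma real_char_mod:
  assumes "real_char D \<xi>" shows "\<xi> (n mod D) = \<xi> n"
proof -
  have "\<xi> (m + k * D) = \<xi> m" for m k
  proof (induction k)
    case (Suc k)
    have "\<xi> (m + Suc k * D) = \<xi> ((m + k * D) + D)" by (simp add: algebra_simps)
    also have "\<dots> = \<xi> (m + k * D)" using assms unfolding real_char_def by blast
    finally show ?case using Suc by simp
  qed simp
  from this[of "n mod D" "n div D"] show ?thesis by simp
qed

lemma finite_real_chars:
  assumes "D > 0" shows "finite {\<xi>. real_char D \<xi>}"
proof (rule inj_on_finite[of "\<lambda>\<xi>. restrict \<xi> {..<D}"])
  show "inj_on (\<lambda>\<xi>. restrict \<xi> {..<D}) {\<xi>. real_char D \<xi>}"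
  proof (rule inj_onI, rule ext)
    fix \<xi> \<psi> n assume "\<xi> \<in> {\<xi>. real_char D \<xi>}" "\<psi> \<in> {\<xi>. real_char D \<xi>}"
      and eq: "restrict \<xi> {..<D} = restrict \<psi> {..<D}"
    moreover from fun_cong[OF eq, of "n mod D"] have "\<xi> (n mod D) = \<psi> (n mod D)" using assms by simp
    ultimately show "\<xi> n = \<psi> n" by (simp add: real_char_mod)
  qed
  show "(\<lambda>\<xi>. restrict \<xi> {..<D}) ` {\<xi>. real_char D \<xi>} \<subseteq> {..<D} \<rightarrow>\<^sub>E {-1, 0, 1}"
  proof (rule image_subsetI)
    fix \<xi> assume "\<xi> \<in> {\<xi>. real_char D \<xi>}"
    hence "\<xi> n \<in> {-1, 0, 1}" for n unfolding real_char_def by blast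
    thus "restrict \<xi> {..<D} \<in> {..<D} \<rightarrow>\<^sub>E {-1, 0, 1}" by (intro restrict_PiE_iff[THEN iffD2]) blast
  qed
qed (auto intro: finite_PiE)

text \<open>A real character other than the principal one takes the value -1 at some
  \<open>b\<close>; multiplication by \<open>b\<close> permutes the residues and reverses the sign
  of the sum.\<close>

lemma real_char_sum_period:
  assumes \<xi>: "real_char D \<xi>" and D: "D > 0" and np: "\<xi> \<noteq> principal_char D"
  shows "(\<Sum>n<D. \<xi> n) = 0"
proof -
  from np obtain b where b: "\<xi> b \<noteq> principal_char D b" by blast
  moreover have "\<xi> b \<in> {-1, 0, 1}" "\<xi> b = 0 \<longleftrightarrow> \<not> coprime b D"
    using \<xi> unfolding real_char_def by blast+
  ultimately have cb: "coprime b D" "\<xi> b = -1" by (auto simp: principal_char_def split: if_splits)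
  have "bij_betw (\<lambda>n. b * n mod D) {..<D} {..<D}"
  proof (rule bij_betw_imageI)
    show inj: "inj_on (\<lambda>n. b * n mod D) {..<D}"
    proof (rule inj_onI)
      fix x y assume "x \<in> {..<D}" "y \<in> {..<D}" "b * x mod D = b * y mod D"
      hence "[x = y] (mod D)" using cb by (simp add: cong_def[symmetric] cong_mult_lcancel_nat)
      thus "x = y" using \<open>x \<in> _\<close> \<open>y \<in> _\<close> by (simp add: cong_def)
    qed
    show "(\<lambda>n. b * n mod D) ` {..<D} = {..<D}"
      using D by (intro endo_inj_surj[OF _ _ inj]) auto
  qed
  from sum.reindex_bij_betw[OF this, of \<xi>]
  have "(\<Sum>n<D. \<xi> n) = (\<Sum>n<D. \<xi> (b * n mod D))" by simp
  also have "\<dots> = (\<Sum>n<D. - \<xi> n)"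
  proof (rule sum.cong)
    fix n
    have "\<xi> (b * n mod D) = \<xi> (b * n)" by (rule real_char_mod[OF \<xi>])
    also have "\<dots> = \<xi> b * \<xi> n" using \<xi> unfolding real_char_def by blast
    finally show "\<xi> (b * n mod D) = - \<xi> n" using cb by simp
  qed simp
  finally show ?thesis by (simp add: sum_negf)
qed

lemma real_char_partial_sum:
  assumes \<xi>: "real_char D \<xi>" and D: "D > 0" and np: "\<xi> \<noteq> principal_char D"
  shows "\<bar>\<Sum>n<N. \<xi> n\<bar> \<le> real D"
proof (induction N rule: less_induct)
  case (less N)
  show ?case
  proof (cases "N \<le> D")
    case True
    have "\<bar>\<Sum>n<N. \<xi> n\<bar> \<le> (\<Sum>n<N. \<bar>\<xi> n\<bar>)" by (rule sum_abs)
    also have "\<dots> \<le> (\<Sum>n<N. 1)" by (rule sum_mono) (rule real_char_abs_le[OF \<xi>])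
    finally show ?thesis using True by simp
  next
    case False
    have "(\<Sum>n<N. \<xi> n) = (\<Sum>n<D. \<xi> n) + (\<Sum>n=D..<N. \<xi> n)"
      using sum.atLeastLessThan_concat[of 0 D N \<xi>] False by (simp add: lessThan_atLeast0)
    also have "(\<Sum>n=D..<N. \<xi> n) = (\<Sum>n<N - D. \<xi> (n + D))"
      using sum.shift_bounds_nat_ivl[of \<xi> 0 D "N - D"] False by (simp add: lessThan_atLeast0)
    also have "(\<Sum>n<D. \<xi> n) + (\<Sum>n<N - D. \<xi> (n + D)) = (\<Sum>n<N - D. \<xi> n)"
      using \<xi> by (simp add: real_char_sum_period[OF assms] real_char_def)
    finally show ?thesis using less[of "N - D"] False D by simp
  qed
qed

lemma real_char_window_sum:
  assumes "real_char D \<xi>" and "D > 0" and "\<xi> \<noteq> principal_char D"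
  shows "\<bar>\<Sum>n\<in>{m..<k}. \<xi> n\<bar> \<le> 2 * real D"
proof (cases "m \<le> k")
  case True
  have "(\<Sum>n<k. \<xi> n) = (\<Sum>n<m. \<xi> n) + (\<Sum>n\<in>{m..<k}. \<xi> n)"
    using sum.atLeastLessThan_concat[of 0 m k \<xi>] True by (simp add: lessThan_atLeast0)
  thus ?thesis using real_char_partial_sum[OF assms, of k] real_char_partial_sum[OF assms, of m] by linarith
qed simp

lemma real_char_tail_bound:
  assumes "real_char D \<xi>" "D > 0" "\<xi> \<noteq> principal_char D" "N \<le> M"
  shows "\<bar>(\<Sum>n=1..M. \<xi> n / real n) - (\<Sum>n=1..N. \<xi> n / real n)\<bar> \<le> 2 * real D / real (Suc N)"
proof -
  have "(\<Sum>n=1..M. \<xi> n / real n) = (\<Sum>n=1..N. \<xi> n / real n) + (\<Sum>n\<in>{Suc N..<Suc M}. \<xi> n * (1 / real n))"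
    using sum.ub_add_nat[of 1 N "\<lambda>n. \<xi> n / real n" "M - N"] \<open>N \<le> M\<close>
    by (simp add: atLeastLessThanSuc_atLeastAtMost)
  moreover have "\<bar>\<Sum>n\<in>{Suc N..<Suc M}. \<xi> n * (1 / real n)\<bar> \<le> 2 * real D * (1 / real (Suc N))"
    using \<open>N \<le> M\<close>
    by (intro abel_summation_bound real_char_window_sum[OF assms(1-3)]) (auto simp: field_simps)
  ultimately show ?thesis by simp
qed

text \<open>The rate 1/N is part of the statement because the errors S(N div d) - L are later summed
  over all d up to N against the von Mangoldt function.\<close>

lemma real_char_L_exists:
  assumes "real_char D \<xi>" "D > 0" "\<xi> \<noteq> principal_char D"
  obtains L where "\<And>N. \<bar>(\<Sum>n=1..N. \<xi> n / real n) - L\<bar> \<le> 2 * real D / real (Suc N)"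
proof -
  define S where "S = (\<lambda>N. \<Sum>n=1..N. \<xi> n / real n)"
  have "Cauchy S"
  proof (rule metric_CauchyI)
    fix e :: real assume "e > 0"
    obtain N where N: "real N > 4 * real D / e" using reals_Archimedean2 by blast
    have "dist (S m) (S n) < e" if "m \<ge> N" "n \<ge> N" for m n
    proof -
      have "\<bar>S m - S N\<bar> \<le> 2 * real D / real (Suc N)" "\<bar>S n - S N\<bar> \<le> 2 * real D / real (Suc N)"
        using real_char_tail_bound[OF assms that(1)] real_char_tail_bound[OF assms that(2)]
        unfolding S_def by blast+
      moreover have "4 * real D < e * real (Suc N)" using N \<open>e > 0\<close> by (simp add: field_simps)
      hence "4 * real D / real (Suc N) < e" by (simp only: pos_divide_less_eq of_nat_0_less_iff zero_less_Suc)
      hence "2 * real D / real (Suc N) + 2 * real D / real (Suc N) < e" by simp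
      ultimately show ?thesis unfolding dist_real_def by linarith
    qed
    thus "\<exists>N. \<forall>m\<ge>N. \<forall>n\<ge>N. dist (S m) (S n) < e" by blast
  qed
  then obtain L where L: "S \<longlonglongrightarrow> L" using Cauchy_convergent_iff convergent_def by blast
  have "\<bar>S N - L\<bar> \<le> 2 * real D / real (Suc N)" for N
  proof (rule LIMSEQ_le_const2)
    show "(\<lambda>M. \<bar>S N - S M\<bar>) \<longlonglongrightarrow> \<bar>S N - L\<bar>" by (intro tendsto_intros L)
    show "\<exists>N'. \<forall>M\<ge>N'. \<bar>S N - S M\<bar> \<le> 2 * real D / real (Suc N)"
      using real_char_tail_bound[OF assms] unfolding S_def by (metis abs_minus_commute)
  qed
  thus ?thesis using that unfolding S_def by blast
qed

section \<open>Nonvanishing of L(1) for real characters\<close>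

lemma sum_power_ge:
  assumes "0 < s" "s < (1::real)"
  shows "real n * s ^ (n - 1) \<le> (\<Sum>i<n. (s\<^sup>2) ^ i)"
proof -
  \<comment> \<open>The inequality of arithmetic and geometric means for the exponents i and n - 1 -
    i; taking the base to be a square keeps the geometric mean an integral power of
    \<open>s\<close>.\<close>
  have "2 * s ^ (n - 1) \<le> (s\<^sup>2) ^ i + (s\<^sup>2) ^ (n - 1 - i)" if "i < n" for i
  proof -
    have "0 \<le> (s ^ i - s ^ (n - 1 - i))\<^sup>2" by simp
    also have "\<dots> = (s\<^sup>2) ^ i + (s\<^sup>2) ^ (n - 1 - i) - 2 * (s ^ i * s ^ (n - 1 - i))"
      by (simp add: power2_diff power_mult[symmetric] mult.commute)
    also have "s ^ i * s ^ (n - 1 - i) = s ^ (n - 1)" using that by (simp add: power_add[symmetric])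
    finally show ?thesis by simp
  qed
  hence "(\<Sum>i<n. 2 * s ^ (n - 1)) \<le> (\<Sum>i<n. (s\<^sup>2) ^ i + (s\<^sup>2) ^ (n - 1 - i))"
    by (intro sum_mono) auto
  also have "\<dots> = 2 * (\<Sum>i<n. (s\<^sup>2) ^ i)"
    using sum.nat_diff_reindex[of "\<lambda>i. (s\<^sup>2) ^ i" n] by (simp add: sum.distrib)
  finally show ?thesis by simp
qed

text \<open>Monsky's proof that \<open>L(1, \<xi>) \<noteq> 0\<close>: compare \<open>\<Sum> \<xi>(n) / n\<close> with the Lambert series
  \<open>\<Sum> \<xi>(n) t\<^sup>n / (1 - t\<^sup>n)\<close>.\<close>

lemma lambert_weight:
  fixes t :: real
  assumes t: "0 < t" "t < 1"
  defines "b \<equiv> (\<lambda>n. 1 / (real n * (1 - t)) - t ^ n / (1 - t ^ n))"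
  shows "n \<ge> 1 \<Longrightarrow> b (Suc n) \<le> b n" "n \<ge> 1 \<Longrightarrow> 0 \<le> b n" "b 1 = 1"
proof -
  define s where "s = sqrt t"
  have s: "0 < s" "s < 1" "s\<^sup>2 = t" using t by (auto simp: s_def)
  define G where "G = (\<lambda>n. \<Sum>i<n. t ^ i)"
  have G: "real n * s ^ (n - 1) \<le> G n" for n using sum_power_ge[OF s(1,2), of n] s(3) by (simp add: G_def)
  have geo: "1 - t ^ n = (1 - t) * G n" for n
    unfolding G_def by (metis one_diff_power_eq)
  show "0 \<le> b n" if "n \<ge> 1" for n
  proof -
    have "real n * t ^ n \<le> real n * s ^ (n - 1)"
    proof (rule mult_left_mono)
      have "t ^ n = s ^ (2 * n)" using s by (simp add: power_mult)
      also have "\<dots> \<le> s ^ (n - 1)" using s by (intro power_decreasing) auto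
      finally show "t ^ n \<le> s ^ (n - 1)" .
    qed simp
    hence le: "real n * t ^ n \<le> G n" using G[of n] by simp
    have "0 < real n * s ^ (n - 1)" using s that by simp
    hence "G n > 0" using G[of n] by linarith
    have "t ^ n / (1 - t ^ n) = t ^ n / G n / (1 - t)" by (simp add: geo)
    also have "\<dots> \<le> (1 / real n) / (1 - t)"
      using le \<open>G n > 0\<close> that t by (intro divide_right_mono) (auto simp: field_simps)
    finally show ?thesis by (simp add: b_def)
  qed
  \<comment> \<open>The recursion \<open>G (Suc n) = 1 + t * G n\<close> collapses the difference of
    consecutive quotients \<open>t ^ n / G n\<close> to \<open>t ^ n / (G n * G (Suc n))\<close>.
    This has to be at most 1/n - 1/(n + 1), which is what \<open>key\<close> says.\<close>
  show "b (Suc n) \<le> b n" if n: "n \<ge> 1"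
  proof -
    have G0: "G n > 0" "G (Suc n) > 0"
      using G[of n] G[of "Suc n"] s n by (smt (verit) mult_pos_pos of_nat_0_less_iff zero_less_power less_le_trans zero_less_one Suc_le_eq zero_less_Suc One_nat_def)+
    have "real n * s ^ n \<le> real n * s ^ (n - 1)" using s by (intro mult_left_mono power_decreasing) auto
    hence "real n * s ^ n \<le> G n" using G[of n] by simp
    moreover have "real (Suc n) * s ^ n \<le> G (Suc n)" using G[of "Suc n"] by simp
    ultimately have GG: "(real n * s ^ n) * (real (Suc n) * s ^ n) \<le> G n * G (Suc n)"
      using s G0 by (intro mult_mono) auto
    hence key: "real n * real (Suc n) * t ^ n \<le> G n * G (Suc n)"
    proof -
      have "t ^ n = s ^ n * s ^ n" using s(3) by (metis power2_eq_square power_mult_distrib)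
      with GG show ?thesis by (simp add: mult_ac)
    qed
    have GS: "G (Suc n) = 1 + t * G n"
      unfolding G_def by (simp only: sum.lessThan_Suc_shift power_0 power_Suc sum_distrib_left)
    have "t ^ n / G n - t ^ Suc n / G (Suc n) = t ^ n * (G (Suc n) - t * G n) / (G n * G (Suc n))"
      using G0 by (simp add: field_simps)
    also have "\<dots> = t ^ n / (G n * G (Suc n))" by (simp add: GS)
    also have "\<dots> \<le> 1 / (real n * real (Suc n))"
      using key G0 n by (simp add: divide_simps mult_ac)
    also have "\<dots> = 1 / real n - 1 / real (Suc n)" using n by (simp add: field_simps)
    finally have "(1 / real (Suc n) - t ^ Suc n / G (Suc n)) / (1 - t) \<le> (1 / real n - t ^ n / G n) / (1 - t)"
      using t by (intro divide_right_mono) auto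
    thus ?thesis unfolding b_def by (simp add: geo diff_divide_distrib mult.commute del: power_Suc of_nat_Suc)
  qed
  show "b 1 = 1" using t by (simp add: b_def diff_divide_distrib[symmetric])
qed

text \<open>The convolution of \<xi> with the constant 1. Its values are the coefficients of the
  Lambert series \<Sum> \<xi>(n) t^n / (1 - t^n), expanded in powers of t.\<close>

definition char_divisor_sum :: "(nat \<Rightarrow> real) \<Rightarrow> nat \<Rightarrow> real" where
  "char_divisor_sum \<xi> n = (\<Sum>d | d dvd n. \<xi> d)"

lemma char_divisor_sum_mult:
  assumes \<xi>: "real_char D \<xi>" and cop: "coprime m n" and "m > 0" "n > 0"
  shows "char_divisor_sum \<xi> (m * n) = char_divisor_sum \<xi> m * char_divisor_sum \<xi> n"
proof -
  have gcds: "gcd (d * e) m = d \<and> gcd (d * e) n = e" if "d dvd m" "e dvd n" for d e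
  proof -
    have "coprime m e" "coprime n d"
      using cop that by (meson coprime_commute coprime_divisors dvd_refl)+
    thus ?thesis using that by (simp add: gcd_mult_left_right_cancel gcd_mult_left_left_cancel gcd_nat.absorb1)
  qed
  have "char_divisor_sum \<xi> m * char_divisor_sum \<xi> n = (\<Sum>(d, e)\<in>{d. d dvd m} \<times> {e. e dvd n}. \<xi> (d * e))"
    using \<xi> by (simp add: char_divisor_sum_def sum_product sum.cartesian_product real_char_def)
  also have "\<dots> = (\<Sum>d | d dvd m * n. \<xi> d)"
  proof (rule sum.reindex_bij_witness[of _ "\<lambda>d. (gcd d m, gcd d n)" "\<lambda>(d, e). d * e"])
    fix x assume "x \<in> {d. d dvd m} \<times> {e. e dvd n}"
    thus "(gcd (case x of (d, e) \<Rightarrow> d * e) m, gcd (case x of (d, e) \<Rightarrow> d * e) n) = x"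
      using gcds by auto
  next
    fix x assume "x \<in> {d. d dvd m * n}"
    then obtain d e where "x = d * e" "d dvd m" "e dvd n" by (auto dest: division_decomp)
    thus "(case (gcd x m, gcd x n) of (d, e) \<Rightarrow> d * e) = x" using gcds by simp
  qed (auto intro: mult_dvd_mono)
  finally show ?thesis by (simp add: char_divisor_sum_def)
qed

lemma char_divisor_sum_prime_power:
  assumes \<xi>: "real_char D \<xi>" and p: "prime p"
  shows "char_divisor_sum \<xi> (p ^ k) \<ge> 0" "even k \<Longrightarrow> char_divisor_sum \<xi> (p ^ k) \<ge> 1"
proof -
  have pow: "\<xi> (p ^ i) = \<xi> p ^ i" for i
    using \<xi> real_char_1[OF \<xi>] by (induction i) (auto simp: real_char_def)
  have "{d. d dvd p ^ k} = (\<lambda>i. p ^ i) ` {..k}" using p by (auto simp: divides_primepow_nat)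
  moreover have "inj_on (\<lambda>i. p ^ i) {..k}" using prime_gt_1_nat[OF p] by (auto simp: inj_on_def)
  ultimately have eq: "char_divisor_sum \<xi> (p ^ k) = (\<Sum>i\<le>k. \<xi> p ^ i)"
    by (simp add: char_divisor_sum_def sum.reindex pow)
  have m1: "(\<Sum>i\<le>k. (-1) ^ i) = (if even k then 1 else (0::real))" by (induction k) auto
  have z: "(\<Sum>i\<le>k. 0 ^ i) = (1::real)" by (induction k) auto
  have "\<xi> p \<in> {-1, 0, 1}" using \<xi> unfolding real_char_def by blast
  thus "char_divisor_sum \<xi> (p ^ k) \<ge> 0" "even k \<Longrightarrow> char_divisor_sum \<xi> (p ^ k) \<ge> 1"
    unfolding eq using m1 z by auto
qed

text \<open>Multiplicativity reduces this to prime powers, where the sum is a finite geometric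
  series with ratio -1, 0 or 1. The squares supply infinitely many coefficients that are at least 1,
  which is what makes the Lambert series unbounded near t = 1.\<close>

lemma char_divisor_sum_ge:
  assumes \<xi>: "real_char D \<xi>" and "n > 0"
  shows "char_divisor_sum \<xi> n \<ge> 0 \<and> ((\<exists>k. n = k\<^sup>2) \<longrightarrow> char_divisor_sum \<xi> n \<ge> 1)"
  using \<open>n > 0\<close>
proof (induction n rule: less_induct)
  case (less n)
  show ?case
  proof (cases "n = 1")
    case True
    thus ?thesis using real_char_1[OF \<xi>] by (simp add: char_divisor_sum_def)
  next
    case False
    then obtain p where p: "prime p" "p dvd n" using prime_factor_nat by blast
    define e where "e = multiplicity p n"
    obtain m where n: "n = p ^ e * m" and pm: "\<not> p dvd m"
      using multiplicity_decompose'[of n p] p less.prems e_def by (metis not_prime_unit less_numeral_extra(3))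
    have e: "e > 0" using p less.prems unfolding e_def by (simp add: prime_multiplicity_gt_zero_iff)
    have "1 < p ^ e" using prime_gt_1_nat[OF p(1)] e by (rule one_less_power)
    hence m: "m > 0" "m < n" using n less.prems by (auto intro!: Nat.gr0I)
    have cop: "coprime (p ^ e) m" using p(1) pm by (simp add: prime_imp_coprime)
    have mult: "char_divisor_sum \<xi> n = char_divisor_sum \<xi> (p ^ e) * char_divisor_sum \<xi> m"
      unfolding n using p(1) m(1) by (intro char_divisor_sum_mult[OF \<xi> cop]) (auto simp: prime_gt_0_nat)
    have IH: "char_divisor_sum \<xi> m \<ge> 0 \<and> ((\<exists>k. m = k\<^sup>2) \<longrightarrow> char_divisor_sum \<xi> m \<ge> 1)"
      using less.IH m by blast
    have "char_divisor_sum \<xi> n \<ge> 1" if k: "n = k\<^sup>2" for k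
    proof -
      have k0: "k > 0" using k less.prems by (auto intro!: Nat.gr0I)
      have ee: "e = 2 * multiplicity p k"
        using k k0 p(1) by (simp add: e_def prime_elem_multiplicity_power_distrib)
      hence ev: "even e" by (metis dvd_triv_left)
      obtain l where l: "k = p ^ multiplicity p k * l" using multiplicity_dvd[of p k] by (elim dvdE)
      have "p ^ e * m = (p ^ multiplicity p k * l)\<^sup>2" using k n l by metis
      also have "\<dots> = p ^ e * l\<^sup>2" by (simp only: ee power_mult_distrib power_mult[symmetric] mult.commute)
      finally have "m = l\<^sup>2" using p(1) by (simp add: prime_gt_0_nat)
      hence "char_divisor_sum \<xi> m \<ge> 1" using IH by blast
      moreover have "char_divisor_sum \<xi> (p ^ e) \<ge> 1" by (rule char_divisor_sum_prime_power(2)[OF \<xi> p(1) ev])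
      ultimately show ?thesis unfolding mult using mult_mono[of 1 "char_divisor_sum \<xi> (p ^ e)" 1] by simp
    qed
    moreover have "char_divisor_sum \<xi> n \<ge> 0"
      unfolding mult using IH char_divisor_sum_prime_power(1)[OF \<xi> p(1)] by simp
    ultimately show ?thesis by blast
  qed
qed

lemma sum_power_from_1: "(1 - x) * (\<Sum>j=1..q. x ^ j) = x - x ^ Suc q" for x :: real
proof (induction q)
  case (Suc q)
  have "(1 - x) * (\<Sum>j=1..Suc q. x ^ j) = (1 - x) * (\<Sum>j=1..q. x ^ j) + (1 - x) * x ^ Suc q"
    by (simp add: distrib_left)
  also have "(1 - x) * (\<Sum>j=1..q. x ^ j) = x - x ^ Suc q" by (rule Suc.IH)
  also have "x - x ^ Suc q + (1 - x) * x ^ Suc q = x - x ^ Suc (Suc q)" by (simp add: algebra_simps)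
  finally show ?case .
qed simp

text \<open>If L were 0, summation by parts would bound the Lambert series by \<open>2 * D\<close>
  for all t < 1. It dominates the sum of t^(k^2) over k from 1 to K, which tends to K as t tends to
  1, and K may exceed 2D. The series is cut off at \<open>M\<close>, and M tends to infinity before
  t tends to 1.\<close>

lemma real_char_L_nonzero:
  assumes \<xi>: "real_char D \<xi>" and D: "D > 0" and np: "\<xi> \<noteq> principal_char D"
    and L: "\<And>N. \<bar>(\<Sum>n=1..N. \<xi> n / real n) - L\<bar> \<le> 2 * real D / real (Suc N)"
  shows "L \<noteq> 0"
proof
  assume "L = 0"
  let ?F = "char_divisor_sum \<xi>"
  have bound: "(\<Sum>k=1..K. t ^ (k\<^sup>2)) \<le> 2 * real D" if t: "0 < t" "t < 1" for t :: real and K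
  proof -
    define b where "b = (\<lambda>n. 1 / (real n * (1 - t)) - t ^ n / (1 - t ^ n))"
    have tn: "t ^ n < 1" if "n \<ge> 1" for n using t that by (simp add: power_less_one_iff)
    have upper: "(\<Sum>n=1..M. \<xi> n * (t ^ n / (1 - t ^ n))) \<le> 2 * real D / (real (Suc M) * (1 - t)) + 2 * real D" for M
    proof -
      have "\<bar>\<Sum>n\<in>{1..<Suc M}. \<xi> n * b n\<bar> \<le> 2 * real D * b 1"
        unfolding b_def using lambert_weight[OF t]
        by (intro abel_summation_bound real_char_window_sum[OF \<xi> D np]) auto
      hence 1: "\<bar>\<Sum>n=1..M. \<xi> n * b n\<bar> \<le> 2 * real D"
        using lambert_weight(3)[OF t] unfolding b_def by (simp add: atLeastLessThanSuc_atLeastAtMost)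
      have "(\<Sum>n=1..M. \<xi> n * b n) = (\<Sum>n=1..M. \<xi> n / real n / (1 - t) - \<xi> n * (t ^ n / (1 - t ^ n)))"
        by (intro sum.cong) (auto simp: b_def right_diff_distrib)
      also have "\<dots> = (\<Sum>n=1..M. \<xi> n / real n) / (1 - t) - (\<Sum>n=1..M. \<xi> n * (t ^ n / (1 - t ^ n)))"
        by (simp only: sum_subtractf sum_divide_distrib)
      finally have 2: "(\<Sum>n=1..M. \<xi> n * (t ^ n / (1 - t ^ n))) = (\<Sum>n=1..M. \<xi> n / real n) / (1 - t) - (\<Sum>n=1..M. \<xi> n * b n)"
        by simp
      have "(\<Sum>n=1..M. \<xi> n / real n) \<le> 2 * real D / real (Suc M)"
        using L[of M] \<open>L = 0\<close> by linarith
      hence "(\<Sum>n=1..M. \<xi> n / real n) / (1 - t) \<le> 2 * real D / real (Suc M) / (1 - t)"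
        using t by (intro divide_right_mono) auto
      thus ?thesis using 1 2 by (simp only: divide_divide_eq_left)
    qed
    have lower: "(\<Sum>k=1..K. t ^ (k\<^sup>2)) - real M * t ^ M / (1 - t) \<le> (\<Sum>n=1..M. \<xi> n * (t ^ n / (1 - t ^ n)))"
      if M: "M \<ge> K\<^sup>2" for M
    proof -
      have "(\<Sum>k=1..K. t ^ (k\<^sup>2)) = (\<Sum>m\<in>(\<lambda>k. k\<^sup>2) ` {1..K}. t ^ m)"
        by (subst sum.reindex) (auto intro!: inj_onI)
      also have "\<dots> \<le> (\<Sum>m\<in>(\<lambda>k. k\<^sup>2) ` {1..K}. ?F m * t ^ m)"
      proof (rule sum_mono)
        fix m assume "m \<in> (\<lambda>k. k\<^sup>2) ` {1..K}"
        hence "?F m \<ge> 1" using char_divisor_sum_ge[OF \<xi>, of m] by force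
        thus "t ^ m \<le> ?F m * t ^ m" using t mult_right_mono[of 1 "?F m" "t ^ m"] by simp
      qed
      also have "\<dots> \<le> (\<Sum>m=1..M. ?F m * t ^ m)"
      proof (rule sum_mono2)
        show "(\<lambda>k. k\<^sup>2) ` {1..K} \<subseteq> {1..M}"
        proof (rule image_subsetI)
          fix k assume "k \<in> {1..K}"
          hence "1 \<le> k\<^sup>2" and "k\<^sup>2 \<le> K\<^sup>2" by (auto intro: power_mono)
          moreover from this(2) M have "k\<^sup>2 \<le> M" by (rule order.trans)
          ultimately show "k\<^sup>2 \<in> {1..M}" by (simp only: atLeastAtMost_iff)
        qed
        show "0 \<le> ?F m * t ^ m" if "m \<in> {1..M} - (\<lambda>k. k\<^sup>2) ` {1..K}" for m
          using that t char_divisor_sum_ge[OF \<xi>, of m] by simp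
      qed simp
      also have "\<dots> = (\<Sum>m=1..M. \<Sum>d | d dvd m. \<xi> d * t ^ (d * (m div d)))"
        unfolding char_divisor_sum_def sum_distrib_right by (intro sum.cong) auto
      also have "\<dots> = (\<Sum>d=1..M. \<Sum>j=1..M div d. \<xi> d * t ^ (d * j))"
        by (rule sum_divisors_swap)
      \<comment> \<open>Each inner geometric series is completed to infinity. Its tail starts at an
        exponent greater than \<open>M\<close>, so completing it costs at most
        \<open>t ^ M / (1 - t)\<close>.\<close>
      also have "\<dots> \<le> (\<Sum>d=1..M. \<xi> d * (t ^ d / (1 - t ^ d)) + t ^ M / (1 - t))"
      proof (rule sum_mono)
        fix d assume d: "d \<in> {1..M}"
        define q where "q = M div d"
        have ne: "1 - t ^ d \<noteq> 0" using tn[of d] d by auto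
        have "(\<Sum>j=1..q. (t ^ d) ^ j) = (t ^ d - (t ^ d) ^ Suc q) / (1 - t ^ d)"
          using sum_power_from_1[of "t ^ d" q] ne by (metis nonzero_mult_div_cancel_left)
        hence geo: "(\<Sum>j=1..q. (t ^ d) ^ j) = t ^ d / (1 - t ^ d) - (t ^ d) ^ Suc q / (1 - t ^ d)"
          by (simp only: diff_divide_distrib)
        have e: "0 \<le> (t ^ d) ^ Suc q / (1 - t ^ d)" using t tn[of d] d by auto
        have "M < d * Suc q" using d unfolding q_def using dividend_less_times_div[of d M] by (simp add: algebra_simps)
        hence "(t ^ d) ^ Suc q \<le> t ^ M"
          unfolding power_mult[symmetric] using t by (intro power_decreasing) auto
        moreover have "t ^ d \<le> t ^ 1" using t d by (intro power_decreasing) auto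
        ultimately have e2: "(t ^ d) ^ Suc q / (1 - t ^ d) \<le> t ^ M / (1 - t)"
          using t by (intro frac_le) auto
        have "(\<Sum>j=1..q. \<xi> d * t ^ (d * j)) = \<xi> d * (t ^ d / (1 - t ^ d)) - \<xi> d * ((t ^ d) ^ Suc q / (1 - t ^ d))"
          by (simp only: power_mult sum_distrib_left[symmetric] geo right_diff_distrib)
        moreover have "\<bar>\<xi> d * ((t ^ d) ^ Suc q / (1 - t ^ d))\<bar> \<le> 1 * (t ^ M / (1 - t))"
          unfolding abs_mult abs_of_nonneg[OF e]
          using e e2 real_char_abs_le[OF \<xi>, of d] by (intro mult_mono) auto
        ultimately show "(\<Sum>j=1..M div d. \<xi> d * t ^ (d * j)) \<le> \<xi> d * (t ^ d / (1 - t ^ d)) + t ^ M / (1 - t)"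
          unfolding q_def by linarith
      qed
      also have "\<dots> = (\<Sum>n=1..M. \<xi> n * (t ^ n / (1 - t ^ n))) + real M * t ^ M / (1 - t)"
        by (simp add: sum.distrib)
      finally show ?thesis by simp
    qed
    show ?thesis
    proof (rule LIMSEQ_le)
      have "(\<lambda>M. real M * t ^ M) \<longlonglongrightarrow> 0" using t by (intro powser_times_n_limit_0) simp
      from tendsto_diff[OF tendsto_const tendsto_divide[OF this tendsto_const]]
      show "(\<lambda>M. (\<Sum>k=1..K. t ^ (k\<^sup>2)) - real M * t ^ M / (1 - t)) \<longlonglongrightarrow> (\<Sum>k=1..K. t ^ (k\<^sup>2))"
        using t by fastforce
      show "(\<lambda>M. 2 * real D / (real (Suc M) * (1 - t)) + 2 * real D) \<longlonglongrightarrow> 2 * real D"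
        using t by real_asymp
      show "\<exists>N. \<forall>n\<ge>N. (\<Sum>k=1..K. t ^ (k\<^sup>2)) - real n * t ^ n / (1 - t) \<le> 2 * real D / (real (Suc n) * (1 - t)) + 2 * real D"
        using lower upper order.trans by blast
    qed
  qed
  define K where "K = 2 * D + 1"
  have "((\<lambda>t. \<Sum>k=1..K. t ^ (k\<^sup>2)) \<longlongrightarrow> (\<Sum>k=1..K. 1 ^ (k\<^sup>2))) (at_left (1::real))"
    by (intro tendsto_intros)
  moreover have "eventually (\<lambda>t. (\<Sum>k=1..K. t ^ (k\<^sup>2)) \<le> 2 * real D) (at_left (1::real))"
  proof (rule eventually_mono)
    show "eventually (\<lambda>t. t \<in> {0<..<1}) (at_left (1::real))" by (rule eventually_at_left_real) simp
    show "(\<Sum>k=1..K. t ^ (k\<^sup>2)) \<le> 2 * real D" if "t \<in> {0<..<1}" for t :: real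
      using that by (intro bound) auto
  qed
  ultimately have "(\<Sum>k=1..K. 1 ^ (k\<^sup>2)) \<le> 2 * real D"
    by (rule tendsto_upperbound) simp
  thus False by (simp add: K_def)
qed

section \<open>Chebyshev and Mertens estimates for the von Mangoldt function\<close>

lemma ln_fact_eq_sum_mangoldt:
  "ln (fact N) = (\<Sum>d=1..N. mangoldt d * real (N div d))"
proof -
  have "ln (fact N :: real) = (\<Sum>n=1..N. ln (real n))" by (induction N) (simp_all add: ln_mult)
  also have "\<dots> = (\<Sum>n=1..N. \<Sum>d | d dvd n. mangoldt d)"
    by (intro sum.cong) (auto simp: mangoldt_sum)
  also have "\<dots> = (\<Sum>d=1..N. \<Sum>k=1..N div d. mangoldt d)"
    by (rule sum_divisors_swap)
  finally show ?thesis by (simp add: mult.commute)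
qed

text \<open>Chebyshev's argument: the logarithm of the central binomial coefficient counts each
  \<Lambda>(d) with M < d <= 2M exactly once, and the coefficient is at most 4^M. The induction
  halves N, rounded up; the factor 2 in the bound absorbs the geometric series and the
  rounding.\<close>

lemma sum_mangoldt_le:
  "(\<Sum>d=1..N. mangoldt d) \<le> 2 * ln 4 * real N"
proof (induction N rule: less_induct)
  case (less N)
  have double: "(\<Sum>d=1..2*M. mangoldt d) \<le> (\<Sum>d=1..M. mangoldt d) + real M * ln 4" for M
  proof -
    have "(\<Sum>d=1..2*M. mangoldt d) - (\<Sum>d=1..M. mangoldt d) = (\<Sum>d\<in>{M<..2*M}. mangoldt d :: real)"
    proof -
      have eq: "{1..2*M} = {1..M} \<union> {M<..2*M}" by auto
      have "(\<Sum>d=1..2*M. mangoldt d) = (\<Sum>d=1..M. mangoldt d) + (\<Sum>d\<in>{M<..2*M}. mangoldt d :: real)"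
        unfolding eq by (rule sum.union_disjoint) auto
      thus ?thesis by simp
    qed
    \<comment> \<open>On this range the weight is 1 - 0; for smaller d it is nonnegative, so the
      range can be enlarged afterwards.\<close>
    also have "\<dots> = (\<Sum>d\<in>{M<..2*M}. mangoldt d * (real (2 * M div d) - 2 * real (M div d)))"
      by (intro sum.cong) (auto simp: div_if)
    also have "\<dots> \<le> (\<Sum>d=1..2*M. mangoldt d * (real (2 * M div d) - 2 * real (M div d)))"
    proof (rule sum_mono2)
      fix d assume "d \<in> {1..2*M} - {M<..2*M}"
      have "d * (2 * (M div d)) \<le> 2 * M" by (metis mult.left_commute mult_le_mono2 times_div_less_eq_dividend)
      hence "2 * (M div d) \<le> 2 * M div d" using \<open>d \<in> _\<close> by (simp add: less_eq_div_iff_mult_less_eq mult.commute)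
      hence "2 * real (M div d) \<le> real (2 * M div d)" by linarith
      thus "0 \<le> mangoldt d * (real (2 * M div d) - 2 * real (M div d))"
        by (intro mult_nonneg_nonneg mangoldt_nonneg) simp
    qed auto
    also have "\<dots> = ln (fact (2 * M)) - 2 * ln (fact M)"
    proof -
      have "(\<Sum>d=1..2*M. mangoldt d * real (M div d)) = (\<Sum>d=1..M. mangoldt d * real (M div d))"
        by (rule sum.mono_neutral_right) auto
      moreover have "(\<Sum>d=1..2*M. mangoldt d * (real (2 * M div d) - 2 * real (M div d)))
          = (\<Sum>d=1..2*M. mangoldt d * real (2 * M div d)) - 2 * (\<Sum>d=1..2*M. mangoldt d * real (M div d))"
        unfolding sum_distrib_left sum_subtractf[symmetric] by (simp add: algebra_simps)
      ultimately show ?thesis by (simp only: ln_fact_eq_sum_mangoldt)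
    qed
    also have "\<dots> = ln (real (2 * M choose M))"
    proof -
      have "real (2 * M choose M) = fact (2 * M) / (fact M * fact M)" by (simp add: binomial_fact)
      thus ?thesis by (simp add: ln_div ln_mult)
    qed
    also have "\<dots> \<le> ln (4 ^ M)"
    proof (subst ln_le_cancel_iff)
      show "0 < real (2 * M choose M)" by (simp add: zero_less_binomial_iff)
      have "(2 * M choose M) \<le> 2 ^ (2 * M)" by (rule binomial_le_pow2)
      also have "\<dots> = 4 ^ M" by (simp add: power_mult)
      finally show "real (2 * M choose M) \<le> 4 ^ M" by (metis of_nat_le_iff of_nat_numeral of_nat_power)
    qed simp
    finally show ?thesis by (simp add: ln_realpow)
  qed
  show ?case
  proof (cases "N \<le> 1")
    case True
    hence "N = 0 \<or> N = 1" by auto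
    thus ?thesis by auto
  next
    case False
    define M where "M = Suc N div 2"
    have M: "M < N" "N \<le> 2 * M" "2 * real M \<le> real N + 1" using False by (auto simp: M_def)
    have "(\<Sum>d=1..N. mangoldt d) \<le> (\<Sum>d=1..2*M. mangoldt d :: real)"
      using M by (intro sum_mono2) (auto simp: mangoldt_nonneg)
    also have "\<dots> \<le> 2 * ln 4 * real M + real M * ln 4" using double[of M] less[of M] M by linarith
    also have "\<dots> = (3 * real M) * ln 4" by simp
    also have "\<dots> \<le> (2 * real N) * ln 4"
    proof (rule mult_right_mono)
      show "3 * real M \<le> 2 * real N"
      proof (cases "N = 2")
        case False
        hence "real N \<ge> 3" using \<open>\<not> N \<le> 1\<close> by simp
        thus ?thesis using M(3) by linarith
      qed (simp add: M_def)
    qed simp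
    finally show ?thesis by (simp add: mult_ac)
  qed
qed

lemma ln_over_self_decreasing:
  assumes "n \<ge> 3" shows "ln (real (Suc n)) / real (Suc n) \<le> ln (real n) / real n"
proof -
  have "exp 1 \<le> real n" using exp_le assms by linarith
  hence ge1: "ln (real n) \<ge> 1" using assms by (metis ln_ge_iff of_nat_0_less_iff order_less_le_trans zero_less_numeral)
  have "ln (real (Suc n)) = ln (real n) + ln (1 + 1 / real n)"
  proof -
    have "real (Suc n) = real n * (1 + 1 / real n)" using assms by (simp add: field_simps)
    moreover have "1 + 1 / real n > 0" by (simp add: add_pos_nonneg)
    ultimately show ?thesis using assms by (simp only: ln_mult_pos of_nat_0_less_iff)
  qed
  also have "ln (1 + 1 / real n) \<le> 1 / real n" by (rule ln_add_one_self_le_self) simp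
  finally have "real n * ln (real (Suc n)) \<le> real n * (ln (real n) + 1 / real n)"
    by (intro mult_left_mono) auto
  also have "\<dots> = real n * ln (real n) + 1" using assms by (simp add: field_simps)
  also have "\<dots> \<le> real (Suc n) * ln (real n)" using ge1 by (simp add: algebra_simps)
  finally show ?thesis using assms by (simp add: divide_simps mult.commute del: of_nat_Suc)
qed

text \<open>Mertens' argument. Since ln is the convolution of \<Lambda> with 1, the sum of \<xi>(n)
  ln n / n, bounded by summation by parts, equals the sum of \<xi>(d) \<Lambda>(d) / d * S(N div d).
  Here S(N div d) is L up to O(d/N), Chebyshev's estimate bounds the total error, and finally one
  divides by L, which is nonzero.\<close>

lemma real_char_mangoldt_sum_bounded:
  assumes \<xi>: "real_char D \<xi>" and D: "D > 0" and np: "\<xi> \<noteq> principal_char D"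
  obtains B where "\<And>N. \<bar>\<Sum>d=1..N. \<xi> d * mangoldt d / real d\<bar> \<le> B"
proof -
  obtain L where L: "\<And>N. \<bar>(\<Sum>n=1..N. \<xi> n / real n) - L\<bar> \<le> 2 * real D / real (Suc N)"
    using real_char_L_exists[OF assms] by blast
  have L0: "L \<noteq> 0" by (rule real_char_L_nonzero[OF assms L])
  define S where "S = (\<lambda>N. \<Sum>n=1..N. \<xi> n / real n)"
  \<comment> \<open>ln n / n decreases only from n = 3 on, so the term n = 2 is bounded
    separately.\<close>
  define C where "C = ln 2 / 2 + 2 * real D * (ln (real 3) / real 3)"
  have logsum: "\<bar>\<Sum>n=1..N. \<xi> n * ln (real n) / real n\<bar> \<le> C" for N
  proof (cases "N \<ge> 3")
    case True
    have "(\<Sum>n=1..N. \<xi> n * ln (real n) / real n) = \<xi> 2 * ln 2 / 2 + (\<Sum>n\<in>{3..<Suc N}. \<xi> n * (ln (real n) / real n))"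
    proof -
      have "{1..N} = insert 1 (insert 2 {3..<Suc N})" using True by auto
      thus ?thesis by simp
    qed
    moreover have "\<bar>\<Sum>n\<in>{3..<Suc N}. \<xi> n * (ln (real n) / real n)\<bar> \<le> 2 * real D * (ln (real 3) / real 3)"
      using True
      by (intro abel_summation_bound real_char_window_sum[OF \<xi> D np] ln_over_self_decreasing) auto
    moreover have "\<bar>\<xi> 2 * ln 2 / 2\<bar> \<le> ln 2 / 2"
      using real_char_abs_le[OF \<xi>, of 2] by (simp add: abs_mult mult_left_le_one_le)
    ultimately show ?thesis unfolding C_def by linarith
  next
    case False
    have "0 \<le> 2 * real D * (ln (real 3) / real 3)" by simp
    moreover have "\<bar>\<xi> 2 * ln 2 / 2\<bar> \<le> ln 2 / 2"
      using real_char_abs_le[OF \<xi>, of 2] by (simp add: abs_mult mult_left_le_one_le)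
    moreover have "(\<Sum>n=1..N. \<xi> n * ln (real n) / real n) = 0 \<or>
       (\<Sum>n=1..N. \<xi> n * ln (real n) / real n) = \<xi> 2 * ln 2 / 2"
    proof -
      have "N = 0 \<or> N = 1 \<or> N = 2" using False by linarith
      moreover have "{1..2} = {1, 2 :: nat}" by auto
      ultimately show ?thesis by (elim disjE) simp_all
    qed
    moreover have "ln 2 / 2 > (0::real)" by simp
    ultimately show ?thesis unfolding C_def by linarith
  qed
  have swap: "(\<Sum>n=1..N. \<xi> n * ln (real n) / real n) = (\<Sum>d=1..N. \<xi> d * mangoldt d / real d * S (N div d))" for N
  proof -
    have "(\<Sum>n=1..N. \<xi> n * ln (real n) / real n)
        = (\<Sum>n=1..N. \<Sum>d | d dvd n. \<xi> d * mangoldt d / real d * (\<xi> (n div d) / real (n div d)))"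
    proof (rule sum.cong)
      fix n assume n: "n \<in> {1..N}"
      have "\<xi> n * ln (real n) / real n = (\<Sum>d | d dvd n. \<xi> n * mangoldt d / real n)"
      proof -
        have "ln (real n) = (\<Sum>d | d dvd n. mangoldt d)" using n mangoldt_sum[of n, where ?'a = real] by simp
        thus ?thesis by (simp only: sum_distrib_left sum_divide_distrib)
      qed
      also have "\<dots> = (\<Sum>d | d dvd n. \<xi> d * mangoldt d / real d * (\<xi> (n div d) / real (n div d)))"
      proof (rule sum.cong)
        fix d assume "d \<in> {d. d dvd n}"
        then obtain k where k: "n = d * k" by auto
        moreover have "\<xi> (d * k) = \<xi> d * \<xi> k" using \<xi> unfolding real_char_def by blast
        ultimately show "\<xi> n * mangoldt d / real n = \<xi> d * mangoldt d / real d * (\<xi> (n div d) / real (n div d))"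
          using n by auto
      qed simp
      finally show "\<xi> n * ln (real n) / real n = \<dots>" .
    qed simp
    also have "\<dots> = (\<Sum>d=1..N. \<Sum>k=1..N div d. \<xi> d * mangoldt d / real d * (\<xi> k / real k))"
      by (rule sum_divisors_swap)
    finally show ?thesis unfolding S_def by (simp only: sum_distrib_left)
  qed
  \<comment> \<open>The product of Chebyshev's constant \<open>2 * ln 4\<close> and the constant
    \<open>2 * D\<close> in the rate of convergence.\<close>
  define E where "E = 4 * real D * ln 4"
  have main: "\<bar>\<Sum>d=1..N. \<xi> d * mangoldt d / real d\<bar> \<le> (C + E) / \<bar>L\<bar>" for N
  proof -
    let ?X = "\<Sum>d=1..N. \<xi> d * mangoldt d / real d"
    have "\<bar>\<Sum>d=1..N. \<xi> d * mangoldt d / real d * (S (N div d) - L)\<bar>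
        \<le> (\<Sum>d=1..N. mangoldt d * (2 * real D / real N))"
    proof (rule order.trans[OF sum_abs], rule sum_mono)
      fix d assume d: "d \<in> {1..N}"
      have "N < d * Suc (N div d)" using d dividend_less_times_div[of d N] by (simp add: algebra_simps)
      hence le: "real N \<le> real d * real (Suc (N div d))" by (metis less_imp_le of_nat_le_iff of_nat_mult)
      have "\<bar>\<xi> d * mangoldt d / real d * (S (N div d) - L)\<bar> = \<bar>\<xi> d\<bar> * (mangoldt d / real d * \<bar>S (N div d) - L\<bar>)"
        by (simp add: abs_mult)
      also have "\<dots> \<le> 1 * (mangoldt d / real d * (2 * real D / real (Suc (N div d))))"
        using L[of "N div d"] real_char_abs_le[OF \<xi>, of d]
        by (intro mult_mono) (auto simp: S_def mangoldt_nonneg intro!: divide_nonneg_nonneg)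
      also have "\<dots> = mangoldt d * (2 * real D / (real d * real (Suc (N div d))))" by simp
      also have "\<dots> \<le> mangoldt d * (2 * real D / real N)"
        using le d by (intro mult_left_mono divide_left_mono) (auto simp: mangoldt_nonneg simp del: of_nat_Suc)
      finally show "\<bar>\<xi> d * mangoldt d / real d * (S (N div d) - L)\<bar> \<le> mangoldt d * (2 * real D / real N)" .
    qed
    also have "\<dots> = (\<Sum>d=1..N. mangoldt d) * (2 * real D / real N)" by (simp only: sum_distrib_right)
    also have "\<dots> \<le> (2 * ln 4 * real N) * (2 * real D / real N)"
      by (intro mult_right_mono sum_mangoldt_le) auto
    also have "\<dots> \<le> E" by (simp add: E_def)
    finally have 1: "\<bar>\<Sum>d=1..N. \<xi> d * mangoldt d / real d * (S (N div d) - L)\<bar> \<le> E" .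
    have "L * ?X = (\<Sum>d=1..N. \<xi> d * mangoldt d / real d * S (N div d)) - (\<Sum>d=1..N. \<xi> d * mangoldt d / real d * (S (N div d) - L))"
    proof -
      have "(\<Sum>d=1..N. \<xi> d * mangoldt d / real d * L) = L * ?X"
        by (simp only: sum_distrib_right[symmetric] mult.commute[of L])
      thus ?thesis by (simp only: right_diff_distrib sum_subtractf)
    qed
    hence "\<bar>L * ?X\<bar> \<le> C + E" using 1 logsum[of N] swap[of N] by linarith
    hence "\<bar>?X\<bar> * \<bar>L\<bar> \<le> C + E" by (simp add: abs_mult mult.commute)
    thus ?thesis using L0 by (subst pos_le_divide_eq) simp_all
  qed
  show ?thesis by (rule that[OF main])
qed

section \<open>Primes on which finitely many real characters take prescribed values\<close>

text \<open>The primes alone carry the divergence of the sum of \<Lambda>(d) / d. The powers of p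
  from p^2 on contribute at most 4 p^(-3/2): one factor 2 bounds the geometric series, the other
  comes from ln p <= 2 sqrt p.\<close>

lemma sum_mangoldt_prime_powers_bounded:
  obtains C where "\<And>N. (\<Sum>d | d \<in> {1..N} \<and> \<not> prime d. mangoldt d / real d) \<le> C"
proof -
  have summ: "summable (\<lambda>n. 4 * real n powr (- (3/2)))"
    by (intro summable_mult) (simp add: summable_real_powr_iff)
  have "(\<Sum>d | d \<in> {1..N} \<and> \<not> prime d. mangoldt d / real d) \<le> (\<Sum>n. 4 * real n powr (- (3/2)))" for N
  proof -
    let ?f = "\<lambda>(p, k). ln (real p) / real (p ^ k)"
    let ?A = "{d. d \<in> {1..N} \<and> primepow d \<and> \<not> prime d}"
    have "(\<Sum>d | d \<in> {1..N} \<and> \<not> prime d. mangoldt d / real d) = (\<Sum>d\<in>?A. mangoldt d / real d)"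
      by (rule sum.mono_neutral_right) (auto simp: mangoldt_def)
    also have "\<dots> \<le> (\<Sum>(p, k)\<in>{2..N} \<times> {2..N}. ln (real p) / real (p ^ k))"
    proof (rule sum_le_included[where i = "\<lambda>(p, k). p ^ k"])
      show "\<forall>x\<in>{2..N} \<times> {2..N}. 0 \<le> (case x of (p, k) \<Rightarrow> ln (real p) / real (p ^ k))" by auto
      show "\<forall>d\<in>?A. \<exists>y\<in>{2..N} \<times> {2..N}. (case y of (p, k) \<Rightarrow> p ^ k) = d \<and>
              mangoldt d / real d \<le> (case y of (p, k) \<Rightarrow> ln (real p) / real (p ^ k))"
      proof
        fix d assume d: "d \<in> ?A"
        then obtain p k where pk: "prime p" "k > 0" "d = p ^ k" by (auto simp: primepow_def)
        have "k \<noteq> 1" using d pk by auto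
        hence k2: "k \<ge> 2" using pk(2) by simp
        have p2: "p \<ge> 2" using pk(1) by (rule prime_ge_2_nat)
        have "k < 2 ^ k" by (rule less_exp)
        also have "2 ^ k \<le> p ^ k" using p2 by (rule power_mono) simp
        finally have "k \<le> N" using d pk by simp
        moreover have "p ^ 1 \<le> p ^ k" using p2 pk(2) by (intro power_increasing) auto
        hence "p \<le> N" using d pk by simp
        ultimately have "(p, k) \<in> {2..N} \<times> {2..N}" using k2 p2 by simp
        moreover have "mangoldt d = ln (real p)" using pk by simp
        ultimately show "\<exists>y\<in>{2..N} \<times> {2..N}. (case y of (p, k) \<Rightarrow> p ^ k) = d \<and>
              mangoldt d / real d \<le> (case y of (p, k) \<Rightarrow> ln (real p) / real (p ^ k))"
          using pk(3) by (intro bexI[of _ "(p, k)"]) simp_all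
      qed
    qed auto
    also have "\<dots> = (\<Sum>p=2..N. \<Sum>k=2..N. ln (real p) / real (p ^ k))"
      by (simp add: sum.cartesian_product)
    also have "\<dots> \<le> (\<Sum>p=2..N. 4 * real p powr (- (3/2)))"
    proof (rule sum_mono)
      fix p assume p: "p \<in> {2..N}"
      define x where "x = 1 / real p"
      have x: "0 < x" "x \<le> 1/2" using p by (auto simp: x_def field_simps)
      have geo: "(\<Sum>k=2..M. x ^ k) \<le> 2 * x\<^sup>2" for M
      proof -
        have "(\<Sum>k=2..M. x ^ k) \<le> 2 * x\<^sup>2 - 2 * x ^ Suc M \<or> M < 2"
        proof (induction M)
          case (Suc M)
          have "x * x ^ Suc M \<le> 1/2 * x ^ Suc M" using x by (intro mult_right_mono) auto
          hence half: "2 * x ^ Suc (Suc M) \<le> x ^ Suc M" by simp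
          show ?case
          proof (cases "M < 2")
            case True
            have "2 * x ^ 3 \<le> x ^ 2" using x by (simp add: power3_eq_cube power2_eq_square)
            thus ?thesis using True by (cases "M = 1") (auto simp: numeral_2_eq_2 numeral_3_eq_3)
          next
            case False
            thus ?thesis using Suc half by simp
          qed
        qed simp
        moreover have "x ^ Suc M \<ge> 0" using x by simp
        ultimately show ?thesis by auto
      qed
      have "(\<Sum>k=2..N. ln (real p) / real (p ^ k)) = ln (real p) * (\<Sum>k=2..N. x ^ k)"
        by (simp add: sum_distrib_left x_def divide_inverse power_inverse)
      also have "\<dots> \<le> ln (real p) * (2 * x\<^sup>2)" using p geo by (intro mult_left_mono) auto
      also have "ln (real p) \<le> 2 * real p powr (1/2)"
        using p ln_bound[of "real p powr (1/2)"] by (simp add: ln_powr)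
      hence "ln (real p) * (2 * x\<^sup>2) \<le> 2 * real p powr (1/2) * (2 * x\<^sup>2)"
        by (rule mult_right_mono) simp
      also have "x\<^sup>2 = real p powr (- 2)"
        using p by (simp add: x_def powr_minus divide_inverse power_inverse)
      also have "2 * real p powr (1/2) * (2 * real p powr (- 2)) = 4 * real p powr (- (3/2))"
        by (simp add: powr_add[symmetric])
      finally show "(\<Sum>k=2..N. ln (real p) / real (p ^ k)) \<le> 4 * real p powr (- (3/2))" .
    qed
    also have "\<dots> \<le> (\<Sum>n. 4 * real n powr (- (3/2)))"
      by (rule sum_le_suminf[OF summ]) auto
    finally show ?thesis .
  qed
  thus ?thesis using that by blast
qed

text \<open>The lower half of Mertens' theorem: ln N! is at least N ln N - N, and replacing
  \<open>N div d\<close> by N/d only enlarges its expansion.\<close>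

lemma sum_mangoldt_div_ge:
  assumes "N > 0"
  shows "ln (real N) - 1 \<le> (\<Sum>d=1..N. mangoldt d / real d)"
proof -
  have fact: "real n * ln (real n) - real n \<le> ln (fact n)" if "n > 0" for n
    using that
  proof (induction n rule: nat_induct_non_zero)
    case (Suc n)
    have "ln (real (Suc n)) = ln (real n) + ln (1 + 1 / real n)"
    proof -
      have "real (Suc n) = real n * (1 + 1 / real n)" using Suc by (simp add: field_simps)
      moreover have "1 + 1 / real n > 0" by (simp add: add_pos_nonneg)
      ultimately show ?thesis using Suc by (simp only: ln_mult_pos of_nat_0_less_iff)
    qed
    moreover have "ln (1 + 1 / real n) \<le> 1 / real n" by (rule ln_add_one_self_le_self) simp
    ultimately have "real n * ln (real (Suc n)) \<le> real n * (ln (real n) + 1 / real n)"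
      by (intro mult_left_mono) auto
    also have "\<dots> = real n * ln (real n) + 1" using Suc by (simp add: field_simps)
    finally have "real (Suc n) * ln (real (Suc n)) - real (Suc n) \<le> ln (real (Suc n)) + (real n * ln (real n) - real n)"
      by (simp add: algebra_simps)
    also have "\<dots> \<le> ln (real (Suc n)) + ln (fact n)" using Suc by simp
    also have "\<dots> = ln (fact (Suc n))" by (simp add: ln_mult)
    finally show ?case .
  qed simp
  have "real N * ln (real N) - real N \<le> (\<Sum>d=1..N. mangoldt d * real (N div d))"
    using fact[OF assms] by (simp only: ln_fact_eq_sum_mangoldt)
  also have "\<dots> \<le> (\<Sum>d=1..N. mangoldt d * (real N / real d))"
  proof (intro sum_mono mult_left_mono mangoldt_nonneg)
    fix d :: nat
    show "real (N div d) \<le> real N / real d"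
      by (cases "d = 0") (auto simp: pos_le_divide_eq simp flip: of_nat_mult)
  qed
  also have "\<dots> = real N * (\<Sum>d=1..N. mangoldt d / real d)"
    by (simp add: sum_distrib_left mult_ac)
  finally have "real N * (ln (real N) - 1) \<le> real N * (\<Sum>d=1..N. mangoldt d / real d)"
    by (simp add: algebra_simps)
  thus ?thesis using assms by simp
qed

text \<open>If n is prime to D and a real character \<psi> separates n from c, replacing \<xi> by
  \<psi>\<xi> permutes the characters and reverses the sign of the sum, which therefore vanishes. If
  no character separates them, every summand is 1.\<close>

lemma real_char_orthogonality:
  assumes D: "D > 0" and n: "coprime c D"
  shows "(\<Sum>\<xi> | real_char D \<xi>. \<xi> c * \<xi> n) \<in> {0, real (card {\<xi>. real_char D \<xi>})}"
    and "(\<Sum>\<xi> | real_char D \<xi>. \<xi> c * \<xi> n) \<noteq> 0 \<Longrightarrow> \<forall>\<xi>. real_char D \<xi> \<longrightarrow> \<xi> n = \<xi> c"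
proof -
  let ?X = "{\<xi>. real_char D \<xi>}"
  have c1: "\<xi> c * \<xi> c = 1" if "real_char D \<xi>" for \<xi>
  proof -
    have "\<xi> c \<in> {-1, 0, 1}" "\<xi> c = 0 \<longleftrightarrow> \<not> coprime c D"
      using that unfolding real_char_def by blast+
    thus ?thesis using n by auto
  qed
  have zero: "(\<Sum>\<xi>\<in>?X. \<xi> c * \<xi> n) = 0" if \<psi>: "real_char D \<psi>" "\<psi> n \<noteq> \<psi> c" for \<psi>
  proof (cases "coprime n D")
    case False
    have "\<xi> n = 0" if "real_char D \<xi>" for \<xi> using that False unfolding real_char_def by blast
    thus ?thesis by (intro sum.neutral) simp
  next
    case True
    have n1: "\<psi> n * \<psi> c = -1"
    proof -
      have "\<psi> c \<in> {-1, 0, 1}" "\<psi> c = 0 \<longleftrightarrow> \<not> coprime c D" "\<psi> n \<in> {-1, 0, 1}" "\<psi> n = 0 \<longleftrightarrow> \<not> coprime n D"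
        using \<psi> unfolding real_char_def by blast+
      thus ?thesis using n True \<psi>(2) by auto
    qed
    have inv: "\<psi> m * (\<psi> m * \<xi> m) = \<xi> m" if "real_char D \<xi>" for \<xi> m
    proof -
      have "\<psi> m \<in> {-1, 0, 1}" "\<psi> m = 0 \<longleftrightarrow> \<not> coprime m D" "\<xi> m = 0 \<longleftrightarrow> \<not> coprime m D"
        using \<psi> that unfolding real_char_def by blast+
      thus ?thesis by auto
    qed
    have "(\<Sum>\<xi>\<in>?X. \<xi> c * \<xi> n) = (\<Sum>\<xi>\<in>?X. (\<psi> c * \<xi> c) * (\<psi> n * \<xi> n))"
    proof (rule sum.reindex_bij_witness[of _ "\<lambda>\<xi> m. \<psi> m * \<xi> m" "\<lambda>\<xi> m. \<psi> m * \<xi> m"])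
      fix \<xi> assume "\<xi> \<in> ?X"
      hence \<xi>: "real_char D \<xi>" by simp
      show "(\<psi> c * (\<psi> c * \<xi> c)) * (\<psi> n * (\<psi> n * \<xi> n)) = \<xi> c * \<xi> n"
        by (simp only: inv[OF \<xi>])
      show "(\<lambda>m. \<psi> m * \<xi> m) \<in> ?X" using real_char_mult[OF \<psi>(1) \<xi>] by simp
      thus "(\<lambda>m. \<psi> m * \<xi> m) \<in> ?X" .
      show "(\<lambda>m. \<psi> m * (\<psi> m * \<xi> m)) = \<xi>" by (rule ext) (rule inv[OF \<xi>])
      thus "(\<lambda>m. \<psi> m * (\<psi> m * \<xi> m)) = \<xi>" .
    qed
    also have "\<dots> = (\<Sum>\<xi>\<in>?X. (\<psi> n * \<psi> c) * (\<xi> c * \<xi> n))" by (simp only: mult_ac)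
    also have "\<dots> = - (\<Sum>\<xi>\<in>?X. \<xi> c * \<xi> n)" unfolding n1 by (simp add: sum_negf)
    finally show ?thesis by simp
  qed
  show "(\<Sum>\<xi>\<in>?X. \<xi> c * \<xi> n) \<noteq> 0 \<Longrightarrow> \<forall>\<xi>. real_char D \<xi> \<longrightarrow> \<xi> n = \<xi> c"
    using zero by blast
  show "(\<Sum>\<xi>\<in>?X. \<xi> c * \<xi> n) \<in> {0, real (card ?X)}"
  proof (cases "\<forall>\<xi>. real_char D \<xi> \<longrightarrow> \<xi> n = \<xi> c")
    case True
    hence "(\<Sum>\<xi>\<in>?X. \<xi> c * \<xi> n) = (\<Sum>\<xi>\<in>?X. 1)" by (intro sum.cong) (auto simp: c1)
    thus ?thesis by simp
  qed (use zero in blast)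
qed

text \<open>Dirichlet's argument. Without such primes beyond \<open>K\<close>, the weight
  \<open>w\<close> vanishes at all larger primes and the sum of w(d) \<Lambda>(d) / d over primes d
  <= N stays bounded. But the principal character contributes ln N to it up to a constant, and every
  other real character a bounded amount.\<close>

theorem exists_prime_real_char_eq:
  assumes D: "D > 0" and c: "coprime c D"
  shows "\<exists>q. prime q \<and> q > K \<and> (\<forall>\<xi>. real_char D \<xi> \<longrightarrow> \<xi> q = \<xi> c)"
proof (rule ccontr)
  assume no: "\<not> ?thesis"
  let ?X = "{\<xi>. real_char D \<xi>}"
  define w where "w = (\<lambda>n. \<Sum>\<xi>\<in>?X. \<xi> c * \<xi> n)"
  define g :: "nat \<Rightarrow> real" where "g = (\<lambda>d. mangoldt d / real d)"
  have finX: "finite ?X" by (rule finite_real_chars[OF D])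
  have w: "w n \<le> real (card ?X)" for n
    using real_char_orthogonality(1)[OF D c, of n] unfolding w_def by auto
  have w0: "w q = 0" if "prime q" "q > K" for q
    using no that real_char_orthogonality(2)[OF D c, of q] unfolding w_def by blast
  obtain C where C: "\<And>N. (\<Sum>d | d \<in> {1..N} \<and> \<not> prime d. g d) \<le> C"
    using sum_mangoldt_prime_powers_bounded unfolding g_def by blast
  \<comment> \<open>The assumption is about primes and says nothing about their powers, so the sums
    are restricted to primes, at the price of the constant \<open>C\<close>.\<close>
  define P where "P = (\<lambda>N :: nat. {d \<in> {1..N}. prime d})"
  have finP: "finite (P N)" for N unfolding P_def by (rule finite_subset[of _ "{1..N}"]) auto
  have split: "(\<Sum>d=1..N. f d) = (\<Sum>d\<in>P N. f d) + (\<Sum>d | d \<in> {1..N} \<and> \<not> prime d. f d)"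
    for f :: "nat \<Rightarrow> real" and N
  proof -
    have "{1..N} = P N \<union> {d. d \<in> {1..N} \<and> \<not> prime d}" by (auto simp: P_def)
    moreover have "finite {d. d \<in> {1..N} \<and> \<not> prime d}" by (rule finite_subset[of _ "{1..N}"]) auto
    moreover have "P N \<inter> {d. d \<in> {1..N} \<and> \<not> prime d} = {}" by (auto simp: P_def)
    ultimately show ?thesis using sum.union_disjoint[of "P N" "{d. d \<in> {1..N} \<and> \<not> prime d}" f] finP by metis
  qed
  have nonneg: "0 \<le> g d" for d by (simp add: g_def mangoldt_nonneg)
  have "\<exists>B. \<forall>N. \<bar>\<Sum>d=1..N. \<xi> d * g d\<bar> \<le> B" if "\<xi> \<in> ?X - {principal_char D}" for \<xi>
  proof -
    obtain B where "\<And>N. \<bar>\<Sum>d=1..N. \<xi> d * mangoldt d / real d\<bar> \<le> B"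
      using real_char_mangoldt_sum_bounded[OF _ D] \<open>\<xi> \<in> _\<close> by blast
    thus ?thesis unfolding g_def by auto
  qed
  then obtain B where B: "\<And>\<xi> N. \<xi> \<in> ?X - {principal_char D} \<Longrightarrow> \<bar>\<Sum>d=1..N. \<xi> d * g d\<bar> \<le> B \<xi>"
    by metis
  have Bp: "\<bar>\<Sum>d\<in>P N. \<xi> c * \<xi> d * g d\<bar> \<le> B \<xi> + C" if \<xi>: "\<xi> \<in> ?X - {principal_char D}" for \<xi> N
  proof -
    have ch: "real_char D \<xi>" using \<xi> by simp
    have "\<bar>\<Sum>d | d \<in> {1..N} \<and> \<not> prime d. \<xi> d * g d\<bar> \<le> (\<Sum>d | d \<in> {1..N} \<and> \<not> prime d. g d)"
    proof (rule order.trans[OF sum_abs], rule sum_mono)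
      fix d
      show "\<bar>\<xi> d * g d\<bar> \<le> g d"
        unfolding abs_mult abs_of_nonneg[OF nonneg]
        using mult_right_mono[OF real_char_abs_le[OF ch, of d] nonneg[of d]] by simp
    qed
    hence "\<bar>\<Sum>d\<in>P N. \<xi> d * g d\<bar> \<le> B \<xi> + C"
      using split[of "\<lambda>d. \<xi> d * g d" N] B[OF \<xi>, of N] C[of N] by linarith
    moreover have "\<bar>\<Sum>d\<in>P N. \<xi> c * \<xi> d * g d\<bar> = \<bar>\<xi> c\<bar> * \<bar>\<Sum>d\<in>P N. \<xi> d * g d\<bar>"
      by (simp only: mult.assoc sum_distrib_left[symmetric] abs_mult)
    moreover have "\<bar>\<xi> c\<bar> * \<bar>\<Sum>d\<in>P N. \<xi> d * g d\<bar> \<le> \<bar>\<Sum>d\<in>P N. \<xi> d * g d\<bar>"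
      using real_char_abs_le[OF ch, of c] by (intro mult_left_le_one_le) auto
    ultimately show ?thesis by linarith
  qed
  define B' where "B' = (\<Sum>\<xi>\<in>?X - {principal_char D}. B \<xi> + C)"
  \<comment> \<open>The principal character omits the primes dividing \<open>D\<close>; these are at
    most \<open>D\<close>.\<close>
  define E where "E = (\<Sum>d\<in>{1..D}. g d)"
  define Q where "Q = (\<Sum>d\<in>{1..K}. real (card ?X) * g d)"
  have bound: "ln (real N) \<le> 1 + C + E + B' + Q" if N: "N > 0" for N
  proof -
    have "(\<Sum>d\<in>P N. w d * g d) = (\<Sum>d\<in>P N \<inter> {1..K}. w d * g d)"
    proof (rule sum.mono_neutral_right[OF finP])
      show "\<forall>d\<in>P N - P N \<inter> {1..K}. w d * g d = 0"
      proof
        fix d assume "d \<in> P N - P N \<inter> {1..K}"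
        hence "prime d" "d > K" unfolding P_def by auto
        thus "w d * g d = 0" by (simp add: w0)
      qed
    qed auto
    also have "\<dots> \<le> (\<Sum>d\<in>P N \<inter> {1..K}. real (card ?X) * g d)"
      by (intro sum_mono mult_right_mono w nonneg)
    also have "\<dots> \<le> Q" unfolding Q_def by (rule sum_mono2) (auto simp: nonneg)
    finally have upper: "(\<Sum>d\<in>P N. w d * g d) \<le> Q" .
    have "(\<Sum>d\<in>P N. w d * g d) = (\<Sum>\<xi>\<in>?X. \<Sum>d\<in>P N. \<xi> c * \<xi> d * g d)"
      unfolding w_def sum_distrib_right by (rule sum.swap)
    also have "\<dots> = (\<Sum>d\<in>P N. principal_char D c * principal_char D d * g d) + (\<Sum>\<xi>\<in>?X - {principal_char D}. \<Sum>d\<in>P N. \<xi> c * \<xi> d * g d)"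
      using finX real_char_principal by (subst sum.remove[of _ "principal_char D"]) auto
    finally have total: "(\<Sum>d\<in>P N. w d * g d) = \<dots>" .
    have "\<bar>\<Sum>\<xi>\<in>?X - {principal_char D}. \<Sum>d\<in>P N. \<xi> c * \<xi> d * g d\<bar> \<le> B'"
      unfolding B'_def by (rule order.trans[OF sum_abs], rule sum_mono, rule Bp)
    hence rest: "(\<Sum>\<xi>\<in>?X - {principal_char D}. \<Sum>d\<in>P N. \<xi> c * \<xi> d * g d) \<ge> - B'" by linarith
    have "(\<Sum>d\<in>P N. g d) \<le> (\<Sum>d\<in>P N. principal_char D c * principal_char D d * g d) + E"
    proof -
      have "(\<Sum>d\<in>P N. g d) - (\<Sum>d\<in>P N. principal_char D c * principal_char D d * g d)
          = (\<Sum>d\<in>P N. if d dvd D then g d else 0)"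
        unfolding sum_subtractf[symmetric]
      proof (rule sum.cong)
        fix d assume "d \<in> P N"
        hence "coprime d D \<longleftrightarrow> \<not> d dvd D"
          unfolding P_def using prime_imp_coprime_nat by (auto dest: coprime_common_divisor[of d D d] simp: prime_nat_iff)
        thus "g d - principal_char D c * principal_char D d * g d = (if d dvd D then g d else 0)"
          using c by (simp add: principal_char_def)
      qed simp
      also have "\<dots> = (\<Sum>d\<in>P N \<inter> {d. d dvd D}. g d)"
        using finP by (simp add: sum.inter_restrict)
      also have "\<dots> \<le> E" unfolding E_def
        using D by (intro sum_mono2) (auto simp: nonneg P_def dvd_imp_le)
      finally show ?thesis by linarith
    qed
    moreover have "ln (real N) - 1 - C \<le> (\<Sum>d\<in>P N. g d)"
      using sum_mangoldt_div_ge[OF N] C[of N] split[of g N] unfolding g_def by linarith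
    ultimately show ?thesis using upper total rest by linarith
  qed
  define N where "N = nat \<lceil>exp (2 + C + E + B' + Q)\<rceil>"
  have N: "exp (2 + C + E + B' + Q) \<le> real N" unfolding N_def by linarith
  hence N0: "N > 0" by (metis exp_gt_zero less_le_trans of_nat_0_less_iff)
  hence "2 + C + E + B' + Q \<le> ln (real N)" using N by (subst ln_ge_iff) auto
  with bound[OF N0] show False by linarith
qed

section \<open>Legendre's theorem on ternary forms\<close>

lemma int_floor_sqrt:
  fixes n :: int
  assumes "n \<ge> 0"
  obtains X where "X \<ge> 0" "X\<^sup>2 \<le> n" "n < (X + 1)\<^sup>2"
proof -
  define X where "X = int (floor_sqrt (nat n))"
  have "(floor_sqrt (nat n))\<^sup>2 \<le> nat n" "nat n < (Suc (floor_sqrt (nat n)))\<^sup>2"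
    using Suc_floor_sqrt_power2_gt by auto
  hence "int ((floor_sqrt (nat n))\<^sup>2) \<le> n" "n < int ((Suc (floor_sqrt (nat n)))\<^sup>2)"
    using assms by linarith+
  thus ?thesis using that[of X] by (simp add: X_def add.commute)
qed

text \<open>Legendre's theorem by the pigeonhole principle. The case \<open>a x\<^sup>2 + b y\<^sup>2 - c z\<^sup>2 = a b c\<close> is
  reduced to a solution by the identity
  \<open>a (x z + b y)\<^sup>2 + b (y z - a x)\<^sup>2 = (a x\<^sup>2 + b y\<^sup>2) (z\<^sup>2 + a b)\<close>.\<close>

lemma legendre_equation_solvable:
  fixes a b c :: int
  assumes pos: "a > 0" "b > 0" "c > 0"
    and cop: "coprime a b" "coprime a c" "coprime b c"
    and nsq: "\<And>k. k\<^sup>2 \<noteq> b * c" "\<And>k. k\<^sup>2 \<noteq> a * c" "\<And>k. k\<^sup>2 \<noteq> a * b"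
    and r: "a dvd b * r\<^sup>2 - c" and s: "b dvd a * s\<^sup>2 - c" and t: "c dvd a * t\<^sup>2 + b"
  shows "\<exists>x y z. z \<noteq> 0 \<and> a * x\<^sup>2 + b * y\<^sup>2 = c * z\<^sup>2"
proof -
  obtain X where X: "X \<ge> 0" "X\<^sup>2 \<le> b * c" "b * c < (X + 1)\<^sup>2" using int_floor_sqrt[of "b * c"] pos by auto
  obtain Y where Y: "Y \<ge> 0" "Y\<^sup>2 \<le> a * c" "a * c < (Y + 1)\<^sup>2" using int_floor_sqrt[of "a * c"] pos by auto
  obtain Z where Z: "Z \<ge> 0" "Z\<^sup>2 \<le> a * b" "a * b < (Z + 1)\<^sup>2" using int_floor_sqrt[of "a * b"] pos by auto
  let ?D = "{0..X} \<times> {0..Y} \<times> {0..Z}" and ?E = "{0..<a} \<times> {0..<b} \<times> {0..<c}"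
  define f where "f = (\<lambda>(x, y, z). ((y - r * z) mod a, (x - s * z) mod b, (x - t * y) mod c))"
  \<comment> \<open>The box has more than sqrt(bc * ac * ab) = abc points, while \<open>f\<close>
    takes at most abc values.\<close>
  have "(a * b * c)\<^sup>2 = (b * c) * (a * c) * (a * b)" by (simp add: power2_eq_square)
  also have "\<dots> < (X + 1)\<^sup>2 * (Y + 1)\<^sup>2 * (Z + 1)\<^sup>2"
    using X Y Z pos by (intro mult_strict_mono) auto
  also have "\<dots> = ((X + 1) * (Y + 1) * (Z + 1))\<^sup>2" by (simp only: power_mult_distrib)
  finally have lt: "a * b * c < (X + 1) * (Y + 1) * (Z + 1)"
    by (rule power2_less_imp_less) (use X Y Z in auto)
  have "int (card ?E) = a * b * c" "int (card ?D) = (X + 1) * (Y + 1) * (Z + 1)"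
    using pos X Y Z by (simp_all add: card_cartesian_product)
  hence "card ?E < card ?D" using lt by linarith
  moreover have "f ` ?D \<subseteq> ?E" using pos by (auto simp: f_def)
  ultimately have "\<not> inj_on f ?D" using card_inj_on_le[of f ?D ?E] by fastforce
  then obtain x1 y1 z1 x2 y2 z2 where p12: "(x1, y1, z1) \<in> ?D" "(x2, y2, z2) \<in> ?D"
    "(x1, y1, z1) \<noteq> (x2, y2, z2)" "f (x1, y1, z1) = f (x2, y2, z2)"
    by (auto simp: inj_on_def)
  define x y z where "x = x1 - x2" and "y = y1 - y2" and "z = z1 - z2"
  have nz: "x \<noteq> 0 \<or> y \<noteq> 0 \<or> z \<noteq> 0" using p12(3) by (auto simp: x_def y_def z_def)
  have "\<bar>x\<bar> \<le> X" "\<bar>y\<bar> \<le> Y" "\<bar>z\<bar> \<le> Z" using p12(1,2) by (auto simp: x_def y_def z_def)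
  hence sq: "x\<^sup>2 \<le> X\<^sup>2" "y\<^sup>2 \<le> Y\<^sup>2" "z\<^sup>2 \<le> Z\<^sup>2"
    using power_mono[of "\<bar>x\<bar>" X 2] power_mono[of "\<bar>y\<bar>" Y 2] power_mono[of "\<bar>z\<bar>" Z 2] by auto
  \<comment> \<open>Equality is excluded because none of bc, ac, ab is a square. Strictness confines
    \<open>F\<close> to the open interval from -abc to 2abc, where the only multiples of abc are 0
    and abc.\<close>
  have lt: "x\<^sup>2 < b * c" "y\<^sup>2 < a * c" "z\<^sup>2 < a * b"
    using sq X(2) Y(2) Z(2) nsq by (metis order.trans order_le_imp_less_or_eq)+
  have lx: "a * x\<^sup>2 < a * b * c" and ly: "b * y\<^sup>2 < a * b * c" and lz: "c * z\<^sup>2 < a * b * c"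
    using mult_strict_left_mono[OF lt(1) pos(1)] mult_strict_left_mono[OF lt(2) pos(2)]
      mult_strict_left_mono[OF lt(3) pos(3)] by (simp_all add: mult_ac)
  have "a dvd (y1 - r * z1) - (y2 - r * z2)" "b dvd (x1 - s * z1) - (x2 - s * z2)"
    "c dvd (x1 - t * y1) - (x2 - t * y2)"
    using p12(4) by (simp_all add: f_def mod_eq_dvd_iff)
  hence d: "a dvd y - r * z" "b dvd x - s * z" "c dvd x - t * y"
    by (simp_all add: x_def y_def z_def algebra_simps)
  define F where "F = a * x\<^sup>2 + b * y\<^sup>2 - c * z\<^sup>2"
  have "F = a * x\<^sup>2 + b * (y - r * z) * (y + r * z) + (b * r\<^sup>2 - c) * z\<^sup>2"
    by (simp add: F_def power2_eq_square algebra_simps)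
  hence "a dvd F" using d(1) r by simp
  moreover have "F = b * y\<^sup>2 + a * (x - s * z) * (x + s * z) + (a * s\<^sup>2 - c) * z\<^sup>2"
    by (simp add: F_def power2_eq_square algebra_simps)
  hence "b dvd F" using d(2) s by simp
  moreover have "F = a * (x - t * y) * (x + t * y) + (a * t\<^sup>2 + b) * y\<^sup>2 - c * z\<^sup>2"
    by (simp add: F_def power2_eq_square algebra_simps)
  hence "c dvd F" using d(3) t by simp
  ultimately have "a * b * c dvd F" using cop by (metis divides_mult coprime_mult_left_iff)
  then obtain k where k: "F = a * b * c * k" by (elim dvdE)
  have abc: "a * b * c > 0" using pos by simp
  have sqn: "a * x\<^sup>2 \<ge> 0" "b * y\<^sup>2 \<ge> 0" "c * z\<^sup>2 \<ge> 0" using pos by auto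
  have "a * b * c * k < a * b * c * 2" "a * b * c * (-1) < a * b * c * k"
    using k lx ly lz sqn unfolding F_def by linarith+
  hence "k < 2" "-1 < k" using abc by (simp_all only: mult_less_cancel_left_pos)
  hence "k = 0 \<or> k = 1" by linarith
  thus ?thesis
  proof
    assume "k = 0"
    hence eq: "a * x\<^sup>2 + b * y\<^sup>2 = c * z\<^sup>2" using k F_def by simp
    have "z \<noteq> 0"
    proof
      assume "z = 0"
      hence "a * x\<^sup>2 + b * y\<^sup>2 = 0" using eq by simp
      hence "a * x\<^sup>2 = 0" "b * y\<^sup>2 = 0" using sqn by linarith+
      thus False using pos nz \<open>z = 0\<close> by simp
    qed
    thus ?thesis using eq by blast
  next
    assume "k = 1"
    hence eq: "a * x\<^sup>2 + b * y\<^sup>2 = c * (z\<^sup>2 + a * b)" using k F_def by (simp add: algebra_simps)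
    have "a * (x * z + b * y)\<^sup>2 + b * (y * z - a * x)\<^sup>2 = (a * x\<^sup>2 + b * y\<^sup>2) * (z\<^sup>2 + a * b)"
      by (simp add: power2_eq_square algebra_simps)
    also have "\<dots> = c * (z\<^sup>2 + a * b)\<^sup>2" unfolding eq by (simp add: power2_eq_square)
    finally show ?thesis
      using pos by (intro exI[of _ "x * z + b * y"] exI[of _ "y * z - a * x"] exI[of _ "z\<^sup>2 + a * b"])
        (simp add: add_nonneg_pos less_imp_neq[symmetric])
  qed
qed

text \<open>Thue's argument: among more than q pairs, two agree in x - r y modulo q. Their
  difference makes x^2 + y^2 a multiple of q strictly between 0 and 2q.\<close>

lemma prime_sum_two_squares:
  fixes q :: nat
  assumes q: "prime q" and r: "int q dvd r\<^sup>2 + 1"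
  shows "\<exists>u v :: int. int q = u\<^sup>2 + v\<^sup>2"
proof -
  have q1: "q > 1" using q prime_gt_1_nat by blast
  obtain X where X: "X \<ge> 0" "X\<^sup>2 \<le> int q" "int q < (X + 1)\<^sup>2" using int_floor_sqrt[of "int q"] by auto
  have "X\<^sup>2 \<noteq> int q"
  proof
    assume "X\<^sup>2 = int q"
    hence "(nat X)\<^sup>2 = q" using X(1) by (metis int_nat_eq nat_eq_iff2 of_nat_power of_nat_eq_iff)
    thus False using q by (metis prime_power_iff numeral_eq_one_iff semiring_norm(85))
  qed
  hence Xlt: "X\<^sup>2 < int q" using X(2) by simp
  let ?D = "{0..X} \<times> {0..X}" and ?E = "{0..<int q}"
  define f where "f = (\<lambda>(x, y). (x - r * y) mod int q)"
  have "int (card ?D) = (X + 1)\<^sup>2" using X by (simp add: card_cartesian_product power2_eq_square)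
  moreover have "int (card ?E) = int q" by simp
  ultimately have "card ?E < card ?D" using X by linarith
  moreover have "f ` ?D \<subseteq> ?E" using q1 by (auto simp: f_def)
  ultimately have "\<not> inj_on f ?D" using card_inj_on_le[of f ?D ?E] by fastforce
  then obtain x1 y1 x2 y2 where p12: "(x1, y1) \<in> ?D" "(x2, y2) \<in> ?D"
    "(x1, y1) \<noteq> (x2, y2)" "f (x1, y1) = f (x2, y2)" by (auto simp: inj_on_def)
  define x y where "x = x1 - x2" and "y = y1 - y2"
  have nz: "x \<noteq> 0 \<or> y \<noteq> 0" using p12(3) by (auto simp: x_def y_def)
  have "\<bar>x\<bar> \<le> X" "\<bar>y\<bar> \<le> X" using p12(1,2) by (auto simp: x_def y_def)
  hence sq: "x\<^sup>2 \<le> X\<^sup>2" "y\<^sup>2 \<le> X\<^sup>2" using power_mono[of "\<bar>x\<bar>" X 2] power_mono[of "\<bar>y\<bar>" X 2] by auto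
  have "int q dvd (x1 - r * y1) - (x2 - r * y2)" using p12(4) by (simp add: f_def mod_eq_dvd_iff)
  hence "int q dvd x - r * y" by (simp add: x_def y_def algebra_simps)
  moreover have "x\<^sup>2 + y\<^sup>2 = (x - r * y) * (x + r * y) + (r\<^sup>2 + 1) * y\<^sup>2"
    by (simp add: power2_eq_square algebra_simps)
  ultimately have "int q dvd x\<^sup>2 + y\<^sup>2" using r by simp
  then obtain k where k: "x\<^sup>2 + y\<^sup>2 = int q * k" by (elim dvdE)
  have "0 < x\<^sup>2 + y\<^sup>2" using nz by (simp add: sum_power2_gt_zero_iff)
  moreover have "x\<^sup>2 + y\<^sup>2 < int q * 2" using sq Xlt by simp
  ultimately have "0 < k" "k < 2" using k q1 by (simp_all add: zero_less_mult_iff)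
  hence "k = 1" by simp
  hence "int q = x\<^sup>2 + y\<^sup>2" using k by simp
  thus ?thesis by blast
qed

lemma quadratic_congruence_squarefree:
  fixes u v :: int and n :: nat
  assumes "squarefree n" and "\<And>p. prime p \<Longrightarrow> p dvd n \<Longrightarrow> \<exists>r. int p dvd u * r\<^sup>2 - v"
  shows "\<exists>r. int n dvd u * r\<^sup>2 - v"
  using assms
proof (induction n rule: less_induct)
  case (less n)
  show ?case
  proof (cases "n = 1")
    case False
    then obtain p where p: "prime p" "p dvd n" using prime_factor_nat by blast
    then obtain m where n: "n = p * m" by (elim dvdE)
    have n0: "n \<noteq> 0" using less.prems(1) by (metis not_squarefree_0)
    have cop: "coprime p m"
    proof (rule prime_imp_coprime_nat[OF p(1)])
      show "\<not> p dvd m"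
      proof
        assume "p dvd m"
        hence "p\<^sup>2 dvd n" unfolding n power2_eq_square by (rule mult_dvd_mono[OF dvd_refl])
        hence "p dvd 1" using less.prems(1) squarefreeD by blast
        thus False using p(1) by auto
      qed
    qed
    have "m < n" using n n0 prime_gt_1_nat[OF p(1)] by simp
    moreover have "squarefree m" using less.prems(1) n squarefree_mono by (metis dvd_triv_right)
    ultimately obtain r1 where r1: "int m dvd u * r1\<^sup>2 - v"
      using less.IH less.prems(2) n by (metis dvd_mult)
    obtain r2 where r2: "int p dvd u * r2\<^sup>2 - v" using less.prems(2) p by blast
    obtain r where r: "[r = r1] (mod int m)" "[r = r2] (mod int p)"
      using binary_chinese_remainder_int[of "int m" "int p" r1 r2] cop by (auto simp: coprime_commute)
    have "[u * r\<^sup>2 - v = u * r1\<^sup>2 - v] (mod int m)" "[u * r\<^sup>2 - v = u * r2\<^sup>2 - v] (mod int p)"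
      by (intro cong_diff cong_mult cong_pow cong_refl r)+
    hence "int m dvd u * r\<^sup>2 - v" "int p dvd u * r\<^sup>2 - v" using r1 r2 cong_dvd_iff by blast+
    hence "int p * int m dvd u * r\<^sup>2 - v" using cop by (intro divides_mult) auto
    thus ?thesis unfolding n by auto
  qed simp
qed

section \<open>Squarefree parts, Legendre symbols and the characters they define\<close>

lemma squarefree_part_dvd_iff:
  fixes n p :: nat
  assumes "prime p"
  shows "p dvd squarefree_part n \<longleftrightarrow> n \<noteq> 0 \<and> odd (multiplicity p n)"
proof (cases "n = 0")
  case False
  have "p dvd squarefree_part n \<longleftrightarrow> multiplicity p (squarefree_part n) > 0"
    using assms by (simp add: prime_multiplicity_gt_zero_iff)
  also have "multiplicity p (squarefree_part n) = multiplicity p n mod 2"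
    using assms False by (simp add: prime_multiplicity_squarefree_part)
  finally show ?thesis using False by (simp add: odd_iff_mod_2_eq_one)
qed (use assms in auto)

lemma Legendre_values: "Legendre a p \<in> {-1, 0, 1}"
  by (simp add: Legendre_def)

lemma Legendre_cong: "[a = b] (mod p) \<Longrightarrow> Legendre a p = Legendre b p"
proof -
  assume ab: "[a = b] (mod p)"
  have "[x = a] (mod p) \<longleftrightarrow> [x = b] (mod p)" for x using ab by (meson cong_sym cong_trans)
  moreover have "[a = x] (mod p) \<longleftrightarrow> [b = x] (mod p)" for x using ab by (meson cong_sym cong_trans)
  ultimately show ?thesis unfolding Legendre_def QuadRes_def by simp
qed

lemma Legendre_eq_0_iff: "Legendre a p = 0 \<longleftrightarrow> p dvd a"
  by (simp add: Legendre_def cong_0_iff)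

lemma cong_sign_eq:
  fixes x y :: int
  assumes "[x = y] (mod int p)" "x \<in> {-1, 0, 1}" "y \<in> {-1, 0, 1}" "p > 2"
  shows "x = y"
proof -
  have "int p dvd x - y" using assms(1) by (simp add: cong_iff_dvd_diff)
  moreover have "\<bar>x - y\<bar> < int p" using assms by auto
  ultimately show ?thesis using zdvd_not_zless[of "\<bar>x - y\<bar>" "int p"] by (cases "x = y") auto
qed

lemma Legendre_mult:
  assumes "prime p" "p > 2"
  shows "Legendre (a * b) (int p) = Legendre a (int p) * Legendre b (int p)"
proof (rule cong_sign_eq)
  have "[Legendre (a * b) (int p) = (a * b) ^ ((p - 1) div 2)] (mod int p)"
    by (rule euler_criterion[OF assms])
  moreover have "[Legendre a (int p) * Legendre b (int p) = a ^ ((p - 1) div 2) * b ^ ((p - 1) div 2)] (mod int p)"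
    by (intro cong_mult euler_criterion[OF assms])
  ultimately show "[Legendre (a * b) (int p) = Legendre a (int p) * Legendre b (int p)] (mod int p)"
    by (metis cong_sym cong_trans power_mult_distrib)
  show "Legendre a (int p) * Legendre b (int p) \<in> {-1, 0, 1}"
    using Legendre_values[of a "int p"] Legendre_values[of b "int p"] by auto
qed (use Legendre_values assms in auto)

lemma Legendre_1: "p > 2 \<Longrightarrow> Legendre 1 (int p) = 1"
  unfolding Legendre_def QuadRes_def
  by (auto simp: cong_0_iff zdvd1_eq intro!: exI[of _ 1])

lemma Legendre_prod:
  assumes "prime q" "q > 2" "finite P"
  shows "Legendre (\<Prod>p\<in>P. f p) (int q) = (\<Prod>p\<in>P. Legendre (f p) (int q))"
  using assms(3) by induction (simp_all add: Legendre_1 Legendre_mult assms)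

text \<open>Take r with r^2 = -1 modulo q. Then (1 + r)^2 = 2r, so 2 and r have the same Legendre
  symbol, and Euler's criterion evaluates that of r as r^((q - 1)/2) = (-1)^((q - 1)/4).\<close>

lemma Legendre_2:
  fixes q :: nat
  assumes q: "prime q" and "[q = 1] (mod 4)"
  shows "Legendre 2 (int q) = (-1) ^ ((q - 1) div 4)"
    and "\<exists>r. int q dvd r\<^sup>2 + 1"
proof -
  have q4: "q mod 4 = 1" using assms(2) by (simp add: cong_def)
  have q1: "q > 1" using q prime_gt_1_nat by blast
  have q2: "q > 2" using q4 q1 by (cases "q = 2") auto
  obtain k where k: "q = 4 * k + 1" using q4 by (metis mult_div_mod_eq)
  have m1: "[Legendre (-1) (int q) = (-1) ^ (2 * k)] (mod int q)"
    using euler_criterion[OF q q2, of "-1"] k by simp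
  hence "Legendre (-1) (int q) = 1" using cong_sign_eq[OF m1 Legendre_values _ q2] by simp
  hence "QuadRes (int q) (-1)" by (auto simp: Legendre_def split: if_splits)
  then obtain r where r: "[r\<^sup>2 = -1] (mod int q)" unfolding QuadRes_def by blast
  hence rd: "int q dvd r\<^sup>2 + 1" by (simp add: cong_iff_dvd_diff)
  thus "\<exists>r. int q dvd r\<^sup>2 + 1" by blast
  have "[Legendre (2 * r) (int q) = (2 * r) ^ ((q - 1) div 2)] (mod int q)" by (rule euler_criterion[OF q q2])
  have "[2 * r = (1 + r)\<^sup>2] (mod int q)"
    using rd by (simp add: cong_iff_dvd_diff power2_eq_square algebra_simps) (metis dvd_minus_iff minus_add_distrib uminus_add_conv_diff diff_minus_eq_add add.commute)
  hence "Legendre (2 * r) (int q) = Legendre (1 + r) (int q) * Legendre (1 + r) (int q)"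
    using Legendre_cong Legendre_mult[OF q q2, of "1 + r" "1 + r"] by (simp add: power2_eq_square)
  hence sq: "Legendre 2 (int q) * Legendre r (int q) = Legendre (1 + r) (int q) * Legendre (1 + r) (int q)"
    by (simp add: Legendre_mult[OF q q2])
  have nr: "\<not> int q dvd r"
  proof
    assume "int q dvd r"
    hence "int q dvd r\<^sup>2 + 1 - r\<^sup>2" using rd by (intro dvd_diff) (auto simp: power2_eq_square)
    thus False using q1 by simp
  qed
  have n2: "\<not> int q dvd 2" using q2 by (auto dest: zdvd_imp_le)
  have "Legendre r (int q) = (-1) ^ k"
  proof (rule cong_sign_eq)
    have "[r ^ (2 * k) = (-1) ^ k] (mod int q)"
      unfolding power_mult by (intro cong_pow r)
    moreover have "(q - 1) div 2 = 2 * k" using k by simp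
    ultimately show "[Legendre r (int q) = (-1) ^ k] (mod int q)"
      using euler_criterion[OF q q2, of r] cong_trans by metis
    show "(-1) ^ k \<in> {-1, 0, 1 :: int}" by (cases "even k") auto
  qed (use Legendre_values q2 in auto)
  moreover have "Legendre 2 (int q) \<noteq> 0" "Legendre r (int q) \<noteq> 0"
    using nr n2 by (auto simp: Legendre_eq_0_iff)
  ultimately have "Legendre 2 (int q) = (-1) ^ k"
    using sq Legendre_values[of 2 "int q"] Legendre_values[of "1 + r" "int q"] by (cases "even k") auto
  thus "Legendre 2 (int q) = (-1) ^ ((q - 1) div 4)" using k by simp
qed

lemma real_char_Legendre:
  assumes p: "prime p" "p > 2" and "p dvd D"
  shows "real_char D (\<lambda>n. if coprime n D then real_of_int (Legendre (int n) (int p)) else 0)"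
  unfolding real_char_def
proof (intro conjI allI)
  have cop: "coprime (n + D) D \<longleftrightarrow> coprime n D" for n by (metis coprime_iff_gcd_eq_1 gcd_add1)
  fix m n
  show "(if coprime (m * n) D then real_of_int (Legendre (int (m * n)) (int p)) else 0) =
    (if coprime m D then real_of_int (Legendre (int m) (int p)) else 0) * (if coprime n D then real_of_int (Legendre (int n) (int p)) else 0)"
    by (simp add: Legendre_mult[OF p])
  have "[int (n + D) = int n] (mod int p)" using \<open>p dvd D\<close> by (auto simp: cong_iff_dvd_diff)
  from Legendre_cong[OF this]
  show "(if coprime (n + D) D then real_of_int (Legendre (int (n + D)) (int p)) else 0) =
    (if coprime n D then real_of_int (Legendre (int n) (int p)) else 0)" by (simp add: cop)
  show "(if coprime n D then real_of_int (Legendre (int n) (int p)) else 0) \<in> {-1, 0, 1}"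
    using Legendre_values[of "int n" "int p"] by auto
  have "Legendre (int n) (int p) \<noteq> 0" if "coprime n D"
  proof -
    have "coprime n p" using that \<open>p dvd D\<close> by (meson coprime_divisors dvd_refl)
    hence "\<not> p dvd n" using p(1) by (metis coprime_absorb_right not_prime_unit coprime_commute)
    thus ?thesis by (simp add: Legendre_eq_0_iff)
  qed
  thus "(if coprime n D then real_of_int (Legendre (int n) (int p)) else 0) = 0 \<longleftrightarrow> \<not> coprime n D"
    by simp
qed

text \<open>The sets \<open>H\<close> are the subgroups of index 2 in the group of units modulo
  8.\<close>

lemma real_char_mod_8:
  assumes "8 dvd D" and H: "H = {1, 3} \<or> H = {1, 5} \<or> H = {1, 7 :: nat}"
  shows "real_char D (\<lambda>n. if coprime n D then (if n mod 8 \<in> H then 1 else -1) else 0)"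
  unfolding real_char_def
proof (intro conjI allI)
  have cop: "coprime (n + D) D \<longleftrightarrow> coprime n D" for n by (metis coprime_iff_gcd_eq_1 gcd_add1)
  have odd: "n mod 8 = 1 \<or> n mod 8 = 3 \<or> n mod 8 = 5 \<or> n mod 8 = 7" if "coprime n D" for n :: nat
  proof -
    have "2 dvd D" using \<open>8 dvd D\<close> by (rule dvd_trans[rotated]) simp
    hence "coprime n 2" using that by (meson coprime_divisors dvd_refl)
    hence "odd n" by simp
    thus ?thesis by presburger
  qed
  fix m n :: nat
  show "(if coprime (m * n) D then (if m * n mod 8 \<in> H then 1 else -1) else 0) =
     (if coprime m D then (if m mod 8 \<in> H then 1 else -1) else 0) * (if coprime n D then (if n mod 8 \<in> H then 1 else - (1::real)) else 0)"
  proof (cases "coprime m D \<and> coprime n D")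
    case True
    obtain X Y where XY: "m mod 8 = X" "n mod 8 = Y" by blast
    hence mn: "m * n mod 8 = X * Y mod 8" by (metis mod_mult_eq)
    have "X = 1 \<or> X = 3 \<or> X = 5 \<or> X = 7" "Y = 1 \<or> Y = 3 \<or> Y = 5 \<or> Y = 7"
      using odd[of m] odd[of n] True XY by auto
    thus ?thesis using H True unfolding mn XY by (elim disjE) simp_all
  qed auto
  have "(n + D) mod 8 = n mod 8" using \<open>8 dvd D\<close> by (metis add.right_neutral dvd_imp_mod_0 mod_add_right_eq)
  thus "(if coprime (n + D) D then (if (n + D) mod 8 \<in> H then 1 else -1) else 0) =
    (if coprime n D then (if n mod 8 \<in> H then 1 else - (1::real)) else 0)" by (simp add: cop)
qed auto

text \<open>The characters with kernels {1, 5} and {1, 3} together determine a unit modulo 8. Taking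
  q beyond D makes q prime to D, so that no character vanishes at q.\<close>

lemma exists_prime_Legendre:
  assumes D: "D > 0" "8 dvd D" and c: "coprime c D" "c mod 8 \<in> {1, 5}"
  shows "\<exists>q. prime q \<and> q > D \<and> q mod 8 = c mod 8 \<and>
    (\<forall>p. prime p \<longrightarrow> p > 2 \<longrightarrow> p dvd D \<longrightarrow> Legendre (int q) (int p) = Legendre (int c) (int p))"
proof -
  obtain q where q: "prime q" "q > D" "\<And>\<xi>. real_char D \<xi> \<Longrightarrow> \<xi> q = \<xi> c"
    using exists_prime_real_char_eq[OF D(1) c(1), of D] by blast
  have cq: "coprime q D"
    using q(1,2) D(1) by (intro prime_imp_coprime_nat) (auto dest: dvd_imp_le)
  have "Legendre (int q) (int p) = Legendre (int c) (int p)" if "prime p" "p > 2" "p dvd D" for p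
    using q(3)[OF real_char_Legendre[OF that]] c(1) cq by simp
  moreover have "q mod 8 = c mod 8"
    using q(3)[OF real_char_mod_8[OF D(2), of "{1, 5}"]] q(3)[OF real_char_mod_8[OF D(2), of "{1, 3}"]] c cq
    by (auto split: if_splits)
  ultimately show ?thesis using q by blast
qed

section \<open>Norm differences over the Gaussian rationals\<close>

lemma quadratic_congruence_prime:
  assumes p: "prime p" "p > 2" and L: "Legendre (u * v) (int p) = 1"
  shows "\<exists>r. int p dvd u * r\<^sup>2 - v"
proof -
  have "\<not> int p dvd u * v" using L Legendre_eq_0_iff[of "u * v" "int p"] by simp
  hence "\<not> int p dvd u" by auto
  hence "coprime u (int p)" using p(1) by (metis coprime_commute prime_imp_coprime prime_nat_int_transfer)
  then obtain i where i: "[u * i = 1] (mod int p)" using cong_solve_coprime_int by blast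
  have "QuadRes (int p) (u * v)" using L by (auto simp: Legendre_def split: if_splits)
  then obtain y where y: "[y\<^sup>2 = u * v] (mod int p)" unfolding QuadRes_def by blast
  have "u * (y * i)\<^sup>2 = (u * i) * i * y\<^sup>2" by (simp add: power2_eq_square)
  also have "[(u * i) * i * y\<^sup>2 = 1 * i * (u * v)] (mod int p)" by (intro cong_mult i y cong_refl)
  also have "1 * i * (u * v) = (u * i) * v" by simp
  also have "[(u * i) * v = 1 * v] (mod int p)" by (intro cong_mult i cong_refl)
  finally show ?thesis by (auto simp: cong_iff_dvd_diff)
qed

lemma squarefree_neq_power2:
  fixes n :: nat and k :: int
  assumes "squarefree n" "n > 1"
  shows "k\<^sup>2 \<noteq> int n"
proof
  assume "k\<^sup>2 = int n"
  hence k: "(nat \<bar>k\<bar>)\<^sup>2 = n" by (metis nat_int nat_power_eq abs_ge_zero power2_abs)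
  hence "nat \<bar>k\<bar> dvd 1" using assms(1) squarefreeD by (metis dvd_refl)
  with k assms(2) show False by simp
qed

text \<open>The aim is a solution of a x^2 + q y^2 = m z^2 with a prime q that is a sum of two
  squares. At odd primes, Legendre's theorem asks that q m be a square modulo the primes dividing a,
  that -a q be one modulo the primes dividing m, and that a m be one modulo q. The first two
  conditions prescribe Legendre symbols of q; reciprocity then determines the third up to the symbol
  of 2 at q. This symbol can still be chosen through q modulo 8, and it occurs because m a is
  even.\<close>

lemma norm_form_represents_difference:
  fixes m a :: nat
  assumes sqf: "squarefree m" "squarefree a" and cop: "coprime m a" and ev: "even (m * a)"
  shows "\<exists>w z u v :: int. w \<noteq> 0 \<and> int m * w\<^sup>2 = int a * z\<^sup>2 + u\<^sup>2 + v\<^sup>2"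
proof -
  have pos: "m > 0" "a > 0" using sqf by (metis not_squarefree_0 neq0_conv)+
  define D where "D = 8 * (m * a)"
  have D: "D > 0" "8 dvd D" using pos by (auto simp: D_def)
  define P where "P = prime_factors (m * a) - {2}"
  have finP: "finite P" by (simp add: P_def)
  have P: "prime p" "p > 2" "p dvd m * a" if "p \<in> P" for p
    using that prime_ge_2_nat[of p] by (auto simp: P_def in_prime_factors_iff intro: le_neq_implies_less)
  \<comment> \<open>q will get the Legendre symbol of \<open>T p\<close> modulo p, so that
    \<open>q * T p\<close> becomes a square there.\<close>
  define T where "T = (\<lambda>p. if p dvd m then - int a else int m)"
  \<comment> \<open>By reciprocity this becomes the product of the symbols at q of the odd primes
    dividing m a.\<close>
  define \<epsilon> where "\<epsilon> = (\<Prod>p\<in>P. Legendre (T p) (int p))"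
  have T: "\<not> int p dvd T p" if "p \<in> P" for p
  proof -
    have "\<not> (p dvd m \<and> p dvd a)" using cop P(1)[OF that] by (metis coprime_common_divisor not_prime_unit)
    thus ?thesis by (auto simp: T_def)
  qed
  have \<epsilon>: "\<epsilon> = 1 \<or> \<epsilon> = -1"
  proof -
    have "Legendre (T p) (int p) \<in> {1, -1}" if "p \<in> P" for p
      using T[OF that] Legendre_eq_0_iff[of "T p" "int p"] Legendre_values[of "T p" "int p"] by auto
    note L = this
    have "(\<Prod>p\<in>Q. Legendre (T p) (int p)) \<in> {1, -1}" if "finite Q" "Q \<subseteq> P" for Q
      using that
    proof (induction Q)
      case (insert p Q)
      have "Legendre (T p) (int p) \<in> {1, -1}" "(\<Prod>p\<in>Q. Legendre (T p) (int p)) \<in> {1, -1}"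
        using insert L by auto
      moreover have "(\<Prod>p\<in>insert p Q. Legendre (T p) (int p)) = Legendre (T p) (int p) * (\<Prod>p\<in>Q. Legendre (T p) (int p))"
        using insert by simp
      ultimately show ?case by auto
    qed simp
    from this[OF finP]
    show ?thesis unfolding \<epsilon>_def by blast
  qed
  \<comment> \<open>Both residues modulo 8 give q = 1 modulo 4, and they give 2 opposite symbols.
    The choice makes the symbol of 2 at q equal to \<epsilon>, so that the symbol of m a at q is
    \<epsilon>^2 = 1.\<close>
  define e :: nat where "e = (if \<epsilon> = 1 then 1 else 5)"
  obtain c where c: "\<forall>i\<in>insert 8 P. [c = (if i = 8 then e else nat (T i mod int i))] (mod i)"
  proof -
    have "\<forall>i\<in>insert 8 P. \<forall>j\<in>insert 8 P. i \<noteq> j \<longrightarrow> coprime i j"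
    proof -
      have "coprime 8 p" "coprime p 8" if "p \<in> P" for p
      proof -
        have "odd p" using P(1,2)[OF that] by (rule prime_odd_nat)
        hence "coprime p (2 ^ 3)" by (simp only: coprime_power_right_iff coprime_right_2_iff_odd) simp
        moreover have "2 ^ 3 = (8 :: nat)" by simp
        ultimately show "coprime p 8" by metis
        thus "coprime 8 p" by (simp only: coprime_commute)
      qed
      thus ?thesis using P(1) by (auto simp: primes_coprime)
    qed
    from chinese_remainder_nat[of "insert 8 P" "\<lambda>i. i" "\<lambda>i. if i = 8 then e else nat (T i mod int i)", OF _ this]
    show ?thesis using finP that by auto
  qed
  have n8: "8 \<notin> P"
  proof
    assume "8 \<in> P"
    hence "odd (8 :: nat)" using P(1,2) prime_odd_nat by blast
    thus False by simp
  qed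
  have c8: "c mod 8 = e" using c by (auto simp: cong_def e_def)
  have cp: "[int c = T p] (mod int p)" if "p \<in> P" for p
  proof -
    have "[c = nat (T p mod int p)] (mod p)" using c[rule_format, of p] that n8 by (cases "p = 8") auto
    hence "[int c = int (nat (T p mod int p))] (mod int p)" by (simp only: cong_int_iff)
    also have "int (nat (T p mod int p)) = T p mod int p" using P(2)[OF that] by simp
    finally show ?thesis by (simp add: cong_def)
  qed
  have "coprime c D"
  proof (rule ccontr)
    assume "\<not> coprime c D"
    hence "gcd c D \<noteq> 1" by (metis coprime_iff_gcd_eq_1)
    then obtain p where p: "prime p" "p dvd c" "p dvd D"
      using prime_factor_nat[of "gcd c D"] by auto
    have "p \<noteq> 2"
    proof
      assume "p = 2"
      hence "even (c mod 8)" using p(2) by (simp add: dvd_mod)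
      thus False using c8 by (simp add: e_def split: if_splits)
    qed
    moreover have "p dvd m * a"
    proof -
      have "p dvd 2 ^ 3 * (m * a)" using p(3) by (simp add: D_def)
      hence "p dvd 2 ^ 3 \<or> p dvd m * a" using p(1) prime_dvd_mult_iff by blast
      moreover have "\<not> p dvd 2 ^ 3" using p(1) \<open>p \<noteq> 2\<close> prime_dvd_power primes_dvd_imp_eq two_is_prime_nat by blast
      ultimately show ?thesis by blast
    qed
    ultimately have "p \<in> P" using p(1) pos by (simp add: P_def in_prime_factors_iff)
    moreover have "int p dvd int c" using p(2) by simp
    ultimately show False using T cp cong_dvd_iff by blast
  qed
  moreover have "c mod 8 \<in> {1, 5}" using c8 by (simp add: e_def)
  ultimately obtain q where q: "prime q" "q > D" "q mod 8 = e"
    and Lq: "\<And>p. prime p \<Longrightarrow> p > 2 \<Longrightarrow> p dvd D \<Longrightarrow> Legendre (int q) (int p) = Legendre (int c) (int p)"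
    using exists_prime_Legendre[OF D, of c] c8 by metis
  have q4: "[q = 1] (mod 4)"
  proof -
    have "q mod 8 mod 4 = q mod 4" by (rule mod_mod_cancel) simp
    thus ?thesis using q(3) by (auto simp: e_def cong_def split: if_splits)
  qed
  have qbig: "q > m" "q > a" "q > 2" "q > m * a"
  proof -
    have "m \<le> m * a" "a \<le> m * a" using pos by simp_all
    thus "q > m" "q > a" "q > 2" "q > m * a" using q(2) pos unfolding D_def by linarith+
  qed
  have LqT: "Legendre (int q) (int p) = Legendre (T p) (int p)" if "p \<in> P" for p
    using Lq[OF P(1,2)[OF that]] P(3)[OF that] Legendre_cong[OF cp[OF that]] by (simp add: D_def)
  have qcop: "coprime q m" "coprime q a"
    using q(1) qbig pos by (auto intro!: prime_imp_coprime_nat dest: dvd_imp_le)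
  have odd_q: "odd q" using q(1) qbig(3) prime_odd_nat by auto
  have prodP: "m * a = 2 * \<Prod>P"
  proof -
    have sq: "squarefree (m * a)" using sqf cop by (simp add: squarefree_mult_coprime)
    have "m * a = (\<Prod>p\<in>prime_factors (m * a). p ^ multiplicity p (m * a))"
      using pos prod_prime_factors[of "m * a"] by simp
    also have "\<dots> = \<Prod>(prime_factors (m * a))"
      using sq pos by (intro prod.cong) (auto simp: squarefree_factorial_semiring')
    also have "\<dots> = 2 * \<Prod>P"
      unfolding P_def using ev pos by (subst prod.remove[of _ 2]) (auto simp: in_prime_factors_iff)
    finally show ?thesis .
  qed
  have LQ: "Legendre (int m * int a) (int q) = 1"
  proof -
    have "int (m * a) = int (2 * \<Prod>P)" by (simp only: prodP)
    hence "int m * int a = 2 * (\<Prod>p\<in>P. int p)" by simp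
    hence "Legendre (int m * int a) (int q) = Legendre (2 * (\<Prod>p\<in>P. int p)) (int q)" by simp
    also have "\<dots> = Legendre 2 (int q) * (\<Prod>p\<in>P. Legendre (int p) (int q))"
      using Legendre_prod[OF q(1) qbig(3) finP] by (simp add: Legendre_mult[OF q(1) qbig(3)])
    also have "(\<Prod>p\<in>P. Legendre (int p) (int q)) = \<epsilon>"
      unfolding \<epsilon>_def
    proof (rule prod.cong)
      fix p assume p: "p \<in> P"
      have "p \<noteq> q" using P(3)[OF p] qbig(4) pos by (auto dest: dvd_imp_le)
      hence "Legendre (int p) (int q) * Legendre (int q) (int p) = (-1) ^ ((p - 1) div 2 * ((q - 1) div 2))"
        by (intro Quadratic_Reciprocity P(1,2)[OF p] q(1) qbig(3))
      moreover have "even ((q - 1) div 2)"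
      proof -
        have "q mod 4 = 1" using q4 by (simp add: cong_def)
        thus ?thesis by presburger
      qed
      ultimately have "Legendre (int p) (int q) * Legendre (int q) (int p) = 1" by simp
      thus "Legendre (int p) (int q) = Legendre (T p) (int p)"
        unfolding LqT[OF p] using Legendre_values[of "T p" "int p"] by auto
    qed simp
    also have "Legendre 2 (int q) = \<epsilon>"
    proof -
      have qd: "q = 8 * (q div 8) + e" using q(3) mult_div_mod_eq[of 8 q] by simp
      show ?thesis
      proof (cases "\<epsilon> = 1")
        case True
        hence "(q - 1) div 4 = 2 * (q div 8)" using qd by (simp add: e_def)
        thus ?thesis using Legendre_2(1)[OF q(1) q4] True by simp
      next
        case False
        hence "(q - 1) div 4 = 2 * (q div 8) + 1" using qd by (simp add: e_def)
        thus ?thesis using Legendre_2(1)[OF q(1) q4] False \<epsilon> by simp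
      qed
    qed
    also have "\<epsilon> * \<epsilon> = 1" using \<epsilon> by auto
    finally show ?thesis .
  qed
  have Psplit: "p = 2 \<or> p \<in> P" if "prime p" "p dvd m * a" for p
    using that pos by (auto simp: P_def in_prime_factors_iff)
  have sqT: "Legendre (T p) (int p) * Legendre (T p) (int p) = 1" if "p \<in> P" for p
    using T[OF that] Legendre_values[of "T p" "int p"] Legendre_eq_0_iff[of "T p" "int p"] by auto
  have "\<exists>r. int a dvd int q * r\<^sup>2 - int m"
  proof (rule quadratic_congruence_squarefree[OF sqf(2)])
    fix p assume p: "prime p" "p dvd a"
    have npm: "\<not> p dvd m" using cop p by (metis coprime_common_divisor not_prime_unit)
    show "\<exists>r. int p dvd int q * r\<^sup>2 - int m"
    proof (cases "p = 2")
      case True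
      hence "odd m" using npm by simp
      thus ?thesis using odd_q True by (intro exI[of _ 1]) simp
    next
      case False
      have "p dvd m * a" using p(2) by simp
      hence pP: "p \<in> P" using Psplit[OF p(1)] False by blast
      hence "Legendre (int q * int m) (int p) = Legendre (T p) (int p) * Legendre (T p) (int p)"
        using npm by (simp add: Legendre_mult[OF P(1,2)[OF pP]] LqT T_def)
      thus ?thesis using sqT[OF pP] by (intro quadratic_congruence_prime[OF P(1,2)[OF pP]]) simp
    qed
  qed
  then obtain r where r: "int a dvd int q * r\<^sup>2 - int m" by blast
  obtain s where s: "int q dvd int a * s\<^sup>2 - int m"
    using quadratic_congruence_prime[OF q(1) qbig(3), of "int a" "int m"] LQ by (auto simp: mult.commute)
  have "\<exists>t. int m dvd int a * t\<^sup>2 - (- int q)"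
  proof (rule quadratic_congruence_squarefree[OF sqf(1)])
    fix p assume p: "prime p" "p dvd m"
    have npa: "\<not> p dvd a" using cop p by (metis coprime_common_divisor not_prime_unit)
    show "\<exists>t. int p dvd int a * t\<^sup>2 - (- int q)"
    proof (cases "p = 2")
      case True
      hence "odd a" using npa by simp
      thus ?thesis using odd_q True by (intro exI[of _ 1]) simp
    next
      case False
      have "p dvd m * a" using p(2) by simp
      hence pP: "p \<in> P" using Psplit[OF p(1)] False by blast
      have "Legendre (int a * (- int q)) (int p) = Legendre (- int a * int q) (int p)" by simp
      also have "\<dots> = Legendre (T p) (int p) * Legendre (T p) (int p)"
        using p(2) by (simp only: Legendre_mult[OF P(1,2)[OF pP]] LqT[OF pP] T_def if_True)
      finally show ?thesis using sqT[OF pP] by (intro quadratic_congruence_prime[OF P(1,2)[OF pP]]) simp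
    qed
  qed
  then obtain t where t: "int m dvd int a * t\<^sup>2 + int q" by auto
  have sqq: "squarefree q" using q(1) by (rule squarefree_prime)
  have sq1: "squarefree (q * m)" "squarefree (m * a)" "squarefree (q * a)"
    using qcop cop sqf sqq by (simp_all add: squarefree_mult_coprime)
  have gt: "q * m > 1" "m * a > 1" "q * a > 1"
  proof -
    have "q * 1 \<le> q * m" "q * 1 \<le> q * a" using pos by (intro mult_le_mono; simp)+
    thus "q * m > 1" "q * a > 1" using qbig(3) by linarith+
    obtain k where "m * a = 2 * k" using ev by (elim evenE)
    moreover have "m * a \<noteq> 0" using pos by simp
    ultimately show "m * a > 1" by simp
  qed
  have "\<exists>x y z. z \<noteq> 0 \<and> int a * x\<^sup>2 + int q * y\<^sup>2 = int m * z\<^sup>2"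
  proof (rule legendre_equation_solvable[OF _ _ _ _ _ _ _ _ _ r s t])
    show "k\<^sup>2 \<noteq> int q * int m" for k
      using squarefree_neq_power2[OF sq1(1) gt(1), of k] by (metis of_nat_mult)
    show "k\<^sup>2 \<noteq> int a * int m" for k
      using squarefree_neq_power2[OF sq1(2) gt(2), of k] by (metis of_nat_mult mult.commute)
    show "k\<^sup>2 \<noteq> int a * int q" for k
      using squarefree_neq_power2[OF sq1(3) gt(3), of k] by (metis of_nat_mult mult.commute)
  qed (use pos qcop cop qbig in \<open>auto simp: coprime_commute\<close>)
  then obtain x y z where xyz: "z \<noteq> 0" "int a * x\<^sup>2 + int q * y\<^sup>2 = int m * z\<^sup>2" by blast
  obtain u v where uv: "int q = u\<^sup>2 + v\<^sup>2" using prime_sum_two_squares[OF q(1)] Legendre_2(2)[OF q(1) q4] by blast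
  have "int m * z\<^sup>2 = int a * x\<^sup>2 + (u * y)\<^sup>2 + (v * y)\<^sup>2"
    using xyz(2) uv by (simp add: power_mult_distrib algebra_simps)
  thus ?thesis using xyz(1) by blast
qed

text \<open>The local condition at \<open>p\<close> on \<open>a\<close> under which a prime \<open>q\<close> can be chosen, by its residue class alone, such that
  \<open>m w\<^sup>2 = a z\<^sup>2 + q t\<^sup>2\<close> satisfies the hypotheses of Legendre's theorem and \<open>q\<close> is a sum of two squares.\<close>

definition parity_ok :: "nat \<Rightarrow> nat \<Rightarrow> nat \<Rightarrow> bool" where
  "parity_ok p m a \<longleftrightarrow>
     (if p = 2 then odd (multiplicity 2 a + multiplicity 2 m)
      else odd (multiplicity p m) \<longrightarrow> even (multiplicity p a))"

text \<open>A whole residue class is required so that the Chinese remainder theorem can combine the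
  primes. The modulus p^2 suffices because the values chosen below, once a factor p common to A, B
  and C is taken out, are nonzero modulo p^2.\<close>

definition locally_ok :: "nat \<Rightarrow> nat \<Rightarrow> nat \<Rightarrow> nat \<Rightarrow> bool" where
  "locally_ok p A B C \<longleftrightarrow> (\<exists>x y z. \<forall>x' y' z'.
     [x' = x] (mod p\<^sup>2) \<longrightarrow> [y' = y] (mod p\<^sup>2) \<longrightarrow> [z' = z] (mod p\<^sup>2) \<longrightarrow>
     parity_ok p (A * B * C) (A * x'\<^sup>2 + B * y'\<^sup>2 + C * z'\<^sup>2))"

section \<open>The local conditions at odd primes and at 2\<close>

lemma locally_ok_swap12: "locally_ok p B A C \<Longrightarrow> locally_ok p A B C"
  unfolding locally_ok_def by (simp only: mult.commute[of B A] add.commute[of "B * _"]) blast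

lemma locally_ok_swap23:
  assumes "locally_ok p A C B" shows "locally_ok p A B C"
proof -
  have "A * C * B = A * B * C" "\<And>x y z. A * x + C * y + B * z = A * x + B * z + C * y" by simp_all
  with assms show ?thesis unfolding locally_ok_def by metis
qed

text \<open>The vector (1, 0, 0) has a value prime to p. Multiplicity 0 settles odd p, and also p =
  2 if the multiplicity of A B C is odd.\<close>

lemma locally_ok_of_unit:
  assumes p: "prime p" and A: "\<not> p dvd A" and ok: "p = 2 \<longrightarrow> odd (multiplicity 2 (A * B * C))"
  shows "locally_ok p A B C"
  unfolding locally_ok_def
proof (intro exI allI impI)
  fix x y z assume "[x = 1] (mod p\<^sup>2)" "[y = 0] (mod p\<^sup>2)" "[z = 0] (mod p\<^sup>2)"
  hence "[x = 1] (mod p)" "[y = 0] (mod p)" "[z = 0] (mod p)"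
    by (auto intro: cong_dvd_modulus_nat simp: power2_eq_square)
  hence "[A * x\<^sup>2 + B * y\<^sup>2 + C * z\<^sup>2 = A * 1\<^sup>2 + B * 0\<^sup>2 + C * 0\<^sup>2] (mod p)"
    by (intro cong_add cong_mult cong_pow cong_refl)
  hence "\<not> p dvd A * x\<^sup>2 + B * y\<^sup>2 + C * z\<^sup>2" using A cong_dvd_iff[of _ _ p] by simp
  hence "multiplicity p (A * x\<^sup>2 + B * y\<^sup>2 + C * z\<^sup>2) = 0" by (rule not_dvd_imp_multiplicity_0)
  thus "parity_ok p (A * B * C) (A * x\<^sup>2 + B * y\<^sup>2 + C * z\<^sup>2)"
    using ok by (auto simp: parity_ok_def)
qed

text \<open>Modulo p, both A x^2 and -(B y^2 + C) take (p + 1)/2 values, so they have a value in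
  common.\<close>

lemma prime_dvd_binary_form:
  fixes A B C :: int
  assumes p: "prime p" "p > 2" and unit: "\<not> int p dvd A" "\<not> int p dvd B"
  shows "\<exists>x y :: nat. int p dvd A * (int x)\<^sup>2 + B * (int y)\<^sup>2 + C"
proof -
  let ?S = "{0..(p - 1) div 2}"
  define f where "f = (\<lambda>x. (A * (int x)\<^sup>2) mod int p)"
  define g where "g = (\<lambda>y. (- (B * (int y)\<^sup>2 + C)) mod int p)"
  have inj: "x = y" if "x \<in> ?S" "y \<in> ?S" "int p dvd u * ((int x)\<^sup>2 - (int y)\<^sup>2)" "\<not> int p dvd u" for x y u
  proof -
    have pp: "prime (int p)" using p(1) by simp
    have "int p dvd (int x)\<^sup>2 - (int y)\<^sup>2" using that(3,4) pp prime_dvd_mult_iff by blast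
    hence "int p dvd (int x - int y) * (int x + int y)" by (simp add: power2_eq_square algebra_simps)
    hence or: "int p dvd int x - int y \<or> int p dvd int x + int y" using pp prime_dvd_mult_iff by blast
    have b: "\<bar>int x - int y\<bar> < int p" "int x + int y < int p" using that(1,2) p(2) by auto
    show ?thesis
    proof (rule ccontr)
      assume "x \<noteq> y"
      hence "int x - int y \<noteq> 0" "int x + int y > 0" by auto
      thus False using or b dvd_imp_le_int[of "int x - int y" "int p"] zdvd_imp_le[of "int p" "int x + int y"] by auto
    qed
  qed
  have "inj_on f ?S"
  proof (rule inj_onI)
    fix x y assume xy: "x \<in> ?S" "y \<in> ?S" "f x = f y"
    have "int p dvd A * (int x)\<^sup>2 - A * (int y)\<^sup>2" using xy(3) by (simp add: f_def mod_eq_dvd_iff)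
    thus "x = y" using inj[OF xy(1,2) _ unit(1)] by (simp add: right_diff_distrib)
  qed
  hence cf: "card (f ` ?S) = Suc ((p - 1) div 2)" by (simp add: card_image)
  have "inj_on g ?S"
  proof (rule inj_onI)
    fix x y assume xy: "x \<in> ?S" "y \<in> ?S" "g x = g y"
    have "int p dvd - (B * (int x)\<^sup>2 + C) - - (B * (int y)\<^sup>2 + C)"
      using xy(3) unfolding g_def by (simp only: mod_eq_dvd_iff)
    also have "- (B * (int x)\<^sup>2 + C) - - (B * (int y)\<^sup>2 + C) = - (B * ((int x)\<^sup>2 - (int y)\<^sup>2))"
      by (simp add: algebra_simps)
    finally have "int p dvd B * ((int x)\<^sup>2 - (int y)\<^sup>2)" by (simp only: dvd_minus_iff)
    thus "x = y" using inj[OF xy(1,2) _ unit(2)] by blast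
  qed
  hence cg: "card (g ` ?S) = Suc ((p - 1) div 2)" by (simp add: card_image)
  have sub: "f ` ?S \<union> g ` ?S \<subseteq> {0..<int p}" using p by (auto simp: f_def g_def)
  have "f ` ?S \<inter> g ` ?S \<noteq> {}"
  proof
    assume "f ` ?S \<inter> g ` ?S = {}"
    hence "card (f ` ?S \<union> g ` ?S) = Suc ((p - 1) div 2) + Suc ((p - 1) div 2)"
      using cf cg by (simp add: card_Un_disjoint)
    moreover have "card (f ` ?S \<union> g ` ?S) \<le> p" using card_mono[OF _ sub] by simp
    moreover have "odd p" using p by (rule prime_odd_nat)
    ultimately show False by presburger
  qed
  then obtain x y where "f x = g y" by blast
  hence "int p dvd A * (int x)\<^sup>2 - - (B * (int y)\<^sup>2 + C)" unfolding f_def g_def by (simp only: mod_eq_dvd_iff)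
  hence "int p dvd A * (int x)\<^sup>2 + B * (int y)\<^sup>2 + C" by (simp only: diff_minus_eq_add add.assoc)
  thus ?thesis by blast
qed

text \<open>A coefficient prime to p gives a value prime to p. If p divides all three squarefree
  coefficients, A B C has multiplicity 3, so the value needs even multiplicity: it is arranged to be
  p N with N divisible by p exactly once.\<close>

lemma locally_ok_odd:
  assumes p: "prime p" "p > 2" and sqf: "squarefree A" "squarefree B" "squarefree C"
  shows "locally_ok p A B C"
proof (cases "p dvd A \<and> p dvd B \<and> p dvd C")
  case False
  thus ?thesis
    using locally_ok_of_unit[OF p(1), of A B C] locally_ok_of_unit[OF p(1), of B A C] locally_ok_of_unit[OF p(1), of C A B]
      locally_ok_swap12 locally_ok_swap23 p(2) by blast
next
  case True
  then obtain A' B' C' where ABC: "A = p * A'" "B = p * B'" "C = p * C'" by (auto elim!: dvdE)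
  have unit: "\<not> p dvd C'" "\<not> p dvd B'" "\<not> p dvd A'"
  proof -
    have "\<not> p dvd X'" if "squarefree (p * X')" for X'
    proof
      assume "p dvd X'"
      hence "p\<^sup>2 dvd p * X'" unfolding power2_eq_square by (rule mult_dvd_mono[OF dvd_refl])
      hence "p dvd 1" using that squarefreeD by blast
      thus False using p(1) by auto
    qed
    thus "\<not> p dvd C'" "\<not> p dvd B'" "\<not> p dvd A'" using sqf ABC by auto
  qed
  obtain x y where "int p dvd int A' * (int x)\<^sup>2 + int B' * (int y)\<^sup>2 + int C'"
    using prime_dvd_binary_form[OF p, of "int A'" "int B'" "int C'"] unit by auto
  hence "int p dvd int (A' * x\<^sup>2 + B' * y\<^sup>2 + C')" by simp
  hence xy: "p dvd A' * x\<^sup>2 + B' * y\<^sup>2 + C'" by (simp only: int_dvd_int_iff)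
  let ?N = "\<lambda>x y z. A' * x\<^sup>2 + B' * y\<^sup>2 + C' * z\<^sup>2"
  obtain z where z: "p dvd ?N x y z" "\<not> p\<^sup>2 dvd ?N x y z"
  proof (cases "p\<^sup>2 dvd ?N x y 1")
    case False
    thus ?thesis using that[of 1] xy by simp
  next
    case True
    \<comment> \<open>If N happens to be divisible by p^2, moving z from 1 to 1 + p changes it by p
      times a unit.\<close>
    have eq: "?N x y (1 + p) = ?N x y 1 + p * (C' * (2 + p))" by (simp add: power2_eq_square algebra_simps)
    have "\<not> p dvd 2" using p(2) by (auto dest: dvd_imp_le)
    hence "\<not> p dvd 2 + p" using dvd_add_triv_right_iff by blast
    hence "\<not> p dvd C' * (2 + p)" using unit(1) p(1) prime_dvd_mult_iff by blast
    hence "\<not> p\<^sup>2 dvd p * (C' * (2 + p))" using p by (simp add: power2_eq_square)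
    hence "\<not> p\<^sup>2 dvd ?N x y (1 + p)" unfolding eq using True by (simp add: dvd_add_right_iff)
    moreover have "p dvd ?N x y (1 + p)" unfolding eq using xy by simp
    ultimately show ?thesis using that by blast
  qed
  show ?thesis unfolding locally_ok_def
  proof (intro exI allI impI)
    fix x' y' z' assume c: "[x' = x] (mod p\<^sup>2)" "[y' = y] (mod p\<^sup>2)" "[z' = z] (mod p\<^sup>2)"
    have "[?N x' y' z' = ?N x y z] (mod p\<^sup>2)" by (intro cong_add cong_mult cong_pow cong_refl c)
    moreover from this have "[?N x' y' z' = ?N x y z] (mod p)"
      by (rule cong_dvd_modulus_nat) (simp add: power2_eq_square)
    ultimately have "p dvd ?N x' y' z'" "\<not> p\<^sup>2 dvd ?N x' y' z'" using z cong_dvd_iff by blast+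
    hence d: "p ^ 1 dvd ?N x' y' z'" "\<not> p ^ Suc 1 dvd ?N x' y' z'" by (simp_all add: power2_eq_square)
    hence "multiplicity p (?N x' y' z') = 1" by (rule multiplicity_eqI)
    moreover have nz: "?N x' y' z' \<noteq> 0" using d(2) by (metis dvd_0_right)
    moreover have "A * x'\<^sup>2 + B * y'\<^sup>2 + C * z'\<^sup>2 = p * ?N x' y' z'" by (simp add: ABC algebra_simps)
    ultimately have "multiplicity p (A * x'\<^sup>2 + B * y'\<^sup>2 + C * z'\<^sup>2) = 2"
      using p nz by (simp only: prime_elem_multiplicity_mult_distrib prime_imp_prime_elem) (simp add: multiplicity_self)
    thus "parity_ok p (A * B * C) (A * x'\<^sup>2 + B * y'\<^sup>2 + C * z'\<^sup>2)" using p(2) by (simp add: parity_ok_def)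
  qed
qed

text \<open>The multiplicity of the value must have the parity opposite to that of A B C. If all
  coefficients are odd or all are even, two of them (halved in the second case) agree modulo 4, and
  their sum is 2 modulo 4. If just one is even, an odd coefficient serves as the value; if two are,
  an even one does, being 2 modulo 4.\<close>

lemma locally_ok_2:
  assumes sqf: "squarefree A" "squarefree B" "squarefree C"
  shows "locally_ok 2 A B C"
proof -
  have sq4: "\<not> 4 dvd X" if "squarefree X" for X :: nat
    using that squarefreeD[of X 2] by auto
  have mod4: "multiplicity 2 N = 1" "N \<noteq> 0" if "N mod 4 = 2" for N :: nat
  proof -
    have "even N" using dvd_mod_iff[of 2 4 N] that by simp
    moreover have "\<not> 4 dvd N" using that by (simp add: dvd_eq_mod_eq_0)
    ultimately show "multiplicity 2 N = 1" by (intro multiplicity_eqI) simp_all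
    show "N \<noteq> 0" using that by auto
  qed
  have odd4: "X mod 4 = 1 \<or> X mod 4 = 3" if "odd X" for X :: nat using that by presburger
  have add4: "(X + Y) mod 4 = 2" if "odd X" "[X = Y] (mod 4)" for X Y :: nat
    using odd4[OF that(1)] that(2) unfolding cong_def by (subst mod_add_eq[symmetric]) auto
  have odd_case: "locally_ok 2 A B C" if "odd A" "odd B" "odd C" "[A = B] (mod 4)" for A B C :: nat
    unfolding locally_ok_def
  proof (intro exI allI impI)
    fix x y z :: nat assume c: "[x = 1] (mod 2\<^sup>2)" "[y = 1] (mod 2\<^sup>2)" "[z = 0] (mod 2\<^sup>2 :: nat)"
    have "[A * x\<^sup>2 + B * y\<^sup>2 + C * z\<^sup>2 = A * 1\<^sup>2 + B * 1\<^sup>2 + C * 0\<^sup>2] (mod 2\<^sup>2)"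
      by (intro cong_add cong_mult cong_pow cong_refl c)
    hence "(A * x\<^sup>2 + B * y\<^sup>2 + C * z\<^sup>2) mod 4 = (A + B) mod 4" by (simp add: cong_def)
    moreover have "(A + B) mod 4 = 2" by (rule add4[OF that(1,4)])
    ultimately have "multiplicity 2 (A * x\<^sup>2 + B * y\<^sup>2 + C * z\<^sup>2) = 1" by (intro mod4(1)) simp
    moreover have "multiplicity 2 (A * B * C) = 0" using that by (intro not_dvd_imp_multiplicity_0) simp
    ultimately show "parity_ok 2 (A * B * C) (A * x\<^sup>2 + B * y\<^sup>2 + C * z\<^sup>2)" by (simp add: parity_ok_def)
  qed
  have even_case: "locally_ok 2 (2 * A) (2 * B) (2 * C)" if "odd A" "odd B" "odd C" "[A = B] (mod 4)" for A B C :: nat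
    unfolding locally_ok_def
  proof (intro exI allI impI)
    fix x y z :: nat assume c: "[x = 1] (mod 2\<^sup>2)" "[y = 1] (mod 2\<^sup>2)" "[z = 0] (mod 2\<^sup>2 :: nat)"
    have "[A * x\<^sup>2 + B * y\<^sup>2 + C * z\<^sup>2 = A * 1\<^sup>2 + B * 1\<^sup>2 + C * 0\<^sup>2] (mod 2\<^sup>2)"
      by (intro cong_add cong_mult cong_pow cong_refl c)
    hence "(A * x\<^sup>2 + B * y\<^sup>2 + C * z\<^sup>2) mod 4 = (A + B) mod 4" by (simp add: cong_def)
    moreover have "(A + B) mod 4 = 2" by (rule add4[OF that(1,4)])
    ultimately have "(A * x\<^sup>2 + B * y\<^sup>2 + C * z\<^sup>2) mod 4 = 2" by simp
    hence m1: "multiplicity 2 (A * x\<^sup>2 + B * y\<^sup>2 + C * z\<^sup>2) = 1" and nz: "A * x\<^sup>2 + B * y\<^sup>2 + C * z\<^sup>2 \<noteq> 0"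
      by (rule mod4)+
    define N where "N = A * x\<^sup>2 + B * y\<^sup>2 + C * z\<^sup>2"
    have "multiplicity 2 (2 * N) = 2"
      using m1 nz unfolding N_def[symmetric] by (simp add: prime_elem_multiplicity_mult_distrib)
    moreover have "2 * A * x\<^sup>2 + 2 * B * y\<^sup>2 + 2 * C * z\<^sup>2 = 2 * N" by (simp add: N_def)
    ultimately have "multiplicity 2 (2 * A * x\<^sup>2 + 2 * B * y\<^sup>2 + 2 * C * z\<^sup>2) = 2" by simp
    moreover have "multiplicity 2 (2 * A * (2 * B) * (2 * C)) = 3"
    proof (rule multiplicity_eqI)
      have e: "2 * A * (2 * B) * (2 * C) = 8 * (A * B * C)" by simp
      show "2 ^ 3 dvd 2 * A * (2 * B) * (2 * C)" unfolding e by simp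
      have "odd (A * B * C)" using that by simp
      thus "\<not> 2 ^ Suc 3 dvd 2 * A * (2 * B) * (2 * C)" unfolding e by (simp add: mult_dvd_mono)
    qed
    ultimately show "parity_ok 2 (2 * A * (2 * B) * (2 * C)) (2 * A * x\<^sup>2 + 2 * B * y\<^sup>2 + 2 * C * z\<^sup>2)"
      by (simp add: parity_ok_def)
  qed
  have mid_case: "locally_ok 2 A B C" if "even A" "squarefree A" "even (multiplicity 2 (A * B * C))" for A B C :: nat
    unfolding locally_ok_def
  proof (intro exI allI impI)
    fix x y z :: nat assume c: "[x = 1] (mod 2\<^sup>2)" "[y = 0] (mod 2\<^sup>2)" "[z = 0] (mod 2\<^sup>2 :: nat)"
    have "[A * x\<^sup>2 + B * y\<^sup>2 + C * z\<^sup>2 = A * 1\<^sup>2 + B * 0\<^sup>2 + C * 0\<^sup>2] (mod 2\<^sup>2)"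
      by (intro cong_add cong_mult cong_pow cong_refl c)
    hence "(A * x\<^sup>2 + B * y\<^sup>2 + C * z\<^sup>2) mod 4 = A mod 4" by (simp add: cong_def)
    moreover have "A mod 4 = 2" using that(1) sq4[OF that(2)] by presburger
    ultimately have "multiplicity 2 (A * x\<^sup>2 + B * y\<^sup>2 + C * z\<^sup>2) = 1" by (intro mod4(1)) simp
    thus "parity_ok 2 (A * B * C) (A * x\<^sup>2 + B * y\<^sup>2 + C * z\<^sup>2)" using that(3) by (simp add: parity_ok_def)
  qed
  have pigeon: "[A = B] (mod 4) \<or> [A = C] (mod 4) \<or> [B = C] (mod 4)" if "odd A" "odd B" "odd C" for A B C :: nat
    using that[THEN odd4] unfolding cong_def by auto
  show ?thesis
  proof (cases "odd A \<and> odd B \<and> odd C")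
    case True
    thus ?thesis using pigeon[of A B C] odd_case[of A B C] odd_case[of A C B] odd_case[of B C A]
      locally_ok_swap12 locally_ok_swap23 by blast
  next
    case notodd: False
    show ?thesis
    proof (cases "even A \<and> even B \<and> even C")
      case True
      then obtain A' B' C' where ABC: "A = 2 * A'" "B = 2 * B'" "C = 2 * C'" by (auto elim!: evenE)
      have "odd A'" "odd B'" "odd C'" using sq4[OF sqf(1)] sq4[OF sqf(2)] sq4[OF sqf(3)] ABC by presburger+
      thus ?thesis unfolding ABC using pigeon[of A' B' C'] even_case[of A' B' C'] even_case[of A' C' B'] even_case[of B' C' A']
        locally_ok_swap12 locally_ok_swap23 by blast
    next
      case noteven: False
      show ?thesis
      proof (cases "odd (multiplicity 2 (A * B * C))")
        case True
        have "odd (multiplicity 2 (B * A * C))" "odd (multiplicity 2 (C * A * B))" using True by (simp_all add: mult_ac)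
        thus ?thesis using noteven True
          locally_ok_of_unit[OF two_is_prime_nat, of A B C] locally_ok_of_unit[OF two_is_prime_nat, of B A C]
          locally_ok_of_unit[OF two_is_prime_nat, of C A B] locally_ok_swap12 locally_ok_swap23 by blast
      next
        case False
        have "even (multiplicity 2 (B * A * C))" "even (multiplicity 2 (C * A * B))" using False by (simp_all add: mult_ac)
        thus ?thesis using notodd False mid_case[of A B C] mid_case[of B A C] mid_case[of C A B] sqf
          locally_ok_swap12 locally_ok_swap23 by blast
      qed
    qed
  qed
qed

text \<open>A B C is the discriminant of the form, and the other coefficient is its value a at (x,
  y, z). The local choices make the squarefree parts of the two coprime with even product, as
  \<open>norm_form_represents_difference\<close> requires; the square factors are put back
  afterwards. Positivity of x serves to make A x^2 + B y^2 positive later.\<close>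

lemma exists_norm_difference:
  fixes A B C :: nat
  assumes sqf: "squarefree A" "squarefree B" "squarefree C"
  shows "\<exists>(x::nat) (y::nat) (z::nat) (w::int) s u v. x > 0 \<and> w \<noteq> 0 \<and>
    int (A * B * C) * w\<^sup>2 = int (A * x\<^sup>2 + B * y\<^sup>2 + C * z\<^sup>2) * s\<^sup>2 + u\<^sup>2 + v\<^sup>2"
proof -
  define m where "m = A * B * C"
  have pos: "A > 0" "B > 0" "C > 0" using sqf by (metis not_squarefree_0 neq0_conv)+
  hence m0: "m > 0" by (simp add: m_def)
  define S where "S = insert 2 (prime_factors m)"
  have S: "finite S" "\<And>p. p \<in> S \<Longrightarrow> prime p" by (auto simp: S_def)
  have "locally_ok p A B C" if "p \<in> S" for p
  proof (cases "p = 2")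
    case False
    thus ?thesis using S(2)[OF that] prime_ge_2_nat[of p] by (intro locally_ok_odd sqf) auto
  qed (use locally_ok_2[OF sqf] in simp)
  hence "\<exists>t. p \<in> S \<longrightarrow> (\<forall>x' y' z'. [x' = fst t] (mod p\<^sup>2) \<longrightarrow> [y' = fst (snd t)] (mod p\<^sup>2) \<longrightarrow>
     [z' = snd (snd t)] (mod p\<^sup>2) \<longrightarrow> parity_ok p m (A * x'\<^sup>2 + B * y'\<^sup>2 + C * z'\<^sup>2))" for p
    unfolding locally_ok_def m_def by (metis fst_conv snd_conv)
  then obtain t where t: "\<And>p. p \<in> S \<longrightarrow> (\<forall>x' y' z'. [x' = fst (t p)] (mod p\<^sup>2) \<longrightarrow> [y' = fst (snd (t p))] (mod p\<^sup>2) \<longrightarrow>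
     [z' = snd (snd (t p))] (mod p\<^sup>2) \<longrightarrow> parity_ok p m (A * x'\<^sup>2 + B * y'\<^sup>2 + C * z'\<^sup>2))"
    by metis
  define X Y Z where "X = (\<lambda>p. fst (t p))" and "Y = (\<lambda>p. fst (snd (t p)))" and "Z = (\<lambda>p. snd (snd (t p)))"
  have XYZ: "p \<in> S \<Longrightarrow> [x' = X p] (mod p\<^sup>2) \<Longrightarrow> [y' = Y p] (mod p\<^sup>2) \<Longrightarrow>
     [z' = Z p] (mod p\<^sup>2) \<Longrightarrow> parity_ok p m (A * x'\<^sup>2 + B * y'\<^sup>2 + C * z'\<^sup>2)" for p x' y' z'
    using t unfolding X_def Y_def Z_def by blast
  have cop: "\<forall>i\<in>S. \<forall>j\<in>S. i \<noteq> j \<longrightarrow> coprime (i\<^sup>2) (j\<^sup>2)" using S(2) by (auto simp: primes_coprime)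
  obtain x0 where x0: "\<forall>p\<in>S. [x0 = X p] (mod p\<^sup>2)" using chinese_remainder_nat[OF S(1) cop] by blast
  obtain y where y: "\<forall>p\<in>S. [y = Y p] (mod p\<^sup>2)" using chinese_remainder_nat[OF S(1) cop] by blast
  obtain z where z: "\<forall>p\<in>S. [z = Z p] (mod p\<^sup>2)" using chinese_remainder_nat[OF S(1) cop] by blast
  \<comment> \<open>Adding the modulus makes x positive without leaving its residue classes.\<close>
  define x where "x = x0 + (\<Prod>p\<in>S. p\<^sup>2)"
  have "(\<Prod>p\<in>S. p\<^sup>2) > 0" using S by (intro prod_pos) (auto simp: prime_gt_0_nat)
  hence x1: "x > 0" by (simp add: x_def)
  have x: "[x = X p] (mod p\<^sup>2)" if "p \<in> S" for p
  proof -
    have "p\<^sup>2 dvd (\<Prod>p\<in>S. p\<^sup>2)" using S(1) that by (rule dvd_prodI)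
    hence "[x = x0] (mod p\<^sup>2)" unfolding x_def by (simp add: cong_def mod_add_eq[symmetric])
    thus ?thesis using x0 that cong_trans by blast
  qed
  define a where "a = A * x\<^sup>2 + B * y\<^sup>2 + C * z\<^sup>2"
  have ok: "parity_ok p m a" if "p \<in> S" for p unfolding a_def using XYZ[OF that] x y z that by blast
  have a0: "a > 0" using pos x1 by (simp add: a_def)
  have "coprime (squarefree_part m) (squarefree_part a)"
  proof (rule ccontr)
    assume "\<not> coprime (squarefree_part m) (squarefree_part a)"
    hence "gcd (squarefree_part m) (squarefree_part a) \<noteq> 1" by (metis coprime_iff_gcd_eq_1)
    then obtain p where p: "prime p" "p dvd squarefree_part m" "p dvd squarefree_part a"
      using prime_factor_nat[of "gcd (squarefree_part m) (squarefree_part a)"] by auto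
    hence odd: "odd (multiplicity p m)" "odd (multiplicity p a)" using squarefree_part_dvd_iff by blast+
    hence "p dvd m" by (metis not_dvd_imp_multiplicity_0 even_zero)
    hence "p \<in> S" using p(1) m0 by (simp add: S_def in_prime_factors_iff)
    from ok[OF this] odd show False by (auto simp: parity_ok_def split: if_splits)
  qed
  moreover have "even (squarefree_part m * squarefree_part a)"
  proof -
    have "odd (multiplicity 2 a + multiplicity 2 m)" using ok[of 2] by (simp add: S_def parity_ok_def)
    thus ?thesis using squarefree_part_dvd_iff[OF two_is_prime_nat] m0 a0 by auto
  qed
  ultimately obtain w s u v :: int where w: "w \<noteq> 0"
    "int (squarefree_part m) * w\<^sup>2 = int (squarefree_part a) * s\<^sup>2 + u\<^sup>2 + v\<^sup>2"
    using norm_form_represents_difference[of "squarefree_part m" "squarefree_part a"] by auto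
  define f g where "f = int (square_part m)" and "g = int (square_part a)"
  have f: "int m = int (squarefree_part m) * f\<^sup>2" and g: "int a = int (squarefree_part a) * g\<^sup>2"
    unfolding f_def g_def by (metis squarefree_decompose of_nat_mult of_nat_power)+
  have "int m * (w * g)\<^sup>2 = (int (squarefree_part m) * w\<^sup>2) * (f * g)\<^sup>2"
    unfolding f by (simp add: power_mult_distrib)
  also have "\<dots> = int a * (s * f)\<^sup>2 + (u * f * g)\<^sup>2 + (v * f * g)\<^sup>2"
    unfolding w(2) g by (simp add: power_mult_distrib algebra_simps)
  finally have "int m * (w * g)\<^sup>2 = int a * (s * f)\<^sup>2 + (u * f * g)\<^sup>2 + (v * f * g)\<^sup>2" .
  moreover have "w * g \<noteq> 0" using w(1) a0 by (simp add: g_def)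
  ultimately show ?thesis using x1 unfolding m_def a_def by blast
qed

section \<open>Ternary forms in a hermitian space of dimension three\<close>

text \<open>Every residue is a sum of two squares modulo a prime, hence modulo a squarefree number.
  For this reason the descent for hermitian conics meets no congruence condition.\<close>

lemma two_squares_congruence_squarefree:
  fixes a :: int and n :: nat
  assumes "squarefree n"
  shows "\<exists>x y. int n dvd x\<^sup>2 + y\<^sup>2 - a"
  using assms
proof (induction n rule: less_induct)
  case (less n)
  show ?case
  proof (cases "n = 1")
    case False
    then obtain p where p: "prime p" "p dvd n" using prime_factor_nat by blast
    then obtain m where n: "n = p * m" by (elim dvdE)
    have n0: "n \<noteq> 0" using less.prems by (metis not_squarefree_0)
    have cop: "coprime p m"
    proof (rule prime_imp_coprime_nat[OF p(1)])
      show "\<not> p dvd m"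
      proof
        assume "p dvd m"
        hence "p\<^sup>2 dvd n" unfolding n power2_eq_square by (rule mult_dvd_mono[OF dvd_refl])
        hence "p dvd 1" using less.prems squarefreeD by blast
        thus False using p(1) by auto
      qed
    qed
    have "m < n" using n n0 prime_gt_1_nat[OF p(1)] by simp
    moreover have "squarefree m" using less.prems n squarefree_mono by (metis dvd_triv_right)
    ultimately obtain x1 y1 where 1: "int m dvd x1\<^sup>2 + y1\<^sup>2 - a" using less.IH by blast
    obtain x2 y2 where 2: "int p dvd x2\<^sup>2 + y2\<^sup>2 - a"
    proof (cases "p = 2")
      case True
      have "even (a\<^sup>2 + 0\<^sup>2 - a)" by simp
      thus ?thesis using that True by (metis of_nat_numeral)
    next
      case False
      hence p2: "p > 2" using prime_ge_2_nat[OF p(1)] by simp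
      have "\<not> int p dvd 1" using p2 by simp
      from prime_dvd_binary_form[OF p(1) p2 this this, of "- a"] show ?thesis using that by auto
    qed
    obtain x where x: "[x = x1] (mod int m)" "[x = x2] (mod int p)"
      using binary_chinese_remainder_int[of "int m" "int p" x1 x2] cop by (auto simp: coprime_commute)
    obtain y where y: "[y = y1] (mod int m)" "[y = y2] (mod int p)"
      using binary_chinese_remainder_int[of "int m" "int p" y1 y2] cop by (auto simp: coprime_commute)
    have "[x\<^sup>2 + y\<^sup>2 - a = x1\<^sup>2 + y1\<^sup>2 - a] (mod int m)" "[x\<^sup>2 + y\<^sup>2 - a = x2\<^sup>2 + y2\<^sup>2 - a] (mod int p)"
      by (intro cong_diff cong_add cong_pow cong_refl x y)+
    hence "int m dvd x\<^sup>2 + y\<^sup>2 - a" "int p dvd x\<^sup>2 + y\<^sup>2 - a" using 1 2 cong_dvd_iff by blast+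
    hence "int p * int m dvd x\<^sup>2 + y\<^sup>2 - a" using cop by (intro divides_mult) auto
    thus ?thesis unfolding n by auto
  qed simp
qed

section \<open>Isotropy of the hermitian form N(x) - a N(y) - b N(z)\<close>

definition hermitian_conic_solvable :: "int \<Rightarrow> int \<Rightarrow> bool" where
  "hermitian_conic_solvable a b \<longleftrightarrow> (\<exists>x1 x2 y1 y2 z1 z2 :: int.
     x1\<^sup>2 + x2\<^sup>2 = a * (y1\<^sup>2 + y2\<^sup>2) + b * (z1\<^sup>2 + z2\<^sup>2) \<and>
     \<not> (x1 = 0 \<and> x2 = 0 \<and> y1 = 0 \<and> y2 = 0 \<and> z1 = 0 \<and> z2 = 0))"

lemma hermitian_conic_sym: "hermitian_conic_solvable a b \<Longrightarrow> hermitian_conic_solvable b a"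
  unfolding hermitian_conic_solvable_def by (metis add.commute)

lemma hermitian_conic_base: "a = 1 \<or> a = 2 \<Longrightarrow> hermitian_conic_solvable a b"
proof (elim disjE)
  assume "a = 1"
  hence "1\<^sup>2 + 0\<^sup>2 = a * (1\<^sup>2 + 0\<^sup>2) + b * (0\<^sup>2 + 0\<^sup>2)" by simp
  thus ?thesis unfolding hermitian_conic_solvable_def by (metis zero_neq_one)
next
  assume "a = 2"
  hence "1\<^sup>2 + 1\<^sup>2 = a * (1\<^sup>2 + 0\<^sup>2) + b * (0\<^sup>2 + 0\<^sup>2)" by simp
  thus ?thesis unfolding hermitian_conic_solvable_def by (metis zero_neq_one)
qed

text \<open>Composition of the norm forms \<open>N(x) - a N(y)\<close> of the quaternion algebra \<open>(-1, a)\<close>.\<close>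

lemma hermitian_conic_descent:
  assumes c: "b * c = x1\<^sup>2 + x2\<^sup>2 - a" "c \<noteq> 0" and sol: "hermitian_conic_solvable a c"
  shows "hermitian_conic_solvable a b"
proof -
  obtain X1 X2 Y1 Y2 Z1 Z2 where eq: "X1\<^sup>2 + X2\<^sup>2 = a * (Y1\<^sup>2 + Y2\<^sup>2) + c * (Z1\<^sup>2 + Z2\<^sup>2)"
    and nz: "\<not> (X1 = 0 \<and> X2 = 0 \<and> Y1 = 0 \<and> Y2 = 0 \<and> Z1 = 0 \<and> Z2 = 0)"
    using sol unfolding hermitian_conic_solvable_def by blast
  show ?thesis
  proof (cases "Z1 = 0 \<and> Z2 = 0")
    case True
    hence "X1\<^sup>2 + X2\<^sup>2 = a * (Y1\<^sup>2 + Y2\<^sup>2) + b * (0\<^sup>2 + 0\<^sup>2)" using eq by simp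
    thus ?thesis using nz True unfolding hermitian_conic_solvable_def by blast
  next
    case False
    define P1 P2 Q1 Q2 where "P1 = x1 * X1 - x2 * X2 + a * Y1" and "P2 = x1 * X2 + x2 * X1 - a * Y2"
      and "Q1 = x1 * Y1 - x2 * Y2 + X1" and "Q2 = x1 * Y2 + x2 * Y1 - X2"
    have "P1\<^sup>2 + P2\<^sup>2 - a * (Q1\<^sup>2 + Q2\<^sup>2) = (x1\<^sup>2 + x2\<^sup>2 - a) * (X1\<^sup>2 + X2\<^sup>2 - a * (Y1\<^sup>2 + Y2\<^sup>2))"
      unfolding P1_def P2_def Q1_def Q2_def by (simp add: power2_eq_square algebra_simps)
    also have "\<dots> = (b * c) * (c * (Z1\<^sup>2 + Z2\<^sup>2))" using eq c(1) by simp
    also have "\<dots> = b * ((c * Z1)\<^sup>2 + (c * Z2)\<^sup>2)" by (simp add: power2_eq_square algebra_simps)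
    finally have "P1\<^sup>2 + P2\<^sup>2 = a * (Q1\<^sup>2 + Q2\<^sup>2) + b * ((c * Z1)\<^sup>2 + (c * Z2)\<^sup>2)" by simp
    moreover have "\<not> (c * Z1 = 0 \<and> c * Z2 = 0)" using False c(2) by simp
    ultimately show ?thesis unfolding hermitian_conic_solvable_def by blast
  qed
qed

text \<open>Legendre's descent with norms of Gaussian integers in place of squares: b is replaced by
  a smaller c with b c = N(x) - a. Square factors of b are removed first, and the sign condition is
  inherited by c.\<close>

lemma hermitian_conic:
  assumes "a \<noteq> 0" "b \<noteq> 0" "a > 0 \<or> b > 0"
  shows "hermitian_conic_solvable a b"
  using assms
proof (induction "nat (\<bar>a\<bar> + \<bar>b\<bar>)" arbitrary: a b rule: less_induct)
  case less
  have main: "hermitian_conic_solvable a b"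
    if ab: "\<bar>a\<bar> \<le> \<bar>b\<bar>" "a \<noteq> 0" "b \<noteq> 0" "a > 0 \<or> b > 0"
      and IH: "\<And>a' b'. \<bar>a'\<bar> + \<bar>b'\<bar> < \<bar>a\<bar> + \<bar>b\<bar> \<Longrightarrow> a' \<noteq> 0 \<Longrightarrow> b' \<noteq> 0 \<Longrightarrow> a' > 0 \<or> b' > 0 \<Longrightarrow> hermitian_conic_solvable a' b'"
    for a b
  proof (cases "\<bar>b\<bar> \<le> 2")
    case True
    \<comment> \<open>Some coefficient is positive and at most 2, and 1 and 2 are norms.\<close>
    hence "a = 1 \<or> a = 2 \<or> b = 1 \<or> b = 2" using ab by auto
    thus ?thesis using hermitian_conic_base hermitian_conic_sym by blast
  next
    case False
    show ?thesis
    proof (cases "squarefree (nat \<bar>b\<bar>)")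
      case nsq: False
      then obtain k where k: "k\<^sup>2 dvd nat \<bar>b\<bar>" "\<not> k dvd 1" unfolding squarefree_def by blast
      hence "(int k)\<^sup>2 dvd b" by (metis of_nat_power int_dvd_int_iff int_nat_eq abs_ge_zero dvd_abs_iff)
      then obtain b' where b': "b = (int k)\<^sup>2 * b'" by (elim dvdE)
      have k0: "k > 1" using k ab(3) b' by (cases "k = 0") auto
      have b'0: "b' \<noteq> 0" using ab(3) b' by auto
      have "2 * \<bar>b'\<bar> \<le> (int k)\<^sup>2 * \<bar>b'\<bar>"
        using k0 power_mono[of 2 "int k" 2] by (intro mult_right_mono) auto
      hence "\<bar>b'\<bar> < \<bar>b\<bar>" using b'0 b' by (simp add: abs_mult)
      moreover have "a > 0 \<or> b' > 0" using ab(4) b' by (auto simp: zero_less_mult_iff)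
      ultimately have "hermitian_conic_solvable a b'" using IH ab b'0 by simp
      then obtain x1 x2 y1 y2 z1 z2 where eq: "x1\<^sup>2 + x2\<^sup>2 = a * (y1\<^sup>2 + y2\<^sup>2) + b' * (z1\<^sup>2 + z2\<^sup>2)"
        and nz: "\<not> (x1 = 0 \<and> x2 = 0 \<and> y1 = 0 \<and> y2 = 0 \<and> z1 = 0 \<and> z2 = 0)"
        unfolding hermitian_conic_solvable_def by blast
      have "(k * x1)\<^sup>2 + (k * x2)\<^sup>2 = (int k)\<^sup>2 * (x1\<^sup>2 + x2\<^sup>2)" by (simp add: power_mult_distrib algebra_simps)
      also have "\<dots> = a * ((k * y1)\<^sup>2 + (k * y2)\<^sup>2) + b * (z1\<^sup>2 + z2\<^sup>2)"
        unfolding eq b' by (simp add: power_mult_distrib algebra_simps)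
      finally have "(k * x1)\<^sup>2 + (k * x2)\<^sup>2 = \<dots>" .
      moreover have "\<not> (k * x1 = 0 \<and> k * x2 = 0 \<and> k * y1 = 0 \<and> k * y2 = 0 \<and> z1 = 0 \<and> z2 = 0)"
        using nz k0 by auto
      ultimately show ?thesis unfolding hermitian_conic_solvable_def by blast
    next
      case True
      obtain x y where "int (nat \<bar>b\<bar>) dvd x\<^sup>2 + y\<^sup>2 - a" using two_squares_congruence_squarefree[OF True] by blast
      hence xy: "b dvd x\<^sup>2 + y\<^sup>2 - a" by simp
      have red: "\<exists>x'. b dvd x - x' \<and> 2 * \<bar>x'\<bar> \<le> \<bar>b\<bar>" for x
      proof -
        define r where "r = x mod \<bar>b\<bar>"
        have r: "0 \<le> r" "r < \<bar>b\<bar>" "b dvd x - r" using ab(3) by (simp_all add: r_def) (metis abs_dvd_iff dvd_minus_mod)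
        show ?thesis
        proof (cases "2 * r \<le> \<bar>b\<bar>")
          case False
          have "x - (r - \<bar>b\<bar>) = (x - r) + \<bar>b\<bar>" by simp
          hence "b dvd x - (r - \<bar>b\<bar>)" using r(3) by (metis dvd_add dvd_abs_iff dvd_refl)
          thus ?thesis using r False by (intro exI[of _ "r - \<bar>b\<bar>"]) auto
        qed (use r in auto)
      qed
      obtain x' y' where x': "b dvd x - x'" "2 * \<bar>x'\<bar> \<le> \<bar>b\<bar>" and y': "b dvd y - y'" "2 * \<bar>y'\<bar> \<le> \<bar>b\<bar>"
        using red[of x] red[of y] by blast
      have "x'\<^sup>2 + y'\<^sup>2 - a = (x\<^sup>2 + y\<^sup>2 - a) - (x - x') * (x + x') - (y - y') * (y + y')"
        by (simp add: power2_eq_square algebra_simps)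
      moreover have "b dvd (x\<^sup>2 + y\<^sup>2 - a) - (x - x') * (x + x') - (y - y') * (y + y')"
        by (intro dvd_diff dvd_mult2 xy x'(1) y'(1))
      ultimately have "b dvd x'\<^sup>2 + y'\<^sup>2 - a" by metis
      then obtain c where c: "b * c = x'\<^sup>2 + y'\<^sup>2 - a" by (metis dvdE)
      show ?thesis
      proof (cases "c = 0")
        case True
        hence "x'\<^sup>2 + y'\<^sup>2 = a * (1\<^sup>2 + 0\<^sup>2) + b * (0\<^sup>2 + 0\<^sup>2)" using c by simp
        thus ?thesis unfolding hermitian_conic_solvable_def by (metis zero_neq_one)
      next
        case c0: False
        have "(2 * \<bar>x'\<bar>)\<^sup>2 \<le> \<bar>b\<bar>\<^sup>2" "(2 * \<bar>y'\<bar>)\<^sup>2 \<le> \<bar>b\<bar>\<^sup>2" using x' y' by (intro power_mono; simp)+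
        hence 1: "2 * (x'\<^sup>2 + y'\<^sup>2) \<le> \<bar>b\<bar> * \<bar>b\<bar>" by (simp add: power_mult_distrib power2_eq_square)
        have "\<bar>b\<bar> * \<bar>c\<bar> = \<bar>x'\<^sup>2 + y'\<^sup>2 - a\<bar>" using c by (metis abs_mult)
        also have "\<dots> \<le> \<bar>x'\<^sup>2 + y'\<^sup>2\<bar> + \<bar>a\<bar>" by (rule abs_triangle_ineq4)
        finally have "2 * (\<bar>b\<bar> * \<bar>c\<bar>) \<le> 2 * (x'\<^sup>2 + y'\<^sup>2) + 2 * \<bar>a\<bar>" by simp
        also have "\<dots> \<le> \<bar>b\<bar> * \<bar>b\<bar> + 2 * \<bar>b\<bar>" using 1 ab(1) by (intro add_mono) auto
        finally have "2 * (\<bar>b\<bar> * \<bar>c\<bar>) \<le> \<bar>b\<bar> * \<bar>b\<bar> + 2 * \<bar>b\<bar>" .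
        hence "\<bar>b\<bar> * (2 * \<bar>c\<bar>) \<le> \<bar>b\<bar> * (\<bar>b\<bar> + 2)" by (simp add: algebra_simps)
        hence "2 * \<bar>c\<bar> \<le> \<bar>b\<bar> + 2" using ab(3) by simp
        hence "\<bar>c\<bar> < \<bar>b\<bar>" using False by linarith
        moreover have "a > 0 \<or> c > 0"
        proof (rule ccontr)
          assume n: "\<not> (a > 0 \<or> c > 0)"
          hence "b > 0" "a < 0" "c < 0" using ab c0 by auto
          hence "b * c < 0" by (simp add: mult_pos_neg)
          moreover have "x'\<^sup>2 + y'\<^sup>2 - a > 0" using \<open>a < 0\<close> by (simp add: add_nonneg_pos less_le_trans)
          ultimately show False using c by simp
        qed
        ultimately have "hermitian_conic_solvable a c" using IH ab(2) c0 by simp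
        thus ?thesis using hermitian_conic_descent[OF c c0] by blast
      qed
    qed
  qed
  show ?case
  proof (cases "\<bar>a\<bar> \<le> \<bar>b\<bar>")
    case True
    show ?thesis by (rule main[OF True less.prems]) (rule less.hyps, auto)
  next
    case False
    have "hermitian_conic_solvable b a"
    proof (rule main)
      fix a' b' :: int
      assume "\<bar>a'\<bar> + \<bar>b'\<bar> < \<bar>b\<bar> + \<bar>a\<bar>" "a' \<noteq> 0" "b' \<noteq> 0" "a' > 0 \<or> b' > 0"
      thus "hermitian_conic_solvable a' b'" by (intro less.hyps) auto
    qed (use False less.prems in auto)
    thus ?thesis by (rule hermitian_conic_sym)
  qed
qed

section \<open>Isometries over the Gaussian rationals\<close>

definition gaussian_rats :: "complex set" where
  "gaussian_rats = {z. Re z \<in> \<rat> \<and> Im z \<in> \<rat>}"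

lemma gaussian_rats_closed:
  assumes "z \<in> gaussian_rats" "w \<in> gaussian_rats"
  shows "z + w \<in> gaussian_rats" "z - w \<in> gaussian_rats" "z * w \<in> gaussian_rats"
    "z / w \<in> gaussian_rats" "cnj z \<in> gaussian_rats" "- z \<in> gaussian_rats"
  using assms by (auto simp: gaussian_rats_def Re_divide Im_divide)

lemma gaussian_rats_of_real: "x \<in> \<rat> \<Longrightarrow> complex_of_real x \<in> gaussian_rats"
  by (simp add: gaussian_rats_def)

lemma gaussian_rats_Complex: "x \<in> \<rat> \<Longrightarrow> y \<in> \<rat> \<Longrightarrow> Complex x y \<in> gaussian_rats"
  by (simp add: gaussian_rats_def)

text \<open>In a nontrivial solution of N(x) = h N(y) + k N(z), positivity of h and k forces x to be
  nonzero, so one may divide by x.\<close>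

lemma hermitian_binary_represents_1:
  fixes h k :: int
  assumes "h > 0" "k > 0"
  shows "\<exists>\<alpha>\<in>gaussian_rats. \<exists>\<beta>\<in>gaussian_rats. of_int h * (cmod \<alpha>)\<^sup>2 + of_int k * (cmod \<beta>)\<^sup>2 = 1"
proof -
  have "hermitian_conic_solvable h k" using assms by (intro hermitian_conic) auto
  then obtain x1 x2 y1 y2 z1 z2 where eq: "x1\<^sup>2 + x2\<^sup>2 = h * (y1\<^sup>2 + y2\<^sup>2) + k * (z1\<^sup>2 + z2\<^sup>2)"
    and nz: "\<not> (x1 = 0 \<and> x2 = 0 \<and> y1 = 0 \<and> y2 = 0 \<and> z1 = 0 \<and> z2 = 0)"
    unfolding hermitian_conic_solvable_def by blast
  define X Y Z where "X = Complex (of_int x1) (of_int x2)" and "Y = Complex (of_int y1) (of_int y2)"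
    and "Z = Complex (of_int z1) (of_int z2)"
  have mem: "X \<in> gaussian_rats" "Y \<in> gaussian_rats" "Z \<in> gaussian_rats"
    unfolding X_def Y_def Z_def by (intro gaussian_rats_Complex; simp)+
  have "(cmod X)\<^sup>2 = of_int (x1\<^sup>2 + x2\<^sup>2)" by (simp add: X_def cmod_power2)
  also have "\<dots> = of_int h * (cmod Y)\<^sup>2 + of_int k * (cmod Z)\<^sup>2"
    unfolding eq by (simp add: Y_def Z_def cmod_power2)
  finally have eq': "(cmod X)\<^sup>2 = of_int h * (cmod Y)\<^sup>2 + of_int k * (cmod Z)\<^sup>2" .
  have "X \<noteq> 0"
  proof
    assume "X = 0"
    hence "of_int h * (cmod Y)\<^sup>2 + of_int k * (cmod Z)\<^sup>2 = 0" using eq' by simp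
    moreover have "of_int h * (cmod Y)\<^sup>2 \<ge> 0" "of_int k * (cmod Z)\<^sup>2 \<ge> 0" using assms by simp_all
    ultimately have "of_int h * (cmod Y)\<^sup>2 = 0" "of_int k * (cmod Z)\<^sup>2 = 0" by linarith+
    hence "Y = 0" "Z = 0" using assms by simp_all
    thus False using nz \<open>X = 0\<close> by (simp add: X_def Y_def Z_def complex_eq_iff)
  qed
  hence "of_int h * (cmod (Y / X))\<^sup>2 + of_int k * (cmod (Z / X))\<^sup>2 = 1"
  proof -
    assume "X \<noteq> 0"
    have "of_int h * (cmod (Y / X))\<^sup>2 + of_int k * (cmod (Z / X))\<^sup>2
        = (of_int h * (cmod Y)\<^sup>2 + of_int k * (cmod Z)\<^sup>2) / (cmod X)\<^sup>2"
      by (simp add: norm_divide power_divide add_divide_distrib)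
    also have "\<dots> = 1" unfolding eq'[symmetric] using \<open>X \<noteq> 0\<close> by simp
    finally show ?thesis .
  qed
  thus ?thesis using gaussian_rats_closed(4)[OF mem(2,1)] gaussian_rats_closed(4)[OF mem(3,1)] by blast
qed

text \<open>In diagonal notation <a, b> = <1, ab>, because the form represents 1 and has determinant
  ab; in the same way <ab, ab> = <1, (ab)^2> = <1, 1>. Hence <a, b, ab> = <1, 1, 1>. The formulas
  are the resulting coordinates: \<alpha>, \<beta> give the vector of norm 1 in the first plane,
  \<gamma>, \<delta> the one in the second.\<close>

lemma hermitian_ternary_isometry:
  fixes a b :: int
  assumes "a > 0" "b > 0"
  shows "\<exists>\<alpha>\<in>gaussian_rats. \<exists>\<beta>\<in>gaussian_rats. \<exists>\<gamma>\<in>gaussian_rats. \<exists>\<delta>\<in>gaussian_rats. \<forall>p q r.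
    (cmod (of_int a * p * cnj \<alpha> + of_int b * q * cnj \<beta>))\<^sup>2
    + (cmod (of_int (a * b) * (cnj \<gamma> * (p * \<beta> - q * \<alpha>) + r * cnj \<delta>)))\<^sup>2
    + (cmod (of_int (a * b) * (\<delta> * (p * \<beta> - q * \<alpha>) - r * \<gamma>)))\<^sup>2
    = of_int a * (cmod p)\<^sup>2 + of_int b * (cmod q)\<^sup>2 + of_int (a * b) * (cmod r)\<^sup>2"
proof -
  obtain \<alpha> \<beta> where ab: "\<alpha> \<in> gaussian_rats" "\<beta> \<in> gaussian_rats"
    "of_int a * (cmod \<alpha>)\<^sup>2 + of_int b * (cmod \<beta>)\<^sup>2 = 1"
    using hermitian_binary_represents_1[OF assms] by blast
  have "a * b > 0" using assms by simp
  from hermitian_binary_represents_1[OF this this]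
  obtain \<gamma> \<delta> where cd: "\<gamma> \<in> gaussian_rats" "\<delta> \<in> gaussian_rats"
    "of_int (a * b) * (cmod \<gamma>)\<^sup>2 + of_int (a * b) * (cmod \<delta>)\<^sup>2 = 1" by blast
  have 1: "(cmod (cnj \<gamma> * t + r * cnj \<delta>))\<^sup>2 + (cmod (\<delta> * t - r * \<gamma>))\<^sup>2
    = ((cmod \<gamma>)\<^sup>2 + (cmod \<delta>)\<^sup>2) * ((cmod t)\<^sup>2 + (cmod r)\<^sup>2)" for t r
    unfolding cmod_power2 by (simp add: power2_eq_square algebra_simps)
  have 2: "(cmod (of_int a * p * cnj \<alpha> + of_int b * q * cnj \<beta>))\<^sup>2 + of_int (a * b) * (cmod (p * \<beta> - q * \<alpha>))\<^sup>2
    = (of_int a * (cmod \<alpha>)\<^sup>2 + of_int b * (cmod \<beta>)\<^sup>2) * (of_int a * (cmod p)\<^sup>2 + of_int b * (cmod q)\<^sup>2)" for p q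
    unfolding cmod_power2 by (simp add: power2_eq_square algebra_simps)
  have "(cmod (of_int a * p * cnj \<alpha> + of_int b * q * cnj \<beta>))\<^sup>2
    + (cmod (of_int (a * b) * (cnj \<gamma> * (p * \<beta> - q * \<alpha>) + r * cnj \<delta>)))\<^sup>2
    + (cmod (of_int (a * b) * (\<delta> * (p * \<beta> - q * \<alpha>) - r * \<gamma>)))\<^sup>2
    = of_int a * (cmod p)\<^sup>2 + of_int b * (cmod q)\<^sup>2 + of_int (a * b) * (cmod r)\<^sup>2" (is "?l1 + ?l2 + ?l3 = _") for p q r
  proof -
    let ?t = "p * \<beta> - q * \<alpha>" and ?n = "real_of_int (a * b)"
    have n: "cmod (of_int (a * b)) = ?n" using assms by (simp only: norm_of_int) simp
    have "?l2 + ?l3 = ?n\<^sup>2 * ((cmod (cnj \<gamma> * ?t + r * cnj \<delta>))\<^sup>2 + (cmod (\<delta> * ?t - r * \<gamma>))\<^sup>2)"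
    proof -
      have "?l2 = ?n\<^sup>2 * (cmod (cnj \<gamma> * ?t + r * cnj \<delta>))\<^sup>2" "?l3 = ?n\<^sup>2 * (cmod (\<delta> * ?t - r * \<gamma>))\<^sup>2"
        by (simp_all only: norm_mult n power_mult_distrib)
      thus ?thesis by (simp only: distrib_left)
    qed
    also have "\<dots> = (?n * (cmod \<gamma>)\<^sup>2 + ?n * (cmod \<delta>)\<^sup>2) * (?n * ((cmod ?t)\<^sup>2 + (cmod r)\<^sup>2))"
      unfolding 1 by (simp only: power2_eq_square algebra_simps)
    also have "\<dots> = ?n * (cmod ?t)\<^sup>2 + ?n * (cmod r)\<^sup>2" unfolding cd(3) by (simp only: mult_1 distrib_left)
    finally have "?l1 + ?l2 + ?l3 = (?l1 + ?n * (cmod ?t)\<^sup>2) + ?n * (cmod r)\<^sup>2" by linarith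
    thus ?thesis unfolding 2 ab(3) by simp
  qed
  thus ?thesis using ab(1,2) cd(1,2) by blast
qed

text \<open>With \<open>a = A x\<^sup>2 + B y\<^sup>2 + C z\<^sup>2\<close> and \<open>g = A x\<^sup>2 + B y\<^sup>2\<close>, the vectors \<open>(x, y, z)\<close>, \<open>(- B y, A x, 0)\<close>,
  \<open>(C x z, C y z, - g)\<close> diagonalize the form as \<open>a T1\<^sup>2 + b T2\<^sup>2 + C g a T3\<^sup>2\<close> where \<open>b = A B g\<close>. The equation for
  \<open>A B C w\<^sup>2\<close> says that the last two terms are the restriction of a hermitian form \<open>b |q|\<^sup>2 + a b |r|\<^sup>2\<close> to the
  rational plane \<open>q = T2 + i (y0 / b) T3\<close>, \<open>r = \<kappa> T3\<close>.\<close>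

lemma ternary_form_embedding:
  fixes A B C :: nat
  assumes sqf: "squarefree A" "squarefree B" "squarefree C"
  shows "\<exists>V1 V2 V3 :: complex \<times> complex \<times> complex.
    {V1, V2, V3} \<subseteq> gaussian_rats \<times> gaussian_rats \<times> gaussian_rats \<and>
    (\<forall>X Y Z. (norm (X *\<^sub>R V1 + Y *\<^sub>R V2 + Z *\<^sub>R V3))\<^sup>2 = real A * X\<^sup>2 + real B * Y\<^sup>2 + real C * Z\<^sup>2)"
proof -
  obtain x y z :: nat and w s u v :: int where x: "x > 0" and w: "w \<noteq> 0"
    and eq: "int (A * B * C) * w\<^sup>2 = int (A * x\<^sup>2 + B * y\<^sup>2 + C * z\<^sup>2) * s\<^sup>2 + u\<^sup>2 + v\<^sup>2"
    using exists_norm_difference[OF sqf] by blast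
  have pos: "A > 0" "B > 0" "C > 0" using sqf by (metis not_squarefree_0 neq0_conv)+
  define g where "g = A * x\<^sup>2 + B * y\<^sup>2"
  define a where "a = g + C * z\<^sup>2"
  define b where "b = A * B * g"
  have g0: "g > 0" using pos x by (simp add: g_def)
  hence a0: "a > 0" and b0: "b > 0" using pos by (auto simp: a_def b_def)
  obtain \<alpha> \<beta> \<gamma> \<delta> where QI: "\<alpha> \<in> gaussian_rats" "\<beta> \<in> gaussian_rats" "\<gamma> \<in> gaussian_rats" "\<delta> \<in> gaussian_rats"
    and iso: "\<And>p q r. (cmod (of_int (int a) * p * cnj \<alpha> + of_int (int b) * q * cnj \<beta>))\<^sup>2
    + (cmod (of_int (int a * int b) * (cnj \<gamma> * (p * \<beta> - q * \<alpha>) + r * cnj \<delta>)))\<^sup>2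
    + (cmod (of_int (int a * int b) * (\<delta> * (p * \<beta> - q * \<alpha>) - r * \<gamma>)))\<^sup>2
    = of_int (int a) * (cmod p)\<^sup>2 + of_int (int b) * (cmod q)\<^sup>2 + of_int (int a * int b) * (cmod r)\<^sup>2"
    using hermitian_ternary_isometry[of "int a" "int b"] a0 b0 by auto
  define V where "V = (\<lambda>p q r. (of_int (int a) * p * cnj \<alpha> + of_int (int b) * q * cnj \<beta>,
     of_int (int a * int b) * (cnj \<gamma> * (p * \<beta> - q * \<alpha>) + r * cnj \<delta>),
     of_int (int a * int b) * (\<delta> * (p * \<beta> - q * \<alpha>) - r * \<gamma>)))"
  have normV: "(norm (V p q r))\<^sup>2 = real a * (cmod p)\<^sup>2 + real b * (cmod q)\<^sup>2 + real a * real b * (cmod r)\<^sup>2" for p q r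
    using iso[of p q r] by (simp add: V_def norm_Pair)
  have linV: "V (p + p') (q + q') (r + r') = V p q r + V p' q' r'" for p q r p' q' r'
    by (simp add: V_def algebra_simps)
  have scaleV: "V (of_real t * p) (of_real t * q) (of_real t * r) = t *\<^sub>R V p q r" for t p q r
    by (simp add: V_def algebra_simps scaleR_conv_of_real)
  have memV: "V p q r \<in> gaussian_rats \<times> gaussian_rats \<times> gaussian_rats"
    if "p \<in> gaussian_rats" "q \<in> gaussian_rats" "r \<in> gaussian_rats" for p q r
  proof -
    have "of_nat k \<in> gaussian_rats" for k using gaussian_rats_of_real[of "of_nat k"] by simp
    thus ?thesis unfolding V_def using that QI by (auto intro!: gaussian_rats_closed)
  qed
  \<comment> \<open>The solution (s, u, v) scaled by g/w. Then y0^2 + a |b \<kappa>|^2 = a g^2 * A B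
    C, which is b times the required coefficient C g a.\<close>
  define y0 where "y0 = real a * of_int s * real g / of_int w"
  define \<kappa> where "\<kappa> = Complex (of_int u * real g / of_int w / real b) (of_int v * real g / of_int w / real b)"
  define \<phi> where "\<phi> = (\<lambda>t1 t2 t3. V (of_real t1) (Complex t2 (t3 * y0 / real b)) (of_real t3 * \<kappa>))"
  have key: "real b * (y0 / real b)\<^sup>2 + real a * real b * (cmod \<kappa>)\<^sup>2 = real C * real g * real a"
  proof -
    have eqr: "real A * real B * real C * (of_int w)\<^sup>2 = real a * (of_int s)\<^sup>2 + (of_int u)\<^sup>2 + (of_int v)\<^sup>2"
    proof -
      have "real_of_int (int (A * B * C) * w\<^sup>2) = real_of_int (int a * s\<^sup>2 + u\<^sup>2 + v\<^sup>2)"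
        using eq by (simp only: a_def g_def)
      thus ?thesis by simp
    qed
    have W: "(real_of_int w)\<^sup>2 \<noteq> 0" using w by simp
    have "real b * (y0 / real b)\<^sup>2 + real a * real b * (cmod \<kappa>)\<^sup>2
      = (y0\<^sup>2 + real a * ((of_int u * real g / of_int w)\<^sup>2 + (of_int v * real g / of_int w)\<^sup>2)) / real b"
      using b0 unfolding cmod_power2 \<kappa>_def by (simp add: power_divide power2_eq_square field_simps)
    also have "y0\<^sup>2 + real a * ((of_int u * real g / of_int w)\<^sup>2 + (of_int v * real g / of_int w)\<^sup>2)
      = real a * (real g)\<^sup>2 * ((real a * (of_int s)\<^sup>2 + (of_int u)\<^sup>2 + (of_int v)\<^sup>2) / (of_int w)\<^sup>2)"
      unfolding y0_def power_divide power_mult_distrib by (simp add: add_divide_distrib power2_eq_square algebra_simps)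
    also have "\<dots> = real a * (real g)\<^sup>2 * (real A * real B * real C)"
      unfolding eqr[symmetric] using W by simp
    also have "\<dots> / real b = real C * real g * real a"
      using b0 g0 pos by (simp add: b_def power2_eq_square)
    finally show ?thesis .
  qed
  have norm\<phi>: "(norm (\<phi> t1 t2 t3))\<^sup>2 = real a * t1\<^sup>2 + real b * t2\<^sup>2 + real C * real g * real a * t3\<^sup>2" for t1 t2 t3
  proof -
    have "(norm (\<phi> t1 t2 t3))\<^sup>2 = real a * t1\<^sup>2 + real b * (t2\<^sup>2 + (t3 * y0 / real b)\<^sup>2) + real a * real b * (t3\<^sup>2 * (cmod \<kappa>)\<^sup>2)"
      unfolding \<phi>_def normV by (simp add: cmod_power2[of "Complex _ _"] norm_mult power_mult_distrib)
    also have "\<dots> = real a * t1\<^sup>2 + real b * t2\<^sup>2 + (real b * (y0 / real b)\<^sup>2 + real a * real b * (cmod \<kappa>)\<^sup>2) * t3\<^sup>2"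
      by (simp add: algebra_simps power_divide power_mult_distrib)
    finally show ?thesis unfolding key .
  qed
  have lin\<phi>: "\<phi> (t1 + t1') (t2 + t2') (t3 + t3') = \<phi> t1 t2 t3 + \<phi> t1' t2' t3'" for t1 t2 t3 t1' t2' t3'
  proof -
    have "Complex (t2 + t2') ((t3 + t3') * y0 / real b) = Complex t2 (t3 * y0 / real b) + Complex t2' (t3' * y0 / real b)"
      by (simp add: complex_eq_iff add_divide_distrib distrib_right)
    thus ?thesis unfolding \<phi>_def by (simp only: linV[symmetric] of_real_add distrib_right)
  qed
  have scale\<phi>: "\<phi> (t * t1) (t * t2) (t * t3) = t *\<^sub>R \<phi> t1 t2 t3" for t t1 t2 t3
  proof -
    have "Complex (t * t2) (t * t3 * y0 / real b) = of_real t * Complex t2 (t3 * y0 / real b)"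
      by (simp add: complex_eq_iff)
    thus ?thesis unfolding \<phi>_def by (simp only: scaleV[symmetric] of_real_mult mult.assoc)
  qed
  have mem\<phi>: "\<phi> t1 t2 t3 \<in> gaussian_rats \<times> gaussian_rats \<times> gaussian_rats" if "t1 \<in> \<rat>" "t2 \<in> \<rat>" "t3 \<in> \<rat>" for t1 t2 t3
  proof -
    have "y0 \<in> \<rat>" unfolding y0_def by simp
    moreover have "\<kappa> \<in> gaussian_rats" unfolding \<kappa>_def by (intro gaussian_rats_Complex) simp_all
    ultimately show ?thesis unfolding \<phi>_def using that
      by (intro memV gaussian_rats_of_real gaussian_rats_Complex gaussian_rats_closed(3)) simp_all
  qed
  define G where "G = real g * real a"
  \<comment> \<open>Coordinates along the three diagonalizing vectors: the inner products with them
    for the given form, divided by their values a, A B g and C g a.\<close>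
  define T1 T2 T3 where "T1 = (\<lambda>X Y Z. (real A * real x * X + real B * real y * Y + real C * real z * Z) / real a)"
    and "T2 = (\<lambda>X Y (Z::real). (real x * Y - real y * X) / real g)"
    and "T3 = (\<lambda>X Y Z. (real A * real x * real z * X + real B * real y * real z * Y - real g * Z) / G)"
  define W1 W2 W3 where "W1 = \<phi> (T1 1 0 0) (T2 1 0 0) (T3 1 0 0)" and "W2 = \<phi> (T1 0 1 0) (T2 0 1 0) (T3 0 1 0)"
    and "W3 = \<phi> (T1 0 0 1) (T2 0 0 1) (T3 0 0 1)"
  have comb: "X *\<^sub>R W1 + Y *\<^sub>R W2 + Z *\<^sub>R W3 = \<phi> (T1 X Y Z) (T2 X Y Z) (T3 X Y Z)" for X Y Z
  proof -
    have "T1 X Y Z = X * T1 1 0 0 + Y * T1 0 1 0 + Z * T1 0 0 1" "T2 X Y Z = X * T2 1 0 0 + Y * T2 0 1 0 + Z * T2 0 0 1"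
      "T3 X Y Z = X * T3 1 0 0 + Y * T3 0 1 0 + Z * T3 0 0 1"
      unfolding T1_def T2_def T3_def by (simp_all add: add_divide_distrib diff_divide_distrib mult_ac)
    thus ?thesis unfolding W1_def W2_def W3_def by (simp only: lin\<phi> scale\<phi>)
  qed
  have "real a * (T1 X Y Z)\<^sup>2 + real b * (T2 X Y Z)\<^sup>2 + real C * real g * real a * (T3 X Y Z)\<^sup>2
     = real A * X\<^sup>2 + real B * Y\<^sup>2 + real C * Z\<^sup>2" for X Y Z
  proof -
    define A' B' C' x' y' z' where "A' = real A" and "B' = real B" and "C' = real C" and "x' = real x" and "y' = real y" and "z' = real z"
    define g' a' where "g' = real g" and "a' = real a"
    have g': "g' = A' * x'\<^sup>2 + B' * y'\<^sup>2" and a': "a' = g' + C' * z'\<^sup>2" and b': "real b = A' * B' * g'"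
      unfolding g'_def a'_def A'_def B'_def C'_def x'_def y'_def z'_def by (simp_all add: g_def a_def b_def)
    have nz: "g' \<noteq> 0" "a' \<noteq> 0" using g0 a0 by (simp_all add: g'_def a'_def)
    define l1 l2 l3 where "l1 = A' * x' * X + B' * y' * Y + C' * z' * Z" and "l2 = x' * Y - y' * X"
      and "l3 = A' * x' * z' * X + B' * y' * z' * Y - g' * Z"
    have "real a * (T1 X Y Z)\<^sup>2 + real b * (T2 X Y Z)\<^sup>2 + real C * real g * real a * (T3 X Y Z)\<^sup>2
      = a' * (l1 / a')\<^sup>2 + A' * B' * g' * (l2 / g')\<^sup>2 + C' * g' * a' * (l3 / (g' * a'))\<^sup>2"
      unfolding T1_def T2_def T3_def b' G_def l1_def l2_def l3_def A'_def B'_def C'_def x'_def y'_def z'_def g'_def a'_def ..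
    also have "\<dots> = (g' * l1\<^sup>2 + A' * B' * a' * l2\<^sup>2 + C' * l3\<^sup>2) / (g' * a')"
      using nz by (simp add: power_divide power2_eq_square field_simps)
    also have "g' * l1\<^sup>2 + A' * B' * a' * l2\<^sup>2 + C' * l3\<^sup>2 = (g' * a') * (A' * X\<^sup>2 + B' * Y\<^sup>2 + C' * Z\<^sup>2)"
      unfolding l1_def l2_def l3_def a' g' by (simp add: power2_eq_square algebra_simps)
    finally show ?thesis using nz by (simp add: A'_def B'_def C'_def)
  qed
  hence "(norm (X *\<^sub>R W1 + Y *\<^sub>R W2 + Z *\<^sub>R W3))\<^sup>2 = real A * X\<^sup>2 + real B * Y\<^sup>2 + real C * Z\<^sup>2" for X Y Z
    unfolding comb norm\<phi> by simp
  moreover have "{W1, W2, W3} \<subseteq> gaussian_rats \<times> gaussian_rats \<times> gaussian_rats"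
    unfolding W1_def W2_def W3_def T1_def T2_def T3_def G_def by (auto intro!: mem\<phi>)
  ultimately show ?thesis by blast
qed

section \<open>Unimodular lattices and neighbours\<close>

text \<open>A self-dual set is automatically a subgroup.\<close>

definition unimodular_lattice :: "'a::euclidean_space set \<Rightarrow> bool" where
  "unimodular_lattice L \<longleftrightarrow> (\<forall>x. x \<in> L \<longleftrightarrow> (\<forall>y\<in>L. x \<bullet> y \<in> \<int>)) \<and> (\<exists>N>0. \<forall>b\<in>Basis. real N *\<^sub>R b \<in> L)"

lemma unimodular_latticeD:
  assumes "unimodular_lattice L"
  shows "x \<in> L \<Longrightarrow> y \<in> L \<Longrightarrow> x \<bullet> y \<in> \<int>" "(\<And>y. y \<in> L \<Longrightarrow> x \<bullet> y \<in> \<int>) \<Longrightarrow> x \<in> L"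
  using assms unfolding unimodular_lattice_def by blast+

lemma unimodular_lattice_closed:
  assumes "unimodular_lattice L" "x \<in> L" "y \<in> L"
  shows "x + y \<in> L" "x - y \<in> L" "of_int k *\<^sub>R x \<in> L"
  using assms
  by (auto intro!: unimodular_latticeD(2)[OF assms(1)] Ints_add Ints_diff Ints_mult
      simp: inner_add_left inner_diff_left unimodular_latticeD(1)[OF assms(1)])

lemma unimodular_lattice_standard:
  "unimodular_lattice {x :: 'a::euclidean_space. \<forall>b\<in>Basis. x \<bullet> b \<in> \<int>}" (is "unimodular_lattice ?L")
  unfolding unimodular_lattice_def
proof (intro conjI allI)
  have B: "b \<in> ?L" if "b \<in> Basis" for b using that by (auto simp: inner_Basis)
  fix x :: 'a
  show "x \<in> ?L \<longleftrightarrow> (\<forall>y\<in>?L. x \<bullet> y \<in> \<int>)"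
  proof
    assume x: "x \<in> ?L"
    show "\<forall>y\<in>?L. x \<bullet> y \<in> \<int>"
    proof
      fix y assume y: "y \<in> ?L"
      have "x \<bullet> y = (\<Sum>b\<in>Basis. (x \<bullet> b) * (y \<bullet> b))" by (rule euclidean_inner)
      also have "\<dots> \<in> \<int>" using x y by (intro Ints_sum Ints_mult) auto
      finally show "x \<bullet> y \<in> \<int>" .
    qed
  qed (use B in auto)
  show "\<exists>N>0. \<forall>b\<in>Basis. real N *\<^sub>R b \<in> ?L" using B by (intro exI[of _ 1]) simp
qed

text \<open>Kneser's neighbour: the vectors of \<open>K\<close> that are integral against
  \<open>x\<close> are kept and \<open>x\<close> is added. For \<open>x\<close> of prime order
  modulo \<open>K\<close>, the index lost equals the index gained.\<close>

definition neighbour :: "'a::euclidean_space set \<Rightarrow> 'a \<Rightarrow> 'a set" where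
  "neighbour K x = {z + of_int c *\<^sub>R x | z c. z \<in> K \<and> z \<bullet> x \<in> \<int>}"

text \<open>The hard direction is that a vector u dual to the neighbour lies in it. \<open>K\<close>
  is generated by the vectors integral against \<open>x\<close> and one \<open>z2\<close> whose
  product with \<open>x\<close> is 1/p modulo integers; it exists since K is self-dual and x has
  order p modulo K. Subtracting c x, where c = p (u \<bullet> z2), makes u integral against
  \<open>z2\<close> too, so the difference lies in \<open>K\<close>.\<close>

lemma unimodular_neighbour:
  fixes K :: "'a::euclidean_space set"
  assumes K: "unimodular_lattice K" and p: "prime p" and x: "x \<notin> K" "real p *\<^sub>R x \<in> K" "x \<bullet> x \<in> \<int>"
  shows "unimodular_lattice (neighbour K x)"
  unfolding unimodular_lattice_def
proof (intro conjI allI)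
  note K1 = unimodular_latticeD(1)[OF K]
  have zero: "0 \<in> K" by (rule unimodular_latticeD(2)[OF K]) simp
  have xN: "x \<in> neighbour K x"
    unfolding neighbour_def using zero by (intro CollectI exI[of _ 0] exI[of _ 1]) simp
  have KN: "z \<in> neighbour K x" if "z \<in> K" "z \<bullet> x \<in> \<int>" for z
    unfolding neighbour_def using that by (intro CollectI exI[of _ z] exI[of _ 0]) simp
  fix u
  show "u \<in> neighbour K x \<longleftrightarrow> (\<forall>y\<in>neighbour K x. u \<bullet> y \<in> \<int>)"
  proof
    assume "u \<in> neighbour K x"
    then obtain z c where u: "u = z + of_int c *\<^sub>R x" "z \<in> K" "z \<bullet> x \<in> \<int>" unfolding neighbour_def by blast
    show "\<forall>y\<in>neighbour K x. u \<bullet> y \<in> \<int>"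
    proof
      fix y assume "y \<in> neighbour K x"
      then obtain z' c' where y: "y = z' + of_int c' *\<^sub>R x" "z' \<in> K" "z' \<bullet> x \<in> \<int>" unfolding neighbour_def by blast
      have "u \<bullet> y = z \<bullet> z' + of_int c' * (z \<bullet> x) + of_int c * (z' \<bullet> x) + of_int c * of_int c' * (x \<bullet> x)"
        unfolding u(1) y(1) by (simp add: inner_add_left inner_add_right inner_commute[of x z'] algebra_simps)
      also have "\<dots> \<in> \<int>" using u y x(3) K1 by (intro Ints_add Ints_mult) auto
      finally show "u \<bullet> y \<in> \<int>" .
    qed
  next
    assume u: "\<forall>y\<in>neighbour K x. u \<bullet> y \<in> \<int>"
    have p0: "real p > 0" using p by (simp add: prime_gt_0_nat)
    have h: "\<exists>k. z \<bullet> x = of_int k / real p" if "z \<in> K" for z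
    proof -
      have "z \<bullet> (real p *\<^sub>R x) \<in> \<int>" using K1[OF that x(2)] .
      then obtain k where "real p * (z \<bullet> x) = of_int k" by (auto elim: Ints_cases)
      thus ?thesis using p0 by (intro exI[of _ k]) (simp add: field_simps)
    qed
    obtain z1 where z1: "z1 \<in> K" "x \<bullet> z1 \<notin> \<int>" using x(1) unimodular_latticeD(2)[OF K] by blast
    obtain k1 where k1: "z1 \<bullet> x = of_int k1 / real p" using h z1(1) by blast
    have "\<not> int p dvd k1"
    proof
      assume "int p dvd k1"
      then obtain l where "k1 = int p * l" by (elim dvdE)
      hence "x \<bullet> z1 = of_int l" using k1 p0 by (simp add: inner_commute)
      thus False using z1(2) by simp
    qed
    moreover have "prime (int p)" using p by simp
    ultimately have "coprime (int p) k1" by (intro prime_imp_coprime)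
    hence "coprime k1 (int p)" by (simp only: coprime_commute)
    then obtain m where "[k1 * m = 1] (mod int p)" using cong_solve_coprime_int by blast
    hence "int p dvd k1 * m - 1" by (simp only: cong_iff_dvd_diff)
    then obtain j where "k1 * m - 1 = int p * j" by (elim dvdE)
    hence j: "k1 * m = 1 + int p * j" by linarith
    define z2 where "z2 = of_int m *\<^sub>R z1"
    have z2: "z2 \<in> K" unfolding z2_def by (rule unimodular_lattice_closed(3)[OF K z1(1) z1(1)])
    have z2x: "z2 \<bullet> x = 1 / real p + of_int j"
    proof -
      have "z2 \<bullet> x = of_int (k1 * m) / real p" by (simp add: z2_def k1)
      also have "\<dots> = 1 / real p + of_int j" unfolding j using p0 by (simp add: field_simps)
      finally show ?thesis .
    qed
    have "real p *\<^sub>R z2 \<in> neighbour K x"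
    proof (rule KN)
      show "real p *\<^sub>R z2 \<in> K" using unimodular_lattice_closed(3)[OF K z2 z2, of "int p"] by simp
      have "(real p *\<^sub>R z2) \<bullet> x = 1 + real p * of_int j" using p0 by (simp add: z2x distrib_left)
      also have "\<dots> \<in> \<int>" by (intro Ints_add Ints_mult) auto
      finally show "(real p *\<^sub>R z2) \<bullet> x \<in> \<int>" .
    qed
    hence "u \<bullet> (real p *\<^sub>R z2) \<in> \<int>" using u by blast
    then obtain c where c: "real p * (u \<bullet> z2) = of_int c" by (auto elim: Ints_cases)
    have uz2: "u \<bullet> z2 = of_int c / real p" using c p0 by (simp add: field_simps)
    define v where "v = u - of_int c *\<^sub>R x"
    have "v \<in> K"
    proof (rule unimodular_latticeD(2)[OF K])
      fix z assume z: "z \<in> K"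
      obtain k where k: "z \<bullet> x = of_int k / real p" using h z by blast
      define z' where "z' = z - of_int k *\<^sub>R z2"
      have z': "z' \<in> K" unfolding z'_def
        by (rule unimodular_lattice_closed(2)[OF K z unimodular_lattice_closed(3)[OF K z2 z2]])
      have "z' \<bullet> x = - of_int (k * j)" unfolding z'_def by (simp add: inner_diff_left k z2x algebra_simps)
      also have "\<dots> \<in> \<int>" by simp
      finally have "u \<bullet> z' \<in> \<int>" using u KN[OF z'] by blast
      moreover have "v \<bullet> z = u \<bullet> z'"
        unfolding v_def z'_def by (simp add: inner_diff_left inner_diff_right uz2 inner_commute[of x z] k)
      ultimately show "v \<bullet> z \<in> \<int>" by simp
    qed
    moreover have "v \<bullet> x \<in> \<int>"
    proof -
      have "u \<bullet> x \<in> \<int>" using u xN by blast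
      thus ?thesis unfolding v_def using x(3) by (auto simp: inner_diff_left intro!: Ints_diff Ints_mult)
    qed
    moreover have "u = v + of_int c *\<^sub>R x" by (simp add: v_def)
    ultimately show "u \<in> neighbour K x" unfolding neighbour_def by blast
  qed
  obtain N where N: "N > 0" "\<And>b. b \<in> Basis \<Longrightarrow> real N *\<^sub>R b \<in> K" using K unfolding unimodular_lattice_def by blast
  show "\<exists>N>0. \<forall>b\<in>Basis. real N *\<^sub>R b \<in> neighbour K x"
  proof (intro exI[of _ "p * N"] conjI ballI KN)
    show "0 < p * N" using N p by (simp add: prime_gt_0_nat)
    fix b :: 'a assume b: "b \<in> Basis"
    show "real (p * N) *\<^sub>R b \<in> K"
      using unimodular_lattice_closed(3)[OF K N(2)[OF b] N(2)[OF b], of "int p"] by simp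
    have "(real (p * N) *\<^sub>R b) \<bullet> x = (real N *\<^sub>R b) \<bullet> (real p *\<^sub>R x)" by simp
    also have "\<dots> \<in> \<int>" by (rule K1[OF N(2)[OF b] x(2)])
    finally show "(real (p * N) *\<^sub>R b) \<bullet> x \<in> \<int>" .
  qed
qed

lemma Rats_common_denominator:
  assumes "finite S" "\<And>s. s \<in> S \<Longrightarrow> f s \<in> (\<rat> :: real set)"
  shows "\<exists>N>0. \<forall>s\<in>S. real N * f s \<in> \<int>"
  using assms
proof (induction S)
  case (insert s S)
  then obtain N where N: "N > 0" "\<forall>t\<in>S. real N * f t \<in> \<int>" by auto
  obtain a b :: int where ab: "f s = of_int a / of_int b" "b > 0"
    using insert.prems[of s] by (auto elim: Rats_cases')
  have "real (N * nat b) * f t \<in> \<int>" if "t \<in> insert s S" for t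
  proof (cases "t = s")
    case True
    have "real (N * nat b) * f s = of_int (int N * a)" using ab by simp
    also have "\<dots> \<in> \<int>" by (rule Ints_of_int)
    finally show ?thesis using True by simp
  next
    case False
    have "real (N * nat b) * f t = real (nat b) * (real N * f t)" by simp
    also have "\<dots> \<in> \<int>" using N(2) that False Ints_mult[OF Ints_of_nat] by blast
    finally show ?thesis .
  qed
  thus ?case using N(1) ab(2) by (intro exI[of _ "N * nat b"]) auto
qed auto

text \<open>Among the unimodular lattices containing all N x, one is chosen that contains the
  largest number of multiples k x with k < N. If some x is missing, a multiple y of x has prime
  order modulo the lattice. Because X is integral, y has integral norm and the neighbour at y keeps
  every multiple already present, while it gains y.\<close>

lemma integral_family_in_unimodular_lattice:
  fixes X :: "'a::euclidean_space set"
  assumes fin: "finite X" and int: "\<And>x y. x \<in> X \<Longrightarrow> y \<in> X \<Longrightarrow> x \<bullet> y \<in> \<int>"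
    and rat: "\<And>x b. x \<in> X \<Longrightarrow> b \<in> Basis \<Longrightarrow> x \<bullet> b \<in> \<rat>"
  shows "\<exists>L. unimodular_lattice L \<and> X \<subseteq> L"
proof -
  obtain N where N: "N > 0" "\<And>x b. x \<in> X \<Longrightarrow> b \<in> Basis \<Longrightarrow> real N * (x \<bullet> b) \<in> \<int>"
    using Rats_common_denominator[of "X \<times> Basis" "\<lambda>(x, b). x \<bullet> b"] fin rat by auto
  define P where "P = (\<lambda>K :: 'a set. unimodular_lattice K \<and> (\<forall>x\<in>X. real N *\<^sub>R x \<in> K))"
  define S where "S = (\<lambda>K :: 'a set. {(x, k). x \<in> X \<and> k < N \<and> real k *\<^sub>R x \<in> K})"
  have subS: "S K \<subseteq> X \<times> {..<N}" for K unfolding S_def by auto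
  have finS: "finite (S K)" for K by (rule finite_subset[OF subS]) (simp add: fin)
  have "P {x. \<forall>b\<in>Basis. x \<bullet> b \<in> \<int>}" unfolding P_def using unimodular_lattice_standard N by auto
  moreover have "\<forall>K. P K \<longrightarrow> card (S K) < Suc (card (X \<times> {..<N}))"
    using card_mono[OF _ subS] fin by (simp add: less_Suc_eq_le)
  ultimately have "\<exists>K. P K \<and> (\<forall>K'. P K' \<longrightarrow> card (S K') \<le> card (S K))"
    by (rule ex_has_greatest_nat)
  then obtain K where K: "P K" "\<And>K'. P K' \<Longrightarrow> card (S K') \<le> card (S K)" by blast
  have uni: "unimodular_lattice K" and NK: "\<And>x. x \<in> X \<Longrightarrow> real N *\<^sub>R x \<in> K" using K(1) unfolding P_def by auto
  have "X \<subseteq> K"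
  proof (rule ccontr)
    assume "\<not> X \<subseteq> K"
    then obtain x where x: "x \<in> X" "x \<notin> K" by blast
    define n where "n = (LEAST n. n > 0 \<and> real n *\<^sub>R x \<in> K)"
    have n: "n > 0" "real n *\<^sub>R x \<in> K" "n \<le> N"
      using LeastI[of "\<lambda>n. n > 0 \<and> real n *\<^sub>R x \<in> K" N] Least_le[of "\<lambda>n. n > 0 \<and> real n *\<^sub>R x \<in> K" N] NK[OF x(1)] N(1)
      unfolding n_def by auto
    have least: "\<not> (0 < k \<and> real k *\<^sub>R x \<in> K)" if "k < n" for k
      using that not_less_Least unfolding n_def by blast
    have "n \<noteq> 1" using n(2) x(2) by auto
    then obtain p where p: "prime p" "p dvd n" using prime_factor_nat by blast
    then obtain m where m: "n = p * m" by (elim dvdE)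
    have m0: "0 < m" "m < n" using m n(1) prime_gt_1_nat[OF p(1)] by auto
    define y where "y = real m *\<^sub>R x"
    have yK: "y \<notin> K" using least[OF m0(2)] m0(1) unfolding y_def by blast
    have py: "real p *\<^sub>R y \<in> K" using n(2) m by (simp add: y_def)
    have "y \<bullet> y = real m * (real m * (x \<bullet> x))" by (simp add: y_def)
    also have "\<dots> \<in> \<int>" using int[OF x(1) x(1)] by (intro Ints_mult) auto
    finally have yy: "y \<bullet> y \<in> \<int>" .
    define K' where "K' = neighbour K y"
    have keep: "real k *\<^sub>R z \<in> K'" if "z \<in> X" "real k *\<^sub>R z \<in> K" for z k
    proof -
      have "(real k *\<^sub>R z) \<bullet> y = real k * (real m * (z \<bullet> x))" by (simp add: y_def)
      also have "\<dots> \<in> \<int>" using int[OF that(1) x(1)] by (intro Ints_mult) auto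
      finally show ?thesis unfolding K'_def neighbour_def using that(2)
        by (intro CollectI exI[of _ "real k *\<^sub>R z"] exI[of _ 0]) simp
    qed
    have "P K'"
      unfolding P_def using unimodular_neighbour[OF uni p(1) yK py yy] keep NK by (auto simp: K'_def)
    moreover have "S K \<subset> S K'"
    proof
      show "S K \<subseteq> S K'" unfolding S_def using keep by auto
      have "0 \<in> K" by (rule unimodular_latticeD(2)[OF uni]) simp
      hence "y \<in> K'" unfolding K'_def neighbour_def by (intro CollectI exI[of _ 0] exI[of _ 1]) simp
      hence "(x, m) \<in> S K'" using x(1) m0 n(3) by (simp add: S_def y_def)
      moreover have "(x, m) \<notin> S K" using yK by (simp add: S_def y_def)
      ultimately show "S K \<noteq> S K'" by blast
    qed
    hence "card (S K) < card (S K')" by (rule psubset_card_mono[OF finS])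
    ultimately show False using K(2) by fastforce
  qed
  thus ?thesis using uni by blast
qed

section \<open>Reduction of unimodular lattices\<close>

definition proj_compl :: "(nat \<Rightarrow> 'a::euclidean_space) \<Rightarrow> nat \<Rightarrow> 'a \<Rightarrow> 'a" where
  "proj_compl g i y = y - (\<Sum>j<i. ((y \<bullet> g j) / (g j \<bullet> g j)) *\<^sub>R g j)"

lemma proj_compl_0 [simp]: "proj_compl g 0 y = y"
  by (simp add: proj_compl_def)

lemma proj_compl_Suc: "proj_compl g (Suc i) y = proj_compl g i y - ((y \<bullet> g i) / (g i \<bullet> g i)) *\<^sub>R g i"
  by (simp add: proj_compl_def)

lemma proj_compl_cong: "(\<And>j. j < i \<Longrightarrow> g j = h j) \<Longrightarrow> proj_compl g i y = proj_compl h i y"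
  by (simp add: proj_compl_def)

lemma proj_compl_diff: "proj_compl g i (y - c *\<^sub>R z) = proj_compl g i y - c *\<^sub>R proj_compl g i z"
  by (simp add: proj_compl_def inner_diff_left diff_divide_distrib scaleR_diff_left sum_subtractf scaleR_sum_right
      scaleR_diff_right)

text \<open>A Hermite-Korkine-Zolotarev reduced system: \<open>g\<close> is the orthogonalization of the lattice vectors \<open>x\<close>, and
  each \<open>g i\<close> is as short as possible.\<close>

definition hkz_system :: "'a::euclidean_space set \<Rightarrow> (nat \<Rightarrow> 'a) \<Rightarrow> (nat \<Rightarrow> 'a) \<Rightarrow> nat \<Rightarrow> bool" where
  "hkz_system L g x k \<longleftrightarrow> (\<forall>i<k. x i \<in> L \<and> g i = proj_compl g i (x i) \<and> g i \<noteq> 0 \<and>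
     (\<forall>y\<in>L. proj_compl g i y \<noteq> 0 \<longrightarrow> g i \<bullet> g i \<le> proj_compl g i y \<bullet> proj_compl g i y))"

lemma hkz_systemD:
  assumes "hkz_system L g x k" "i < k"
  shows "x i \<in> L" "g i = proj_compl g i (x i)" "g i \<noteq> 0"
    "y \<in> L \<Longrightarrow> proj_compl g i y \<noteq> 0 \<Longrightarrow> g i \<bullet> g i \<le> proj_compl g i y \<bullet> proj_compl g i y"
  using assms unfolding hkz_system_def by blast+

lemma hkz_system_mono: "hkz_system L g x k \<Longrightarrow> m \<le> k \<Longrightarrow> hkz_system L g x m"
  unfolding hkz_system_def by (meson less_le_trans)

lemma proj_compl_orthogonal:
  assumes orth: "\<And>i j. i < k \<Longrightarrow> j < k \<Longrightarrow> i \<noteq> j \<Longrightarrow> g i \<bullet> g j = 0" and nz: "\<And>i. i < k \<Longrightarrow> g i \<noteq> 0" and i: "i < k"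
  shows "proj_compl g k y \<bullet> g i = 0"
proof -
  have "(\<Sum>j<k. (y \<bullet> g j / (g j \<bullet> g j)) * (g j \<bullet> g i)) = (\<Sum>j<k. if j = i then y \<bullet> g i else 0)"
    by (rule sum.cong) (use orth nz i in auto)
  also have "\<dots> = y \<bullet> g i" using i by simp
  finally show ?thesis by (simp add: proj_compl_def inner_diff_left inner_sum_left)
qed

lemma hkz_orthogonal:
  assumes "hkz_system L g x k" "i < k" "j < k" "i \<noteq> j"
  shows "g i \<bullet> g j = 0"
  using assms
proof (induction k arbitrary: i j)
  case (Suc k)
  have sys: "hkz_system L g x k" by (rule hkz_system_mono[OF Suc.prems(1)]) simp
  have *: "g k \<bullet> g l = 0" if "l < k" for l
  proof -
    have "g k = proj_compl g k (x k)" using hkz_systemD(2)[OF Suc.prems(1)] by simp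
    also have "\<dots> \<bullet> g l = 0"
      by (rule proj_compl_orthogonal) (use Suc.IH[OF sys] hkz_systemD(3)[OF sys] that in auto)
    finally show ?thesis .
  qed
  show ?case using Suc.prems Suc.IH[OF sys] *[of i] *[of j]
    by (cases "i = k"; cases "j = k") (auto simp: inner_commute)
qed simp

lemma hkz_proj_compl_orthogonal:
  assumes "hkz_system L g x k" "i < m" "m \<le> k"
  shows "proj_compl g m y \<bullet> g i = 0"
  by (rule proj_compl_orthogonal) (use hkz_orthogonal[OF assms(1)] hkz_systemD(3)[OF assms(1)] assms in auto)

lemma hkz_norm_split:
  assumes "hkz_system L g x k" "i < k"
  shows "proj_compl g i y \<bullet> proj_compl g i y
    = proj_compl g (Suc i) y \<bullet> proj_compl g (Suc i) y + (y \<bullet> g i)\<^sup>2 / (g i \<bullet> g i)"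
proof -
  define c where "c = (y \<bullet> g i) / (g i \<bullet> g i)"
  have e: "proj_compl g i y = proj_compl g (Suc i) y + c *\<^sub>R g i" by (simp add: proj_compl_Suc c_def)
  have o: "proj_compl g (Suc i) y \<bullet> g i = 0" using hkz_proj_compl_orthogonal[OF assms(1), of i "Suc i"] assms(2) by simp
  have "proj_compl g i y \<bullet> proj_compl g i y = proj_compl g (Suc i) y \<bullet> proj_compl g (Suc i) y + c * c * (g i \<bullet> g i)"
    unfolding e using o by (simp add: inner_add_left inner_add_right inner_commute[of "g i" "proj_compl g (Suc i) y"])
  moreover have "c * c * (g i \<bullet> g i) = (y \<bullet> g i)\<^sup>2 / (g i \<bullet> g i)"
    using hkz_systemD(3)[OF assms] by (simp add: c_def power2_eq_square)
  ultimately show ?thesis by simp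
qed

lemma hkz_inner_x:
  assumes "hkz_system L g x k" "i < k"
  shows "x i \<bullet> g i = g i \<bullet> g i" "proj_compl g (Suc i) (x i) = 0"
proof -
  have "x i \<bullet> g i = proj_compl g i (x i) \<bullet> g i + (\<Sum>j<i. ((x i \<bullet> g j) / (g j \<bullet> g j)) * (g j \<bullet> g i))"
    by (simp add: proj_compl_def inner_diff_left inner_sum_left)
  hence "x i \<bullet> g i = g i \<bullet> g i + (\<Sum>j<i. ((x i \<bullet> g j) / (g j \<bullet> g j)) * (g j \<bullet> g i))"
    by (simp only: hkz_systemD(2)[OF assms, symmetric])
  also have "(\<Sum>j<i. ((x i \<bullet> g j) / (g j \<bullet> g j)) * (g j \<bullet> g i)) = 0"
    using hkz_orthogonal[OF assms(1)] assms(2) by (intro sum.neutral) auto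
  finally show 1: "x i \<bullet> g i = g i \<bullet> g i" by simp
  show "proj_compl g (Suc i) (x i) = 0"
    unfolding proj_compl_Suc 1 hkz_systemD(2)[OF assms, symmetric] using hkz_systemD(3)[OF assms] by simp
qed

text \<open>Subtracting a multiple of \<open>x i\<close> does not change the projection away from \<open>g 0, \<dots>, g i\<close>, so the
  coefficient at \<open>g i\<close> may be assumed to be at most \<open>1/2\<close>.\<close>

lemma hkz_size_reduce:
  assumes L: "unimodular_lattice L" and sys: "hkz_system L g x k" and i: "i < k" and y: "y \<in> L"
  obtains y' m where "y' \<in> L" "y' = y - of_int m *\<^sub>R x i" "proj_compl g (Suc i) y' = proj_compl g (Suc i) y"
    "\<bar>y' \<bullet> g i\<bar> \<le> (g i \<bullet> g i) / 2"
proof -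
  define m where "m = round ((y \<bullet> g i) / (g i \<bullet> g i))"
  define y' where "y' = y - of_int m *\<^sub>R x i"
  have d: "g i \<bullet> g i > 0" using hkz_systemD(3)[OF sys i] by simp
  have xi: "x i \<in> L" by (rule hkz_systemD(1)[OF sys i])
  have y'L: "y' \<in> L" unfolding y'_def
    by (rule unimodular_lattice_closed(2)[OF L y unimodular_lattice_closed(3)[OF L xi xi]])
  have p: "proj_compl g (Suc i) y' = proj_compl g (Suc i) y"
    unfolding y'_def proj_compl_diff hkz_inner_x(2)[OF sys i] by simp
  have "y' \<bullet> g i = ((y \<bullet> g i) / (g i \<bullet> g i) - of_int m) * (g i \<bullet> g i)"
    using d by (simp add: y'_def inner_diff_left hkz_inner_x(1)[OF sys i] left_diff_distrib)
  moreover have "\<bar>(y \<bullet> g i) / (g i \<bullet> g i) - of_int m\<bar> \<le> 1 / 2"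
    unfolding m_def using of_int_round_abs_le[of "(y \<bullet> g i) / (g i \<bullet> g i)"] by (simp add: abs_minus_commute)
  ultimately have "\<bar>y' \<bullet> g i\<bar> \<le> 1 / 2 * (g i \<bullet> g i)"
    using d by (simp only: abs_mult) (simp add: mult_right_mono)
  thus ?thesis using that[OF y'L y'_def p] by simp
qed

text \<open>Reducing \<open>x (Suc i)\<close> against \<open>g i\<close> gives a lattice vector
  whose projection has squared length at most that of \<open>g (Suc i)\<close> plus a quarter of
  that of \<open>g i\<close>; minimality of \<open>g i\<close> bounds it from below.\<close>

lemma hkz_three_quarters:
  assumes L: "unimodular_lattice L" and sys: "hkz_system L g x k" and i: "Suc i < k"
  shows "g (Suc i) \<bullet> g (Suc i) \<ge> 3 / 4 * (g i \<bullet> g i)"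
proof -
  have i': "i < k" using i by simp
  obtain y' m where y': "y' \<in> L" "proj_compl g (Suc i) y' = proj_compl g (Suc i) (x (Suc i))" "\<bar>y' \<bullet> g i\<bar> \<le> (g i \<bullet> g i) / 2"
    using hkz_size_reduce[OF L sys i' hkz_systemD(1)[OF sys i]] by metis
  have d: "g i \<bullet> g i > 0" using hkz_systemD(3)[OF sys i'] by simp
  have g1: "proj_compl g (Suc i) y' = g (Suc i)" using y'(2) hkz_systemD(2)[OF sys i] by simp
  have split: "proj_compl g i y' \<bullet> proj_compl g i y' = g (Suc i) \<bullet> g (Suc i) + (y' \<bullet> g i)\<^sup>2 / (g i \<bullet> g i)"
    using hkz_norm_split[OF sys i', of y'] unfolding g1 .
  have "g (Suc i) \<bullet> g (Suc i) > 0" using hkz_systemD(3)[OF sys i] by simp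
  moreover have "(y' \<bullet> g i)\<^sup>2 / (g i \<bullet> g i) \<ge> 0" using d by simp
  ultimately have "proj_compl g i y' \<bullet> proj_compl g i y' \<noteq> 0" using split by linarith
  hence "proj_compl g i y' \<noteq> 0" by auto
  hence "g i \<bullet> g i \<le> g (Suc i) \<bullet> g (Suc i) + (y' \<bullet> g i)\<^sup>2 / (g i \<bullet> g i)"
    using hkz_systemD(4)[OF sys i' y'(1)] split by simp
  moreover have "(y' \<bullet> g i)\<^sup>2 / (g i \<bullet> g i) \<le> (g i \<bullet> g i) / 4"
  proof -
    have "\<bar>y' \<bullet> g i\<bar>\<^sup>2 \<le> ((g i \<bullet> g i) / 2)\<^sup>2" using y'(3) by (intro power_mono) auto
    thus ?thesis using d by (simp add: power2_eq_square field_simps)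
  qed
  ultimately show ?thesis by linarith
qed

text \<open>Rationality of the \<open>g i\<close> is carried along because it gives the squared
  lengths of all projected lattice vectors a common denominator, so a shortest nonzero projection
  exists by well-ordering. That some projection is nonzero is a dimension count.\<close>

lemma hkz_extend:
  fixes L :: "'a::euclidean_space set"
  assumes L: "unimodular_lattice L" and sys: "hkz_system L g x k" and k: "k < DIM('a)"
    and rat: "\<And>i b. i < k \<Longrightarrow> b \<in> Basis \<Longrightarrow> g i \<bullet> b \<in> \<rat>"
  shows "\<exists>g' x'. hkz_system L g' x' (Suc k) \<and> (\<forall>i<Suc k. \<forall>b\<in>Basis. g' i \<bullet> b \<in> \<rat>)"
proof -
  obtain N where N: "N > 0" "\<And>b. b \<in> Basis \<Longrightarrow> real N *\<^sub>R b \<in> L" using L unfolding unimodular_lattice_def by blast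
  have yb: "real N * (y \<bullet> b) \<in> \<int>" if "y \<in> L" "b \<in> Basis" for y b
    using unimodular_latticeD(1)[OF L that(1) N(2)[OF that(2)]] by simp
  have innerq: "u \<bullet> v \<in> \<rat>" if "\<And>b. b \<in> Basis \<Longrightarrow> u \<bullet> b \<in> \<rat>" "\<And>b. b \<in> Basis \<Longrightarrow> v \<bullet> b \<in> \<rat>" for u v :: 'a
    unfolding euclidean_inner[of u v] using that by (intro Rats_sum Rats_mult) auto
  have Lq: "y \<bullet> b \<in> \<rat>" if "y \<in> L" "b \<in> Basis" for y b
  proof -
    have "real N * (y \<bullet> b) / real N \<in> \<rat>" using yb[OF that] Ints_subset_Rats by (intro Rats_divide) auto
    thus ?thesis using N(1) by simp
  qed
  have gden: "\<exists>M>0. \<forall>y\<in>L. real M * (y \<bullet> g i) \<in> \<int>" if i: "i < k" for i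
  proof -
    obtain M where M: "M > 0" "\<forall>b\<in>Basis. real M * (g i \<bullet> b) \<in> \<int>"
      using Rats_common_denominator[of Basis "\<lambda>b. g i \<bullet> b"] rat[OF i] by auto
    have "real (M * N) * (y \<bullet> g i) \<in> \<int>" if "y \<in> L" for y
    proof -
      have "real (M * N) * (y \<bullet> g i) = (\<Sum>b\<in>Basis. (real N * (y \<bullet> b)) * (real M * (g i \<bullet> b)))"
        unfolding euclidean_inner[of y "g i"] by (simp add: sum_distrib_left mult_ac)
      also have "\<dots> \<in> \<int>" using M(2) by (intro Ints_sum Ints_mult[OF yb[OF that]]) auto
      finally show ?thesis .
    qed
    thus ?thesis using M(1) N(1) by (intro exI[of _ "M * N"]) auto
  qed
  have den: "\<exists>M>0. \<forall>y\<in>L. real M * (proj_compl g i y \<bullet> proj_compl g i y) \<in> \<int>" if "i \<le> k" for i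
    using that
  proof (induction i)
    case 0
    show ?case using unimodular_latticeD(1)[OF L] by (intro exI[of _ 1]) auto
  next
    case (Suc i)
    then obtain M where M: "M > 0" "\<And>y. y \<in> L \<Longrightarrow> real M * (proj_compl g i y \<bullet> proj_compl g i y) \<in> \<int>" by auto
    have i: "i < k" using Suc.prems by simp
    obtain M1 where M1: "M1 > 0" "\<And>y. y \<in> L \<Longrightarrow> real M1 * (y \<bullet> g i) \<in> \<int>" using gden[OF i] by blast
    have "inverse (g i \<bullet> g i) \<in> \<rat>" using innerq rat[OF i] by (intro Rats_inverse) auto
    then obtain M2 where M2: "M2 > 0" "real M2 * inverse (g i \<bullet> g i) \<in> \<int>"
      using Rats_common_denominator[of "{()}" "\<lambda>_. inverse (g i \<bullet> g i)"] by auto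
    show ?case
    proof (intro exI[of _ "M * (M1 * M1 * M2)"] conjI ballI)
      fix y assume y: "y \<in> L"
      have "real (M * (M1 * M1 * M2)) * (proj_compl g (Suc i) y \<bullet> proj_compl g (Suc i) y)
        = real (M1 * M1 * M2) * (real M * (proj_compl g i y \<bullet> proj_compl g i y))
          - real M * ((real M1 * (y \<bullet> g i)) * (real M1 * (y \<bullet> g i)) * (real M2 * inverse (g i \<bullet> g i)))"
        unfolding hkz_norm_split[OF sys i, of y] by (simp add: divide_inverse power2_eq_square algebra_simps)
      also have "\<dots> \<in> \<int>"
        by (rule Ints_diff[OF Ints_mult[OF Ints_of_nat M(2)[OF y]]
              Ints_mult[OF Ints_of_nat Ints_mult[OF Ints_mult[OF M1(2)[OF y] M1(2)[OF y]] M2(2)]]])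
      finally show "real (M * (M1 * M1 * M2)) * (proj_compl g (Suc i) y \<bullet> proj_compl g (Suc i) y) \<in> \<int>" .
    qed (use M(1) M1(1) M2(1) in simp)
  qed
  obtain M where M: "M > 0" "\<And>y. y \<in> L \<Longrightarrow> real M * (proj_compl g k y \<bullet> proj_compl g k y) \<in> \<int>" using den[of k] by auto
  have "\<exists>y. y \<in> L \<and> proj_compl g k y \<noteq> 0"
  proof (rule ccontr)
    assume no: "\<not> ?thesis"
    have "b \<in> span (g ` {..<k})" if b: "b \<in> Basis" for b
    proof -
      have "proj_compl g k (real N *\<^sub>R b) = 0" using no N(2)[OF b] by blast
      hence "real N *\<^sub>R b = (\<Sum>j<k. ((real N *\<^sub>R b \<bullet> g j) / (g j \<bullet> g j)) *\<^sub>R g j)"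
        unfolding proj_compl_def by (simp only: right_minus_eq)
      also have "\<dots> \<in> span (g ` {..<k})" by (intro span_sum span_scale span_base) auto
      finally have "(1 / real N) *\<^sub>R (real N *\<^sub>R b) \<in> span (g ` {..<k})" by (rule span_scale)
      thus ?thesis using N(1) by simp
    qed
    hence "span Basis \<subseteq> span (g ` {..<k})" by (intro span_minimal) auto
    hence "DIM('a) \<le> card (g ` {..<k})"
      using dim_le_card[of "UNIV :: 'a set" "g ` {..<k}"] by (simp add: dim_UNIV)
    also have "\<dots> \<le> k" using card_image_le[of "{..<k}" g] by simp
    finally show False using k by simp
  qed
  then obtain y where y: "y \<in> L" "proj_compl g k y \<noteq> 0"
    and ymin: "\<And>z. z \<in> L \<Longrightarrow> proj_compl g k z \<noteq> 0 \<Longrightarrow>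
      nat \<lfloor>real M * (proj_compl g k y \<bullet> proj_compl g k y)\<rfloor> \<le> nat \<lfloor>real M * (proj_compl g k z \<bullet> proj_compl g k z)\<rfloor>"
    using ex_has_least_nat[of "\<lambda>y. y \<in> L \<and> proj_compl g k y \<noteq> 0" _ "\<lambda>y. nat \<lfloor>real M * (proj_compl g k y \<bullet> proj_compl g k y)\<rfloor>"]
    by blast
  have min: "proj_compl g k y \<bullet> proj_compl g k y \<le> proj_compl g k z \<bullet> proj_compl g k z" if "z \<in> L" "proj_compl g k z \<noteq> 0" for z
  proof -
    have fl: "real (nat \<lfloor>real M * (proj_compl g k t \<bullet> proj_compl g k t)\<rfloor>) = real M * (proj_compl g k t \<bullet> proj_compl g k t)" if "t \<in> L" for t
      using M(2)[OF that] by (auto elim!: Ints_cases)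
    have "real M * (proj_compl g k y \<bullet> proj_compl g k y) \<le> real M * (proj_compl g k z \<bullet> proj_compl g k z)"
      using ymin[OF that] fl[OF y(1)] fl[OF that(1)] by linarith
    thus ?thesis using M(1) by simp
  qed
  define g' where "g' = g(k := proj_compl g k y)"
  define x' where "x' = x(k := y)"
  have pc: "proj_compl g' i z = proj_compl g i z" if "i \<le> k" for i z
    by (rule proj_compl_cong) (use that in \<open>auto simp: g'_def\<close>)
  have "hkz_system L g' x' (Suc k)"
    unfolding hkz_system_def
  proof (intro allI impI)
    fix i assume i: "i < Suc k"
    show "x' i \<in> L \<and> g' i = proj_compl g' i (x' i) \<and> g' i \<noteq> 0 \<and>
       (\<forall>y\<in>L. proj_compl g' i y \<noteq> 0 \<longrightarrow> g' i \<bullet> g' i \<le> proj_compl g' i y \<bullet> proj_compl g' i y)"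
    proof (cases "i = k")
      case True
      thus ?thesis using y min pc[of k] by (simp add: g'_def x'_def)
    next
      case False
      hence "i < k" using i by simp
      hence pci: "proj_compl g' i z = proj_compl g i z" for z by (intro pc) simp
      have gx: "g' i = g i" "x' i = x i" using False by (simp_all add: g'_def x'_def)
      show ?thesis unfolding pci gx using sys[unfolded hkz_system_def] \<open>i < k\<close> by blast
    qed
  qed
  moreover have "g' i \<bullet> b \<in> \<rat>" if "i < Suc k" "b \<in> Basis" for i b
  proof (cases "i = k")
    case True
    have "proj_compl g k y \<bullet> b = y \<bullet> b - (\<Sum>j<k. ((y \<bullet> g j) / (g j \<bullet> g j)) * (g j \<bullet> b))"
      by (simp add: proj_compl_def inner_diff_left inner_sum_left)
    also have "\<dots> \<in> \<rat>"
    proof (intro Rats_diff Rats_sum Rats_mult Rats_divide)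
      fix j assume "j \<in> {..<k}"
      hence gj: "\<And>c. c \<in> Basis \<Longrightarrow> g j \<bullet> c \<in> \<rat>" using rat by simp
      show "y \<bullet> g j \<in> \<rat>" "g j \<bullet> g j \<in> \<rat>" "g j \<bullet> b \<in> \<rat>"
        using innerq[OF Lq[OF y(1)] gj] innerq[OF gj gj] gj[OF that(2)] by simp_all
    qed (rule Lq[OF y(1) that(2)])
    finally show ?thesis using True by (simp add: g'_def)
  qed (use that rat in \<open>simp add: g'_def\<close>)
  ultimately show ?thesis by blast
qed

lemma hkz_exists:
  fixes L :: "'a::euclidean_space set"
  assumes L: "unimodular_lattice L"
  obtains g x where "hkz_system L g x DIM('a)"
proof -
  have "\<exists>g x. hkz_system L g x k \<and> (\<forall>i<k. \<forall>b\<in>Basis. g i \<bullet> b \<in> \<rat>)" if "k \<le> DIM('a)" for k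
    using that
  proof (induction k)
    case 0
    show ?case by (simp add: hkz_system_def)
  next
    case (Suc k)
    then obtain g x where gx: "hkz_system L g x k" "\<forall>i<k. \<forall>b\<in>Basis. g i \<bullet> b \<in> \<rat>" by auto
    have k: "k < DIM('a)" using Suc.prems by simp
    show ?case by (rule hkz_extend[OF L gx(1) k]) (use gx(2) in auto)
  qed
  from this[OF order_refl] show ?thesis using that by metis
qed

lemma hkz_proj_compl_DIM:
  fixes L :: "'a::euclidean_space set"
  assumes sys: "hkz_system L g x DIM('a)"
  shows "proj_compl g DIM('a) y = 0"
proof -
  let ?n = "DIM('a)"
  have inj: "inj_on g {..<?n}"
  proof (rule inj_onI)
    fix i j assume ij: "i \<in> {..<?n}" "j \<in> {..<?n}" "g i = g j"
    show "i = j"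
    proof (rule ccontr)
      assume "i \<noteq> j"
      hence "g i \<bullet> g i = 0" using hkz_orthogonal[OF sys, of i j] ij by simp
      thus False using hkz_systemD(3)[OF sys, of i] ij by simp
    qed
  qed
  have "pairwise orthogonal (g ` {..<?n})"
    unfolding pairwise_image pairwise_def using hkz_orthogonal[OF sys] by (auto simp: orthogonal_def)
  moreover have "0 \<notin> g ` {..<?n}" using hkz_systemD(3)[OF sys] by force
  ultimately have "independent (g ` {..<?n})" by (rule pairwise_orthogonal_independent)
  moreover have "card (g ` {..<?n}) = ?n" using card_image[OF inj] by simp
  ultimately have "span (g ` {..<?n}) = UNIV"
    using card_ge_dim_independent[of "g ` {..<?n}" UNIV] by (auto simp: dim_UNIV)
  hence "proj_compl g ?n y \<in> span (g ` {..<?n})" by simp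
  moreover have "orthogonal (proj_compl g ?n y) z" if "z \<in> g ` {..<?n}" for z
    using that hkz_proj_compl_orthogonal[OF sys, of _ ?n y] by (auto simp: orthogonal_def)
  ultimately have "orthogonal (proj_compl g ?n y) (proj_compl g ?n y)"
    by (intro orthogonal_to_span[of "proj_compl g ?n y" "g ` {..<?n}"]) auto
  thus ?thesis by (simp add: orthogonal_self)
qed

text \<open>By self-duality it suffices that \<open>y \<bullet> g n\<close> is an integral multiple
  of \<open>g n \<bullet> g n\<close> for every y in L. After reduction by a multiple of
  \<open>x n\<close>, y projects to c times \<open>g n\<close> with |c| <= 1/2; this is shorter than
  the minimum, hence zero.\<close>

lemma hkz_last_dual:
  fixes L :: "'a::euclidean_space set"
  assumes L: "unimodular_lattice L" and sys: "hkz_system L g x DIM('a)" and n: "DIM('a) = Suc n"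
  shows "(1 / (g n \<bullet> g n)) *\<^sub>R g n \<in> L"
proof (rule unimodular_latticeD(2)[OF L])
  fix y assume y: "y \<in> L"
  have nD: "n < DIM('a)" using n by simp
  have d: "g n \<bullet> g n > 0" using hkz_systemD(3)[OF sys nD] by simp
  obtain y' m where y': "y' \<in> L" "y' = y - of_int m *\<^sub>R x n" "\<bar>y' \<bullet> g n\<bar> \<le> (g n \<bullet> g n) / 2"
    using hkz_size_reduce[OF L sys nD y] by metis
  have "proj_compl g (Suc n) y' = 0" using hkz_proj_compl_DIM[OF sys] n by simp
  hence split: "proj_compl g n y' \<bullet> proj_compl g n y' = (y' \<bullet> g n)\<^sup>2 / (g n \<bullet> g n)"
    using hkz_norm_split[OF sys nD, of y'] by simp
  have "proj_compl g n y' = 0"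
  proof (rule ccontr)
    assume "proj_compl g n y' \<noteq> 0"
    hence "g n \<bullet> g n \<le> (y' \<bullet> g n)\<^sup>2 / (g n \<bullet> g n)" using hkz_systemD(4)[OF sys nD y'(1)] split by simp
    hence "(g n \<bullet> g n)\<^sup>2 \<le> (y' \<bullet> g n)\<^sup>2" using d by (simp add: power2_eq_square field_simps)
    also have "\<bar>y' \<bullet> g n\<bar>\<^sup>2 \<le> ((g n \<bullet> g n) / 2)\<^sup>2" using y'(3) by (intro power_mono) auto
    hence "(y' \<bullet> g n)\<^sup>2 \<le> ((g n \<bullet> g n) / 2)\<^sup>2" by simp
    finally show False using d by (simp add: power_divide)
  qed
  hence "y' \<bullet> g n = 0" using split d by simp
  hence "y \<bullet> g n = of_int m * (g n \<bullet> g n)"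
    using y'(2) by (simp add: inner_diff_left hkz_inner_x(1)[OF sys nD])
  thus "(1 / (g n \<bullet> g n)) *\<^sub>R g n \<bullet> y \<in> \<int>" using d by (simp add: inner_commute[of _ y])
qed

text \<open>A unit vector in a unimodular lattice splits off as an orthogonal summand: the
  coefficients of the projection are integers. So the projections stay in the lattice.\<close>

lemma hkz_unit_prefix:
  assumes L: "unimodular_lattice L" and sys: "hkz_system L g x k" and j: "j \<le> k"
    and unit: "\<And>i. i < j \<Longrightarrow> g i \<bullet> g i = 1"
  shows "i < j \<Longrightarrow> g i \<in> L" "y \<in> L \<Longrightarrow> proj_compl g j y \<in> L"
proof -
  have *: "(\<forall>i<m. g i \<in> L) \<and> (\<forall>y\<in>L. proj_compl g m y \<in> L)" if "m \<le> j" for m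
    using that
  proof (induction m)
    case (Suc m)
    have mk: "m < k" using Suc.prems j by simp
    have IH: "\<forall>i<m. g i \<in> L" "\<And>y. y \<in> L \<Longrightarrow> proj_compl g m y \<in> L" using Suc by auto
    have gm: "g m \<in> L" using IH(2)[OF hkz_systemD(1)[OF sys mk]] hkz_systemD(2)[OF sys mk] by simp
    have "proj_compl g (Suc m) y \<in> L" if y: "y \<in> L" for y
    proof -
      obtain c where "y \<bullet> g m = of_int c" using unimodular_latticeD(1)[OF L y gm] by (auto elim: Ints_cases)
      hence "proj_compl g (Suc m) y = proj_compl g m y - of_int c *\<^sub>R g m"
        using unit[of m] Suc.prems by (simp add: proj_compl_Suc)
      thus ?thesis
        using unimodular_lattice_closed(2)[OF L IH(2)[OF y] unimodular_lattice_closed(3)[OF L gm gm]] by simp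
    qed
    thus ?case using IH(1) gm less_Suc_eq by auto
  qed simp
  show "i < j \<Longrightarrow> g i \<in> L" "y \<in> L \<Longrightarrow> proj_compl g j y \<in> L" using *[of j] by auto
qed

text \<open>The first vectors of a reduced system are orthonormal. If the system were not orthonormal, the first
  other vector \<open>g j\<close> would have norm at least 2; since \<open>g 5 / (g 5 \<bullet> g 5)\<close> is a lattice vector, it would follow that
  \<open>g 5 \<bullet> g 5 \<le> 1/2\<close>. This contradicts the lower bounds for the norms of the \<open>g i\<close>, which for \<open>j = 0\<close> have to be
  improved by the covering radius of the hexagonal lattice.\<close>

theorem unimodular_lattice_dim_6:
  fixes L :: "'a::euclidean_space set"
  assumes L: "unimodular_lattice L" and dim: "DIM('a) = 6"
  shows "\<exists>e. (\<forall>k<6. e k \<in> L) \<and> (\<forall>x y. x \<bullet> y = (\<Sum>k<(6::nat). (x \<bullet> e k) * (y \<bullet> e k)))"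
proof -
  obtain g x where sysD: "hkz_system L g x DIM('a)" using hkz_exists[OF L] by blast
  hence sys: "hkz_system L g x 6" using dim by simp
  define d where "d = (\<lambda>i. g i \<bullet> g i)"
  note orth = hkz_orthogonal[OF sys]
  have dpos: "d i > 0" if "i < 6" for i using hkz_systemD(3)[OF sys that] by (simp add: d_def)
  have d34: "d (Suc i) \<ge> 3 / 4 * d i" if "Suc i < 6" for i
    using hkz_three_quarters[OF L sys that] by (simp add: d_def)
  define w where "w = (1 / d 5) *\<^sub>R g 5"
  have wL: "w \<in> L" using hkz_last_dual[OF L sysD, of 5] dim by (simp add: w_def d_def)
  have ww: "w \<bullet> w = 1 / d 5" using dpos[of 5] by (simp add: w_def d_def)
  have int: "z \<bullet> z \<in> \<int>" if "z \<in> L" for z using unimodular_latticeD(1)[OF L that that] .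
  have all1: "\<forall>i<6. d i = 1"
  proof (rule ccontr)
    assume "\<not> ?thesis"
    hence ex: "\<exists>i. i < 6 \<and> d i \<noteq> 1" by blast
    define j where "j = (LEAST i. i < 6 \<and> d i \<noteq> 1)"
    have j: "j < 6" "d j \<noteq> 1" using LeastI_ex[OF ex] by (auto simp: j_def)
    have jl: "d i = 1" if "i < j" for i using not_less_Least[of i "\<lambda>i. i < 6 \<and> d i \<noteq> 1"] that j(1) unfolding j_def by auto
    have unit: "g i \<bullet> g i = 1" if "i < j" for i using jl[OF that] by (simp add: d_def)
    have j6: "j \<le> 6" using j by simp
    have "g j \<in> L" using hkz_unit_prefix(2)[OF L sys j6 unit hkz_systemD(1)[OF sys j(1)]] hkz_systemD(2)[OF sys j(1)] by simp
    hence "d j \<in> \<int>" unfolding d_def by (rule int)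
    hence dj: "d j \<ge> 2" using dpos[OF j(1)] j(2) by (auto elim!: Ints_cases)
    \<comment> \<open>\<open>w\<close> is orthogonal to the earlier \<open>g i\<close>, so the
      minimality of \<open>g j\<close> applies to \<open>w\<close> itself.\<close>
    have "proj_compl g j w = w"
    proof -
      have "(\<Sum>i<j. ((w \<bullet> g i) / (g i \<bullet> g i)) *\<^sub>R g i) = 0"
        using orth[of 5] j(1) by (intro sum.neutral) (auto simp: w_def)
      thus ?thesis by (simp add: proj_compl_def)
    qed
    moreover have "w \<noteq> 0" using dpos[of 5] hkz_systemD(3)[OF sys, of 5] by (simp add: w_def)
    ultimately have "d j \<le> 1 / d 5" using hkz_systemD(4)[OF sys j(1) wL] ww by (simp add: d_def)
    hence "2 \<le> 1 / d 5" using dj by linarith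
    hence d5: "d 5 \<le> 1 / 2" using dpos[of 5] by (simp add: field_simps)
    have c: "d 1 \<ge> 3 / 4 * d 0" "d 2 \<ge> 3 / 4 * d 1" "d 3 \<ge> 3 / 4 * d 2" "d 4 \<ge> 3 / 4 * d 3" "d 5 \<ge> 3 / 4 * d 4"
      using d34[of 0] d34[of 1] d34[of 2] d34[of 3] d34[of 4] by (simp_all add: eval_nat_numeral)
    \<comment> \<open>If j >= 1, the chain gives d 5 >= 2 * (3/4)^4 = 81/128 > 1/2. For j = 0 it
      only gives 2 * (3/4)^5 = 243/512, just short of a contradiction.\<close>
    have j0: "j = 0"
    proof -
      have "j = 0 \<or> j = 1 \<or> j = 2 \<or> j = 3 \<or> j = 4 \<or> j = 5" using j(1) by linarith
      thus ?thesis using c d5 dj by (elim disjE) simp_all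
    qed
    have d0: "d 0 \<in> \<int>" "d 0 \<ge> 2" using \<open>d j \<in> \<int>\<close> dj j0 by auto
    have g0: "g 0 = x 0" "g 0 \<in> L" using hkz_systemD(1,2)[OF sys, of 0] by auto
    have min: "z \<bullet> z \<ge> 2" if "z \<in> L" "z \<noteq> 0" for z
      using hkz_systemD(4)[OF sys, of 0 z] that d0(2) by (simp add: d_def)
    have "d 0 < 3" using c d5 by linarith
    hence d02: "d 0 = 2" using d0 by (auto elim!: Ints_cases)
    have d12: "d 1 < 2" using c d5 by linarith
    have small: "c \<in> {-1, 0, 1}" if "c \<in> \<int>" "\<bar>c\<bar> \<le> 1" for c :: real
      using that by (auto elim!: Ints_cases)
    have x1: "x 1 \<in> L" "g 1 = proj_compl g 1 (x 1)" using hkz_systemD(1,2)[OF sys, of 1] by auto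
    \<comment> \<open>\<open>g 0\<close> and the reduced vector \<open>y\<close> turn out to span a
      hexagonal lattice of minimal norm 2: \<open>y \<bullet> g 0\<close> must be a sign, since
      otherwise y would have norm d 1 < 2.\<close>
    have "0 < (6 :: nat)" by simp
    from hkz_size_reduce[OF L sys this x1(1)] obtain y m where y: "y \<in> L"
      "proj_compl g (Suc 0) y = proj_compl g (Suc 0) (x 1)" "\<bar>y \<bullet> g 0\<bar> \<le> (g 0 \<bullet> g 0) / 2" by metis
    have py: "proj_compl g 1 y = g 1" using y(2) x1(2) by simp
    have "\<bar>y \<bullet> g 0\<bar> \<le> 1" using y(3) d02 by (simp add: d_def)
    hence cy: "y \<bullet> g 0 \<in> {-1, 0, 1}" using small unimodular_latticeD(1)[OF L y(1) g0(2)] by blast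
    have ysplit: "y \<bullet> y = d 1 + (y \<bullet> g 0)\<^sup>2 / 2"
      using hkz_norm_split[OF sys, of 0 y] py d02 by (simp add: d_def)
    have "y \<noteq> 0" using py hkz_systemD(3)[OF sys, of 1] by (auto simp: proj_compl_def)
    hence yy: "y \<bullet> y \<ge> 2" by (rule min[OF y(1)])
    have "y \<bullet> g 0 \<noteq> 0" using ysplit yy d12 by auto
    hence sq: "(y \<bullet> g 0)\<^sup>2 = 1" using cy by auto
    have "y \<bullet> y < 3" using ysplit sq d12 by simp
    hence "y \<bullet> y = 2" using yy int[OF y(1)] by (auto elim!: Ints_cases)
    hence d1: "d 1 = 3 / 2" using ysplit sq by simp
    have g1: "g 1 = y - ((y \<bullet> g 0) / 2) *\<^sub>R g 0"
      using py d02 by (simp add: proj_compl_def d_def)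
    have x2: "x 2 \<in> L" "g 2 = proj_compl g 2 (x 2)" using hkz_systemD(1,2)[OF sys, of 2] by auto
    have "1 < (6 :: nat)" by simp
    from hkz_size_reduce[OF L sys this x2(1)] obtain u where u: "u \<in> L"
      "proj_compl g (Suc 1) u = proj_compl g (Suc 1) (x 2)" "\<bar>u \<bullet> g 1\<bar> \<le> (g 1 \<bullet> g 1) / 2" by metis
    have "0 < (6 :: nat)" by simp
    from hkz_size_reduce[OF L sys this u(1)] obtain v n where v: "v \<in> L" "v = u - of_int n *\<^sub>R x 0"
      "proj_compl g (Suc 0) v = proj_compl g (Suc 0) u" "\<bar>v \<bullet> g 0\<bar> \<le> (g 0 \<bullet> g 0) / 2" by metis
    have vg1: "v \<bullet> g 1 = u \<bullet> g 1" using v(2) g0(1) orth[of 0 1] by (simp add: inner_diff_left)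
    have "proj_compl g (Suc 1) v = proj_compl g (Suc 1) u"
      using v(3) vg1 by (simp add: proj_compl_Suc[of g "Suc 0"])
    hence pv: "proj_compl g 2 v = g 2" using u(2) x2(2) by (simp add: numeral_2_eq_2)
    have "\<bar>v \<bullet> g 0\<bar> \<le> 1" using v(4) d02 by (simp add: d_def)
    hence "v \<bullet> g 0 \<in> {-1, 0, 1}" using small unimodular_latticeD(1)[OF L v(1) g0(2)] by blast
    hence sq0: "(v \<bullet> g 0)\<^sup>2 \<le> 1" by auto
    \<comment> \<open>\<open>v \<bullet> g 1\<close> is half an integer, so the bound 3/4 from size
      reduction improves to 1/2.\<close>
    have "2 * (v \<bullet> g 1) = 2 * (v \<bullet> y) - (y \<bullet> g 0) * (v \<bullet> g 0)"
      unfolding g1 by (simp add: inner_diff_right)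
    also have "\<dots> \<in> \<int>"
      using unimodular_latticeD(1)[OF L v(1) y(1)] unimodular_latticeD(1)[OF L y(1) g0(2)] unimodular_latticeD(1)[OF L v(1) g0(2)]
      by (intro Ints_diff Ints_mult) auto
    finally have "2 * (v \<bullet> g 1) \<in> \<int>" .
    then obtain l where l: "2 * (v \<bullet> g 1) = of_int l" by (elim Ints_cases)
    have "\<bar>v \<bullet> g 1\<bar> \<le> 3 / 4" using u(3) vg1 d1 by (simp add: d_def)
    hence "\<bar>of_int l :: real\<bar> < 2" using l by linarith
    hence "\<bar>l\<bar> \<le> 1" by linarith
    hence "\<bar>v \<bullet> g 1\<bar> \<le> 1 / 2" using l by linarith
    hence "\<bar>v \<bullet> g 1\<bar>\<^sup>2 \<le> (1 / 2)\<^sup>2" by (intro power_mono) auto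
    hence sq1: "(v \<bullet> g 1)\<^sup>2 \<le> 1 / 4" by (simp add: power_divide)
    have "v \<bullet> v = proj_compl g 1 v \<bullet> proj_compl g 1 v + (v \<bullet> g 0)\<^sup>2 / 2"
      using hkz_norm_split[OF sys, of 0 v] d02 by (simp add: d_def)
    also have "proj_compl g 1 v \<bullet> proj_compl g 1 v = d 2 + (v \<bullet> g 1)\<^sup>2 / (3 / 2)"
    proof -
      have "proj_compl g 1 v \<bullet> proj_compl g 1 v
          = proj_compl g (Suc 1) v \<bullet> proj_compl g (Suc 1) v + (v \<bullet> g 1)\<^sup>2 / (g 1 \<bullet> g 1)"
        by (rule hkz_norm_split[OF sys]) simp
      also have "Suc 1 = (2::nat)" by simp
      finally show ?thesis using d1 unfolding pv d_def by (simp only:)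
    qed
    \<comment> \<open>1/6 + 1/2 = 2/3 is the squared covering radius of the hexagonal lattice of
      minimal norm 2. The resulting bound d 2 >= 4/3 gives d 5 >= (27/64)(4/3) = 9/16 > 1/2.\<close>
    finally have "v \<bullet> v \<le> d 2 + 1 / 6 + 1 / 2" using sq0 sq1 by simp
    moreover have "v \<noteq> 0" using pv hkz_systemD(3)[OF sys, of 2] by (auto simp: proj_compl_def)
    hence "v \<bullet> v \<ge> 2" by (rule min[OF v(1)])
    ultimately have "d 2 \<ge> 4 / 3" by simp
    thus False using c d5 by linarith
  qed
  have unit: "g i \<bullet> g i = 1" if "i < 6" for i using all1 that by (simp add: d_def)
  have "x = (\<Sum>k<6. (x \<bullet> g k) *\<^sub>R g k)" for x
    using hkz_proj_compl_DIM[OF sysD, of x] unit by (simp add: dim proj_compl_def)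
  hence expand: "x = (\<Sum>k<6. (x \<bullet> g k) *\<^sub>R g k)" for x .
  have "x \<bullet> y = (\<Sum>k<6. (x \<bullet> g k) * (y \<bullet> g k))" for x y
  proof -
    have "x \<bullet> y = (\<Sum>k<6. (x \<bullet> g k) *\<^sub>R g k) \<bullet> y" using expand[of x] by simp
    thus ?thesis by (simp add: inner_sum_left inner_commute[of "g _" y])
  qed
  moreover have "g k \<in> L" if "k < 6" for k
    by (rule hkz_unit_prefix(1)[OF L sys _ unit that]) auto
  ultimately show ?thesis by blast
qed

section \<open>Ternary forms as sums of six squares\<close>

text \<open>Orthogonalization of the coefficient vectors against \<open>u\<close>. The remainder is
  again a sum of squares of rational linear forms, so the step can be repeated and all diagonal
  coefficients are nonnegative. If \<open>u\<close> vanishes on \<open>I\<close>, the coefficient is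
  0: the form may be degenerate.\<close>

lemma complete_square:
  fixes u v w :: "'i \<Rightarrow> real"
  assumes I: "finite I" and rat: "\<And>i. u i \<in> \<rat>" "\<And>i. v i \<in> \<rat>" "\<And>i. w i \<in> \<rat>"
  obtains a l m v' w' where "a \<in> \<rat>" "a \<ge> 0" "l \<in> \<rat>" "m \<in> \<rat>" "\<forall>i. v' i \<in> \<rat>" "\<forall>i. w' i \<in> \<rat>"
    "\<forall>X Y Z. (\<Sum>i\<in>I. (u i * X + v i * Y + w i * Z)\<^sup>2) = a * (X + l * Y + m * Z)\<^sup>2 + (\<Sum>i\<in>I. (v' i * Y + w' i * Z)\<^sup>2)"
proof (cases "(\<Sum>i\<in>I. (u i)\<^sup>2) = 0")
  case True
  hence "\<And>i. i \<in> I \<Longrightarrow> u i = 0" using I by (simp add: sum_nonneg_eq_0_iff)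
  hence "(\<Sum>i\<in>I. (u i * X + v i * Y + w i * Z)\<^sup>2) = 0 * (X + 0 * Y + 0 * Z)\<^sup>2 + (\<Sum>i\<in>I. (v i * Y + w i * Z)\<^sup>2)" for X Y Z
    by simp
  thus ?thesis using rat by (intro that[of 0 0 0 v w]) simp_all
next
  case False
  define a l m where "a = (\<Sum>i\<in>I. (u i)\<^sup>2)" and "l = (\<Sum>i\<in>I. u i * v i) / a" and "m = (\<Sum>i\<in>I. u i * w i) / a"
  define v' w' where "v' = (\<lambda>i. v i - l * u i)" and "w' = (\<lambda>i. w i - m * u i)"
  have a: "a \<ge> 0" "a \<noteq> 0" using False by (auto simp: a_def intro: sum_nonneg)
  have aq: "a \<in> \<rat>" "l \<in> \<rat>" "m \<in> \<rat>" unfolding a_def l_def m_def using rat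
    by (auto intro!: Rats_sum Rats_divide Rats_mult Rats_power)
  have q: "v' i \<in> \<rat>" "w' i \<in> \<rat>" for i unfolding v'_def w'_def using rat aq by auto
  have "(\<Sum>i\<in>I. u i * v' i) = (\<Sum>i\<in>I. u i * v i) - l * a"
    by (simp add: v'_def a_def right_diff_distrib sum_subtractf sum_distrib_left power2_eq_square mult_ac)
  hence o1: "(\<Sum>i\<in>I. u i * v' i) = 0" using a by (simp add: l_def)
  have "(\<Sum>i\<in>I. u i * w' i) = (\<Sum>i\<in>I. u i * w i) - m * a"
    by (simp add: w'_def a_def right_diff_distrib sum_subtractf sum_distrib_left power2_eq_square mult_ac)
  hence o2: "(\<Sum>i\<in>I. u i * w' i) = 0" using a by (simp add: m_def)
  have "(\<Sum>i\<in>I. (u i * X + v i * Y + w i * Z)\<^sup>2) = a * (X + l * Y + m * Z)\<^sup>2 + (\<Sum>i\<in>I. (v' i * Y + w' i * Z)\<^sup>2)" for X Y Z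
  proof -
    define T where "T = X + l * Y + m * Z"
    have "(\<Sum>i\<in>I. (u i * X + v i * Y + w i * Z)\<^sup>2) = (\<Sum>i\<in>I. (u i)\<^sup>2 * T\<^sup>2 + (2 * T * Y) * (u i * v' i) + (2 * T * Z) * (u i * w' i) + (v' i * Y + w' i * Z)\<^sup>2)"
      by (intro sum.cong refl) (simp add: T_def v'_def w'_def power2_eq_square algebra_simps)
    also have "\<dots> = a * T\<^sup>2 + (2 * T * Y) * (\<Sum>i\<in>I. u i * v' i) + (2 * T * Z) * (\<Sum>i\<in>I. u i * w' i) + (\<Sum>i\<in>I. (v' i * Y + w' i * Z)\<^sup>2)"
      by (simp only: sum.distrib sum_distrib_left[symmetric] sum_distrib_right[symmetric] a_def)
    finally show ?thesis using o1 o2 by (simp add: T_def)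
  qed
  with q show ?thesis by (intro that[OF aq(1) a(1) aq(2,3)] allI)
qed

lemma nonneg_rat_square_class:
  assumes "a \<in> \<rat>" "a \<ge> (0::real)"
  shows "\<exists>A t. squarefree (A::nat) \<and> t \<in> \<rat> \<and> a = real A * t\<^sup>2"
proof (cases "a = 0")
  case True
  \<comment> \<open>The zero goes into t, so that A remains squarefree and degenerate forms are
    covered by the same embedding.\<close>
  thus ?thesis by (intro exI[of _ 1] exI[of _ 0]) simp
next
  case False
  obtain p q :: int where pq: "a = of_int p / of_int q" "q > 0" using assms(1) by (auto elim: Rats_cases')
  have p: "p > 0" using False assms(2) pq by (simp add: zero_le_divide_iff zero_less_divide_iff order_less_le)
  define n where "n = nat (p * q)"
  have "real n = of_int (p * q)" using p pq by (simp add: n_def)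
  hence "a = real n / (of_int q)\<^sup>2" using pq by (simp add: power2_eq_square)
  also have "real n = real (squarefree_part n) * (real (square_part n))\<^sup>2"
    by (metis squarefree_decompose of_nat_mult of_nat_power)
  finally have "a = real (squarefree_part n) * (real (square_part n) / of_int q)\<^sup>2" by (simp add: power_divide)
  thus ?thesis by (intro exI[of _ "squarefree_part n"] exI[of _ "real (square_part n) / of_int q"]) auto
qed

lemma inner_Basis_gaussian_rats:
  assumes "x \<in> gaussian_rats \<times> gaussian_rats \<times> gaussian_rats" "b \<in> Basis"
  shows "x \<bullet> b \<in> \<rat>"
  using assms by (auto simp: Basis_prod_def Basis_complex_def inner_complex_def gaussian_rats_def)

text \<open>Undoing the diagonalization after the embedding gives W1, W2, W3 in Q(i)^3 with exactly
  the given Gram matrix. It is integral although the vectors are only rational, and coordinates in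
  an orthonormal lattice basis turn them into integer vectors.\<close>

theorem ternary_six_squares:
  fixes u v w :: "'i \<Rightarrow> int"
  assumes I: "finite I"
  shows "\<exists>p q r :: nat \<Rightarrow> int.
    (\<Sum>k<6. (p k)\<^sup>2) = (\<Sum>i\<in>I. (u i)\<^sup>2) \<and> (\<Sum>k<6. (q k)\<^sup>2) = (\<Sum>i\<in>I. (v i)\<^sup>2) \<and> (\<Sum>k<6. (r k)\<^sup>2) = (\<Sum>i\<in>I. (w i)\<^sup>2) \<and>
    (\<Sum>k<6. p k * q k) = (\<Sum>i\<in>I. u i * v i) \<and> (\<Sum>k<6. p k * r k) = (\<Sum>i\<in>I. u i * w i) \<and> (\<Sum>k<6. q k * r k) = (\<Sum>i\<in>I. v i * w i)"
proof -
  define Q where "Q = (\<lambda>X Y Z. \<Sum>i\<in>I. (real_of_int (u i) * X + real_of_int (v i) * Y + real_of_int (w i) * Z)\<^sup>2)"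
  obtain a l m v1 w1 where 1: "a \<in> \<rat>" "a \<ge> 0" "l \<in> \<rat>" "m \<in> \<rat>" "\<forall>i. v1 i \<in> \<rat>" "\<forall>i. w1 i \<in> \<rat>"
    "\<forall>X Y Z. Q X Y Z = a * (X + l * Y + m * Z)\<^sup>2 + (\<Sum>i\<in>I. (v1 i * Y + w1 i * Z)\<^sup>2)"
    unfolding Q_def by (rule complete_square[OF I Rats_of_int Rats_of_int Rats_of_int])
  obtain b n m' w2 z2 where 2: "b \<in> \<rat>" "b \<ge> 0" "n \<in> \<rat>" "m' \<in> \<rat>" "\<forall>i. w2 i \<in> \<rat>" "\<forall>i. z2 i \<in> \<rat>"
    "\<forall>X Y Z. (\<Sum>i\<in>I. (v1 i * X + w1 i * Y + 0 * Z)\<^sup>2) = b * (X + n * Y + m' * Z)\<^sup>2 + (\<Sum>i\<in>I. (w2 i * Y + z2 i * Z)\<^sup>2)"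
    by (rule complete_square[OF I 1(5,6)[rule_format] Rats_0])
  obtain c where 3: "c \<in> \<rat>" "c \<ge> 0" "\<And>Z. (\<Sum>i\<in>I. (w2 i * Z)\<^sup>2) = c * Z\<^sup>2"
  proof
    show "(\<Sum>i\<in>I. (w2 i)\<^sup>2) \<in> \<rat>" using 2(5) by (auto intro!: Rats_sum Rats_power)
    show "(\<Sum>i\<in>I. (w2 i * Z)\<^sup>2) = (\<Sum>i\<in>I. (w2 i)\<^sup>2) * Z\<^sup>2" for Z by (simp add: power_mult_distrib sum_distrib_right)
  qed (auto intro: sum_nonneg)
  have Q: "Q X Y Z = a * (X + l * Y + m * Z)\<^sup>2 + b * (Y + n * Z)\<^sup>2 + c * Z\<^sup>2" for X Y Z
    using 1(7)[rule_format, of X Y Z] 2(7)[rule_format, of Y Z 0] 3(3)[of Z] by simp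
  obtain A ta where A: "squarefree (A::nat)" "ta \<in> \<rat>" "a = real A * ta\<^sup>2" using nonneg_rat_square_class[OF 1(1,2)] by blast
  obtain B tb where B: "squarefree (B::nat)" "tb \<in> \<rat>" "b = real B * tb\<^sup>2" using nonneg_rat_square_class[OF 2(1,2)] by blast
  obtain C tc where C: "squarefree (C::nat)" "tc \<in> \<rat>" "c = real C * tc\<^sup>2" using nonneg_rat_square_class[OF 3(1,2)] by blast
  obtain V1 V2 V3 :: "complex \<times> complex \<times> complex" where V: "{V1, V2, V3} \<subseteq> gaussian_rats \<times> gaussian_rats \<times> gaussian_rats"
    "\<And>X Y Z. (norm (X *\<^sub>R V1 + Y *\<^sub>R V2 + Z *\<^sub>R V3))\<^sup>2 = real A * X\<^sup>2 + real B * Y\<^sup>2 + real C * Z\<^sup>2"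
    using ternary_form_embedding[OF A(1) B(1) C(1)] by blast
  define W1 W2 W3 where "W1 = ta *\<^sub>R V1" and "W2 = (ta * l) *\<^sub>R V1 + tb *\<^sub>R V2"
    and "W3 = (ta * m) *\<^sub>R V1 + (tb * n) *\<^sub>R V2 + tc *\<^sub>R V3"
  have normW: "(norm (X *\<^sub>R W1 + Y *\<^sub>R W2 + Z *\<^sub>R W3))\<^sup>2 = Q X Y Z" for X Y Z
  proof -
    have "X *\<^sub>R W1 + Y *\<^sub>R W2 + Z *\<^sub>R W3 = (ta * (X + l * Y + m * Z)) *\<^sub>R V1 + (tb * (Y + n * Z)) *\<^sub>R V2 + (tc * Z) *\<^sub>R V3"
      unfolding W1_def W2_def W3_def by (simp add: algebra_simps)
    thus ?thesis unfolding Q A(3) B(3) C(3) by (simp only: V(2) power_mult_distrib mult.assoc)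
  qed
  define X where "X = {W1, W2, W3}"
  have ipol: "x \<bullet> y = ((norm (x + y))\<^sup>2 - (norm x)\<^sup>2 - (norm y)\<^sup>2) / 2" for x y :: "complex \<times> complex \<times> complex"
    by (simp add: power2_norm_eq_inner inner_add_left inner_add_right inner_commute[of y x])
  have n1: "(norm W1)\<^sup>2 = Q 1 0 0" "(norm W2)\<^sup>2 = Q 0 1 0" "(norm W3)\<^sup>2 = Q 0 0 1" "(norm (W1 + W2))\<^sup>2 = Q 1 1 0"
    "(norm (W1 + W3))\<^sup>2 = Q 1 0 1" "(norm (W2 + W3))\<^sup>2 = Q 0 1 1"
    using normW[of 1 0 0] normW[of 0 1 0] normW[of 0 0 1] normW[of 1 1 0] normW[of 1 0 1] normW[of 0 1 1] by simp_all
  have sq: "(\<Sum>i\<in>I. (real_of_int (s i) + real_of_int (t i))\<^sup>2) - (\<Sum>i\<in>I. (real_of_int (s i))\<^sup>2) - (\<Sum>i\<in>I. (real_of_int (t i))\<^sup>2)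
    = 2 * of_int (\<Sum>i\<in>I. s i * t i)" for s t :: "'i \<Rightarrow> int"
    unfolding of_int_sum sum_subtractf[symmetric] sum_distrib_left
    by (intro sum.cong refl) (simp add: power2_eq_square algebra_simps)
  have gram: "W1 \<bullet> W1 = of_int (\<Sum>i\<in>I. (u i)\<^sup>2)" "W2 \<bullet> W2 = of_int (\<Sum>i\<in>I. (v i)\<^sup>2)" "W3 \<bullet> W3 = of_int (\<Sum>i\<in>I. (w i)\<^sup>2)"
    "W1 \<bullet> W2 = of_int (\<Sum>i\<in>I. u i * v i)" "W1 \<bullet> W3 = of_int (\<Sum>i\<in>I. u i * w i)" "W2 \<bullet> W3 = of_int (\<Sum>i\<in>I. v i * w i)"
  proof -
    show "W1 \<bullet> W1 = of_int (\<Sum>i\<in>I. (u i)\<^sup>2)" "W2 \<bullet> W2 = of_int (\<Sum>i\<in>I. (v i)\<^sup>2)" "W3 \<bullet> W3 = of_int (\<Sum>i\<in>I. (w i)\<^sup>2)"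
      using n1(1,2,3) by (simp_all add: power2_norm_eq_inner Q_def)
    show "W1 \<bullet> W2 = of_int (\<Sum>i\<in>I. u i * v i)" "W1 \<bullet> W3 = of_int (\<Sum>i\<in>I. u i * w i)" "W2 \<bullet> W3 = of_int (\<Sum>i\<in>I. v i * w i)"
      unfolding ipol n1 using sq[of u v] sq[of u w] sq[of v w] by (simp_all add: Q_def)
  qed
  have intX: "x \<bullet> y \<in> \<int>" if "x \<in> X" "y \<in> X" for x y
    using that gram unfolding X_def by (auto simp: inner_commute simp del: of_int_sum)
  have ratX: "x \<bullet> b \<in> \<rat>" if "x \<in> X" "b \<in> Basis" for x b
  proof -
    have "V1 \<bullet> b \<in> \<rat>" "V2 \<bullet> b \<in> \<rat>" "V3 \<bullet> b \<in> \<rat>" using V(1) that(2) inner_Basis_gaussian_rats by auto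
    thus ?thesis using that(1) A(2) B(2) C(2) 1(3,4) 2(3) unfolding X_def W1_def W2_def W3_def
      by (auto simp: inner_add_left)
  qed
  have "finite X" by (simp add: X_def)
  from integral_family_in_unimodular_lattice[OF this intX ratX]
  obtain L where L: "unimodular_lattice L" "X \<subseteq> L" by blast
  have "DIM(complex \<times> complex \<times> complex) = 6" by simp
  from unimodular_lattice_dim_6[OF L(1) this]
  obtain e where e: "\<forall>k<6. e k \<in> L" "\<And>x y. x \<bullet> y = (\<Sum>k<(6::nat). (x \<bullet> e k) * (y \<bullet> e k))" by blast
  \<comment> \<open>The floor only converts a real number that is an integer into an
    \<open>int\<close>.\<close>
  define co where "co = (\<lambda>x k. \<lfloor>x \<bullet> e k\<rfloor>)"
  have co: "x \<bullet> e k = of_int (co x k)" if "x \<in> X" "k < 6" for x k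
  proof -
    have "x \<bullet> e k \<in> \<int>" using unimodular_latticeD(1)[OF L(1)] e(1) that L(2) by blast
    thus ?thesis unfolding co_def by (auto elim!: Ints_cases)
  qed
  have inner: "x \<bullet> y = of_int (\<Sum>k<6. co x k * co y k)" if "x \<in> X" "y \<in> X" for x y
    unfolding e(2)[of x y] of_int_sum of_int_mult by (intro sum.cong refl) (use co that in auto)
  have mem: "W1 \<in> X" "W2 \<in> X" "W3 \<in> X" by (auto simp: X_def)
  show ?thesis
    using inner[OF mem(1) mem(1)] inner[OF mem(2) mem(2)] inner[OF mem(3) mem(3)]
      inner[OF mem(1) mem(2)] inner[OF mem(1) mem(3)] inner[OF mem(2) mem(3)]
    unfolding gram of_int_eq_iff power2_eq_square
    by (intro exI[of _ "co W1"] exI[of _ "co W2"] exI[of _ "co W3"]) simp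
qed

theorem theorem1p2:
  fixes a :: int and \<rho> :: complex
  assumes "a \<ge> 4"
    and "poly (map_poly of_int [:-1, -a, a - 1, 1:]) \<rho> = 0"
  shows "pythagoras_number (int_adjoin \<rho>) = 6"
proof -
  let ?R = "int_adjoin \<rho>"
  have \<rho>: "\<rho> ^ 3 + of_int (a - 1) * \<rho>\<^sup>2 - of_int a * \<rho> - 1 = 0"
    using assms(2) by (simp add: map_poly_pCons algebra_simps power2_eq_square power3_eq_cube)
  have sub: "sums_of_at_most_squares m ?R \<subseteq> sums_of_squares ?R" for m
    unfolding sums_of_at_most_squares_def sums_of_squares_def by blast
  have "sums_of_squares ?R \<subseteq> sums_of_at_most_squares 6 ?R"
  proof
    fix x assume "x \<in> sums_of_squares ?R"
    then obtain ys where ys: "x = (\<Sum>y\<leftarrow>ys. y\<^sup>2)" "set ys \<subseteq> ?R" unfolding sums_of_squares_def by blast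
    have "\<exists>u v w. i < length ys \<longrightarrow> ys ! i = Zcomb a \<rho> u v w" for i
    proof (cases "i < length ys")
      case True
      hence "ys ! i \<in> {Zcomb a \<rho> u v w | u v w. True}"
        using ys(2) nth_mem unfolding int_adjoin_eq_Zcomb[OF \<rho>] by blast
      thus ?thesis by blast
    qed simp
    then obtain u v w where uvw: "\<And>i. i < length ys \<Longrightarrow> ys ! i = Zcomb a \<rho> (u i) (v i) (w i)" by metis
    let ?I = "{..<length ys}"
    obtain p q r :: "nat \<Rightarrow> int" where pqr:
      "(\<Sum>k<6. (p k)\<^sup>2) = (\<Sum>i\<in>?I. (u i)\<^sup>2)" "(\<Sum>k<6. (q k)\<^sup>2) = (\<Sum>i\<in>?I. (v i)\<^sup>2)" "(\<Sum>k<6. (r k)\<^sup>2) = (\<Sum>i\<in>?I. (w i)\<^sup>2)"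
      "(\<Sum>k<6. p k * q k) = (\<Sum>i\<in>?I. u i * v i)" "(\<Sum>k<6. p k * r k) = (\<Sum>i\<in>?I. u i * w i)" "(\<Sum>k<6. q k * r k) = (\<Sum>i\<in>?I. v i * w i)"
      using ternary_six_squares[of ?I u v w] by auto
    have gram: "(\<Sum>i\<in>J. (Zcomb a \<rho> (u' i) (v' i) (w' i))\<^sup>2) = Zcomb a \<rho>
      ((\<Sum>i\<in>J. (u' i)\<^sup>2) + a * (\<Sum>i\<in>J. (v' i)\<^sup>2) + (a - 1) * (\<Sum>i\<in>J. (w' i)\<^sup>2) + 2 * (\<Sum>i\<in>J. v' i * w' i))
      ((\<Sum>i\<in>J. (w' i)\<^sup>2) - (a - 1) * (\<Sum>i\<in>J. (v' i)\<^sup>2) + 2 * (\<Sum>i\<in>J. u' i * v' i))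
      ((\<Sum>i\<in>J. (v' i)\<^sup>2) - a * (\<Sum>i\<in>J. (w' i)\<^sup>2) + 2 * (\<Sum>i\<in>J. u' i * w' i))" for J :: "nat set" and u' v' w'
      unfolding Zcomb_power2[OF \<rho>] Zcomb_sum by (simp only: sum.distrib sum_subtractf sum_distrib_left)
    define zs where "zs = map (\<lambda>k. Zcomb a \<rho> (p k) (q k) (r k)) [0..<6]"
    have "x = (\<Sum>i\<in>?I. (Zcomb a \<rho> (u i) (v i) (w i))\<^sup>2)"
      unfolding ys(1) by (simp add: sum_list_sum_nth atLeast0LessThan uvw)
    also have "\<dots> = (\<Sum>k<6. (Zcomb a \<rho> (p k) (q k) (r k))\<^sup>2)"
      unfolding gram pqr ..
    also have "\<dots> = (\<Sum>z\<leftarrow>zs. z\<^sup>2)"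
      by (simp add: zs_def sum_list_sum_nth atLeast0LessThan)
    finally have "x = (\<Sum>z\<leftarrow>zs. z\<^sup>2)" .
    moreover have "set zs \<subseteq> ?R" unfolding int_adjoin_eq_Zcomb[OF \<rho>] zs_def by auto
    moreover have "enat (length zs) \<le> 6" by (simp add: zs_def numeral_eq_enat)
    ultimately show "x \<in> sums_of_at_most_squares 6 ?R" unfolding sums_of_at_most_squares_def by blast
  qed
  hence 6: "sums_of_squares ?R = sums_of_at_most_squares 6 ?R" using sub by blast
  \<comment> \<open>An admissible m below 6 is finite and may be enlarged to 5, since m bounds the
    number of squares from above.\<close>
  have "6 \<le> m" if m: "sums_of_squares ?R = sums_of_at_most_squares m ?R" for m
  proof (rule ccontr)
    assume "\<not> 6 \<le> m"
    then obtain n where n: "m = enat n" "n \<le> 5" by (cases m) (auto simp: numeral_eq_enat)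
    have "sums_of_at_most_squares m ?R \<subseteq> sums_of_at_most_squares 5 ?R"
      unfolding sums_of_at_most_squares_def using n by (auto simp: numeral_eq_enat)
    thus False using exists_sum_of_squares_not_five[OF \<rho> assms(1)] m by blast
  qed
  thus ?thesis unfolding pythagoras_number_def using 6
    by (intro antisym Inf_lower Inf_greatest) auto
qed

end
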